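(* The variety $\widehat P=\widehat P(n_1,\dots,n_l,n)$ is a small toric desingularization of $P=P(n_1,\dots,n_l,n)$; that is, the fan $\widehat\Sigma$ is a refinement of the fan $\Sigma$, the toric variety $\widehat P$ is smooth, and the toric morphism $\widehat P\to P$ induced by the refinement contracts no divisor.
   Context: Let $l\ge 1$ and let $k_1,\dots,k_{l+1}$ be positive integers; put $n_0=0$, $n_i=k_1+\dots+k_i$ and $n=n_{l+1}$. Ladder diagram. $\Lambda\subset\mathbb{R}^2$ is the union of the unit squares $[a-1,a]\times[c-1,c]$ ($a,c\ge1$ integers) such that $1\le c\le n-n_i$, where $i$ is the index with $n_{i-1}<a\le n_i$. Graph $\Gamma$. $D$ is the set of centers of the unit squares of $\Lambda$ ("dots"). $S=\{s_1,\dots,s_{l+1}\}$ is the set of "stars" $s_i=(n_{i-1}+\tfrac12,\,n-n_i+\tfrac12)$. $E$ is the set of horizontal and vertical unit segments joining two elements of $D\cup S$ at distance $1$; horizontal edges are oriented to the right and vertical edges downwards. $\Gamma$ is the oriented graph with vertex set $D\cup S$ and edge set $E$; $h(e)$ and $t(e)$ denote the head and tail of $e\in E$. $L(D),L(S),L(E)$ are the free abelian groups on $D,S,E$, and $\delta:L(E)\to L(D)$ is the composition of $\partial:L(E)\to L(D)\oplus L(S)$, $\partial(e)=h(e)-t(e)$, with the projection $L(D)\oplus L(S)\to L(D)$. Boxes, corners, roofs. A box is a set $b\subset E$ of four edges forming a $4$-cycle (unit square) in $\Gamma$; $B$ is the set of boxes. The corner $\mathcal{C}_b$ of $b$ is the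 pair of edges of $b$ meeting at its lower left vertex. The $i$-th roof $\mathcal{R}_i$ ($1\le i\le l$) is the set of $k_i+k_{i+1}$ edges of the oriented path from $s_i$ to $s_{i+1}$ along the upper right boundary of $\Gamma$: from $s_i$ one step down, $k_i-1$ steps to the right, $k_{i+1}-1$ steps down, one step to the right to $s_{i+1}$. The set $E$ is the disjoint union of all roofs and all corners. Toric varieties. $\Delta$ is the convex hull of $\delta(E)$ in $L(D)\otimes\mathbb{R}$; $\Sigma$ is the complete fan of cones over all proper faces of $\Delta$; $P$ is the toric variety over $\mathbb{C}$ associated with $\Sigma$ in the lattice $L(D)$. $\widehat\Sigma$ is the simplicial fan with the same one-dimensional cones as $\Sigma$ (generated by the $\delta(e)$, $e\in E$) and with primitive collections $\mathcal{R}_1,\dots,\mathcal{R}_l$ and $\mathcal{C}_b$, $b\in B$; that is, its maximal cones are the cones generated by $\{\delta(e): e\in G\}$, where $G\subset E$ is obtained by omitting exactly one edge from each roof and exactly one edge from each corner. $\widehat P$ is the toric variety associated with $\widehat\Sigma$. *)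

theory Defs
  imports "HOL-Analysis.Analysis" "HOL-Analysis.Finite_Function_Topology"
begin

section \<open>Fans in the lattice of a finite set\<close>

text \<open>
  For a finite set \<open>D\<close> the lattice \<open>N = L(D)\<close> is the free abelian group on \<open>D\<close>, regarded
  inside \<open>N \<otimes> \<real>\<close>, which is the space of the \<open>v :: 'd \<Rightarrow>\<^sub>0 real\<close> with support in \<open>D\<close>.
  The dual lattice \<open>M = Hom(N, \<int>)\<close> is written in the dual basis: its elements are the
  \<open>m :: 'd \<Rightarrow>\<^sub>0 int\<close> with support in \<open>D\<close>.
\<close>

definition lattice_points :: "'d set \<Rightarrow> ('d \<Rightarrow>\<^sub>0 real) set" where
  "lattice_points D =
     {v. Poly_Mapping.keys v \<subseteq> D \<and> (\<forall>d. Poly_Mapping.lookup v d \<in> \<int>)}"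

definition pairing :: "('d \<Rightarrow>\<^sub>0 int) \<Rightarrow> ('d \<Rightarrow>\<^sub>0 real) \<Rightarrow> real" where
  "pairing m v =
     (\<Sum>d\<in>Poly_Mapping.keys m. real_of_int (Poly_Mapping.lookup m d) * Poly_Mapping.lookup v d)"

definition rational_polyhedral_cone :: "'d set \<Rightarrow> ('d \<Rightarrow>\<^sub>0 real) set \<Rightarrow> bool" where
  "rational_polyhedral_cone D \<sigma> \<longleftrightarrow>
     (\<exists>V. finite V \<and> V \<subseteq> lattice_points D \<and> \<sigma> = convex_cone hull V)"

definition strongly_convex :: "('d \<Rightarrow>\<^sub>0 real) set \<Rightarrow> bool" where
  "strongly_convex \<sigma> \<longleftrightarrow> \<sigma> \<inter> uminus ` \<sigma> = {0}"

text \<open>The relation \<open>face_of\<close> counts the empty set as a face; faces of cones are nonempty.\<close>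

definition is_fan :: "'d set \<Rightarrow> ('d \<Rightarrow>\<^sub>0 real) set set \<Rightarrow> bool" where
  "is_fan D \<Sigma> \<longleftrightarrow>
     finite \<Sigma> \<and> \<Sigma> \<noteq> {} \<and>
     (\<forall>\<sigma>\<in>\<Sigma>. rational_polyhedral_cone D \<sigma> \<and> strongly_convex \<sigma>) \<and>
     (\<forall>\<sigma>\<in>\<Sigma>. \<forall>\<tau>. \<tau> face_of \<sigma> \<and> \<tau> \<noteq> {} \<longrightarrow> \<tau> \<in> \<Sigma>) \<and>
     (\<forall>\<sigma>\<in>\<Sigma>. \<forall>\<tau>\<in>\<Sigma>. \<sigma> \<inter> \<tau> face_of \<sigma> \<and> \<sigma> \<inter> \<tau> face_of \<tau>)"

definition fan_refinement ::
    "'d set \<Rightarrow> ('d \<Rightarrow>\<^sub>0 real) set set \<Rightarrow> ('d \<Rightarrow>\<^sub>0 real) set set \<Rightarrow> bool" where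
  "fan_refinement D \<Sigma>' \<Sigma> \<longleftrightarrow>
     is_fan D \<Sigma>' \<and> is_fan D \<Sigma> \<and> \<Union>\<Sigma>' = \<Union>\<Sigma> \<and> (\<forall>\<sigma>'\<in>\<Sigma>'. \<exists>\<sigma>\<in>\<Sigma>. \<sigma>' \<subseteq> \<sigma>)"


section \<open>Toric varieties over the complex numbers\<close>

subsection \<open>Affine charts\<close>

definition dual_monoid :: "'d set \<Rightarrow> ('d \<Rightarrow>\<^sub>0 real) set \<Rightarrow> ('d \<Rightarrow>\<^sub>0 int) set" where
  "dual_monoid D \<sigma> = {m. Poly_Mapping.keys m \<subseteq> D \<and> (\<forall>v\<in>\<sigma>. 0 \<le> pairing m v)}"

text \<open>
  The semigroup algebra \<open>\<complex>[\<sigma>\<^sup>\<or> \<inter> M]\<close>, as a subring of the group algebra of \<open>'d \<Rightarrow>\<^sub>0 int\<close>,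
  whose multiplication is the convolution product of \<open>poly_mapping\<close>.
\<close>

definition coordinate_ring ::
    "'d set \<Rightarrow> ('d \<Rightarrow>\<^sub>0 real) set \<Rightarrow> (('d \<Rightarrow>\<^sub>0 int) \<Rightarrow>\<^sub>0 complex) set" where
  "coordinate_ring D \<sigma> = {f. Poly_Mapping.keys f \<subseteq> dual_monoid D \<sigma>}"

text \<open>
  The (closed) points of \<open>U\<^sub>\<sigma> = Spec \<complex>[\<sigma>\<^sup>\<or> \<inter> M]\<close>: monoid homomorphisms from \<open>\<sigma>\<^sup>\<or> \<inter> M\<close> to the
  multiplicative monoid \<open>\<complex>\<close>, extended by \<open>0\<close>.
\<close>

definition affine_chart ::
    "'d set \<Rightarrow> ('d \<Rightarrow>\<^sub>0 real) set \<Rightarrow> (('d \<Rightarrow>\<^sub>0 int) \<Rightarrow> complex) set" where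
  "affine_chart D \<sigma> =
     {x. x 0 = 1 \<and>
         (\<forall>m\<in>dual_monoid D \<sigma>. \<forall>m'\<in>dual_monoid D \<sigma>. x (m + m') = x m * x m') \<and>
         (\<forall>m. m \<notin> dual_monoid D \<sigma> \<longrightarrow> x m = 0)}"

definition eval_at :: "('m \<Rightarrow> complex) \<Rightarrow> ('m \<Rightarrow>\<^sub>0 complex) \<Rightarrow> complex" where
  "eval_at x f = (\<Sum>m\<in>Poly_Mapping.keys f. Poly_Mapping.lookup f m * x m)"

text \<open>For \<open>\<sigma>' \<subseteq> \<sigma>\<close> this is the map \<open>U\<^bsub>\<sigma>'\<^esub> \<rightarrow> U\<^bsub>\<sigma>\<^esub>\<close> dual to \<open>\<sigma>\<^sup>\<or> \<inter> M \<subseteq> \<sigma>'\<^sup>\<or> \<inter> M\<close>.\<close>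

definition restrict_point ::
    "'d set \<Rightarrow> ('d \<Rightarrow>\<^sub>0 real) set \<Rightarrow> (('d \<Rightarrow>\<^sub>0 int) \<Rightarrow> complex) \<Rightarrow> ('d \<Rightarrow>\<^sub>0 int) \<Rightarrow> complex" where
  "restrict_point D \<sigma> x = (\<lambda>m. if m \<in> dual_monoid D \<sigma> then x m else 0)"

subsection \<open>Gluing\<close>

type_synonym 'd chart_point = "('d \<Rightarrow>\<^sub>0 real) set \<times> (('d \<Rightarrow>\<^sub>0 int) \<Rightarrow> complex)"

definition chart_points :: "'d set \<Rightarrow> ('d \<Rightarrow>\<^sub>0 real) set set \<Rightarrow> 'd chart_point set" where
  "chart_points D \<Sigma> = (SIGMA \<sigma>:\<Sigma>. affine_chart D \<sigma>)"

definition glue :: "'d set \<Rightarrow> ('d \<Rightarrow>\<^sub>0 real) set set \<Rightarrow> 'd chart_point rel" where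
  "glue D \<Sigma> =
     {((\<sigma>, x), (\<tau>, y)).
        (\<sigma>, x) \<in> chart_points D \<Sigma> \<and> (\<tau>, y) \<in> chart_points D \<Sigma> \<and>
        (\<exists>z\<in>affine_chart D (\<sigma> \<inter> \<tau>). x = restrict_point D \<sigma> z \<and> y = restrict_point D \<tau> z)}"

definition toric_variety :: "'d set \<Rightarrow> ('d \<Rightarrow>\<^sub>0 real) set set \<Rightarrow> 'd chart_point set set" where
  "toric_variety D \<Sigma> = chart_points D \<Sigma> // glue D \<Sigma>"

definition principal_open ::
    "'d set \<Rightarrow> ('d \<Rightarrow>\<^sub>0 real) set set \<Rightarrow> ('d \<Rightarrow>\<^sub>0 real) set \<Rightarrow> (('d \<Rightarrow>\<^sub>0 int) \<Rightarrow>\<^sub>0 complex) \<Rightarrow>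
       'd chart_point set set" where
  "principal_open D \<Sigma> \<sigma> f = {glue D \<Sigma> `` {(\<sigma>, x)} | x. x \<in> affine_chart D \<sigma> \<and> eval_at x f \<noteq> 0}"

text \<open>The topological space has underlying set \<open>toric_variety D \<Sigma>\<close> (take \<open>f = 1\<close>).\<close>

definition zariski :: "'d set \<Rightarrow> ('d \<Rightarrow>\<^sub>0 real) set set \<Rightarrow> 'd chart_point set topology" where
  "zariski D \<Sigma> =
     topology_generated_by {principal_open D \<Sigma> \<sigma> f | \<sigma> f. \<sigma> \<in> \<Sigma> \<and> f \<in> coordinate_ring D \<sigma>}"

text \<open>
  The toric morphism of a refinement \<open>\<Sigma>'\<close> of \<open>\<Sigma>\<close>, glued from the maps \<open>U\<^bsub>\<sigma>'\<^esub> \<rightarrow> U\<^bsub>\<sigma>\<^esub>\<close>,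
  \<open>\<sigma>' \<subseteq> \<sigma>\<close>. All the classes in the union are equal.
\<close>

definition toric_morphism ::
    "'d set \<Rightarrow> ('d \<Rightarrow>\<^sub>0 real) set set \<Rightarrow> 'd chart_point set \<Rightarrow> 'd chart_point set" where
  "toric_morphism D \<Sigma> p =
     (\<Union>(\<sigma>', x)\<in>p. \<Union>\<sigma>\<in>{\<sigma>\<in>\<Sigma>. \<sigma>' \<subseteq> \<sigma>}. glue D \<Sigma> `` {(\<sigma>, restrict_point D \<sigma> x)})"

subsection \<open>Smoothness\<close>

text \<open>
  Scalars of \<open>\<complex>\<close> are embedded in the group algebra as constants, i.e. as multiples of the unit
  character.
\<close>

abbreviation const_char :: "complex \<Rightarrow> ('m::zero \<Rightarrow>\<^sub>0 complex)" where
  "const_char c \<equiv> Poly_Mapping.single 0 c"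

definition algebraically_independent ::
    "nat \<Rightarrow> (nat \<Rightarrow> ('m::comm_monoid_add \<Rightarrow>\<^sub>0 complex)) \<Rightarrow> bool" where
  "algebraically_independent r f \<longleftrightarrow>
     (\<forall>P :: (nat \<Rightarrow>\<^sub>0 nat) \<Rightarrow>\<^sub>0 complex.
        (\<forall>a\<in>Poly_Mapping.keys P. Poly_Mapping.keys a \<subseteq> {..<r}) \<and>
        (\<Sum>a\<in>Poly_Mapping.keys P.
           const_char (Poly_Mapping.lookup P a) * (\<Prod>i<r. f i ^ Poly_Mapping.lookup a i)) = 0
        \<longrightarrow> P = 0)"

text \<open>
  The dimension of an irreducible affine variety: the transcendence degree over \<open>\<complex>\<close> of its
  coordinate ring \<open>A\<close>.
\<close>

definition has_trdeg :: "('m::comm_monoid_add \<Rightarrow>\<^sub>0 complex) set \<Rightarrow> nat \<Rightarrow> bool" where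
  "has_trdeg A r \<longleftrightarrow>
     (\<exists>f. (\<forall>i<r. f i \<in> A) \<and> algebraically_independent r f) \<and>
     (\<forall>s f. (\<forall>i<s. f i \<in> A) \<and> algebraically_independent s f \<longrightarrow> s \<le> r)"

definition maximal_ideal_at ::
    "('m \<Rightarrow>\<^sub>0 complex) set \<Rightarrow> ('m \<Rightarrow> complex) \<Rightarrow> ('m \<Rightarrow>\<^sub>0 complex) set" where
  "maximal_ideal_at A x = {f\<in>A. eval_at x f = 0}"

definition ideal_square ::
    "('m::comm_monoid_add \<Rightarrow>\<^sub>0 complex) set \<Rightarrow> ('m \<Rightarrow>\<^sub>0 complex) set" where
  "ideal_square I = {(\<Sum>i<r. f i * g i) | (r::nat) f g. \<forall>i<r. f i \<in> I \<and> g i \<in> I}"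

text \<open>\<open>dim\<^bsub>\<complex>\<^esub> (V / W) = r\<close> for complex subspaces \<open>W \<subseteq> V\<close>; the \<open>b i\<close> represent a basis.\<close>

definition has_quotient_dim ::
    "('m::comm_monoid_add \<Rightarrow>\<^sub>0 complex) set \<Rightarrow> ('m \<Rightarrow>\<^sub>0 complex) set \<Rightarrow> nat \<Rightarrow> bool" where
  "has_quotient_dim V W r \<longleftrightarrow>
     (\<exists>b. (\<forall>i<r. b i \<in> V) \<and>
          (\<forall>f\<in>V. \<exists>c. f - (\<Sum>i<r. const_char (c i) * b i) \<in> W) \<and>
          (\<forall>c. (\<Sum>i<r. const_char (c i) * b i) \<in> W \<longrightarrow> (\<forall>i<r. c i = 0)))"

text \<open>
  Nonsingularity of \<open>Spec A\<close> at \<open>x\<close>: the cotangent space \<open>\<mm>\<^sub>x / \<mm>\<^sub>x\<^sup>2\<close> has dimension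
  \<open>dim A\<close>. It does not matter whether \<open>\<mm>\<^sub>x\<close> is taken in \<open>A\<close> or in its localization at \<open>x\<close>.
\<close>

definition nonsingular_at ::
    "('m::comm_monoid_add \<Rightarrow>\<^sub>0 complex) set \<Rightarrow> ('m \<Rightarrow> complex) \<Rightarrow> bool" where
  "nonsingular_at A x \<longleftrightarrow>
     (\<exists>r. has_trdeg A r \<and>
          has_quotient_dim (maximal_ideal_at A x) (ideal_square (maximal_ideal_at A x)) r)"

definition smooth_toric_variety :: "'d set \<Rightarrow> ('d \<Rightarrow>\<^sub>0 real) set set \<Rightarrow> bool" where
  "smooth_toric_variety D \<Sigma> \<longleftrightarrow>
     (\<forall>\<sigma>\<in>\<Sigma>. \<forall>x\<in>affine_chart D \<sigma>. nonsingular_at (coordinate_ring D \<sigma>) x)"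

subsection \<open>Divisors\<close>

definition irreducible_closed :: "'p topology \<Rightarrow> 'p set \<Rightarrow> bool" where
  "irreducible_closed T Z \<longleftrightarrow>
     closedin T Z \<and> Z \<noteq> {} \<and>
     (\<forall>A B. closedin T A \<and> closedin T B \<and> Z \<subseteq> A \<union> B \<longrightarrow> Z \<subseteq> A \<or> Z \<subseteq> B)"

text \<open>Prime divisors of an irreducible space: the irreducible closed subsets of codimension 1.\<close>

definition prime_divisor :: "'p topology \<Rightarrow> 'p set \<Rightarrow> bool" where
  "prime_divisor T Z \<longleftrightarrow>
     irreducible_closed T Z \<and> Z \<subset> topspace T \<and>
     (\<nexists>Y. irreducible_closed T Y \<and> Z \<subset> Y \<and> Y \<subset> topspace T)"

text \<open>
  A divisor \<open>Z\<close> is contracted by \<open>\<phi>\<close> if \<open>dim \<phi>(Z) < dim Z\<close>. For a birational morphism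
  of varieties the ambient dimensions agree, so \<open>Z\<close> is not contracted precisely if the
  closure of \<open>\<phi>(Z)\<close> has codimension 1, that is, is again a prime divisor.
\<close>

definition contracts_no_divisor :: "'p topology \<Rightarrow> 'q topology \<Rightarrow> ('p \<Rightarrow> 'q) \<Rightarrow> bool" where
  "contracts_no_divisor T' T \<phi> \<longleftrightarrow>
     (\<forall>Z. prime_divisor T' Z \<longrightarrow> prime_divisor T (T closure_of (\<phi> ` Z)))"


section \<open>The ladder diagram and its graph\<close>

text \<open>
  Vertices of the graph are written as pairs \<open>(a, c)\<close> of natural numbers, standing for the point
  \<open>(a - 1/2, c - 1/2)\<close> of the plane; for a dot this is the centre of \<open>[a-1, a] \<times> [c-1, c]\<close>.
  Edges are pairs \<open>(t, h)\<close> of tail and head. The parameters are \<open>l\<close> and \<open>k\<^sub>1, \<dots>, k\<^bsub>l+1\<^esub>\<close>.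
\<close>

type_synonym vertex = "nat \<times> nat"
type_synonym edge = "vertex \<times> vertex"

definition psum :: "(nat \<Rightarrow> nat) \<Rightarrow> nat \<Rightarrow> nat" where
  "psum k i = (\<Sum>j=1..i. k j)"

definition dots :: "nat \<Rightarrow> (nat \<Rightarrow> nat) \<Rightarrow> vertex set" where
  "dots l k =
     {(a, c). \<exists>i\<in>{1..l+1}. psum k (i - 1) < a \<and> a \<le> psum k i \<and>
                1 \<le> c \<and> c \<le> psum k (l + 1) - psum k i}"

definition star :: "nat \<Rightarrow> (nat \<Rightarrow> nat) \<Rightarrow> nat \<Rightarrow> vertex" where
  "star l k i = (psum k (i - 1) + 1, psum k (l + 1) - psum k i + 1)"

definition graph_vertices :: "nat \<Rightarrow> (nat \<Rightarrow> nat) \<Rightarrow> vertex set" where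
  "graph_vertices l k = dots l k \<union> star l k ` {1..l+1}"

definition graph_edges :: "nat \<Rightarrow> (nat \<Rightarrow> nat) \<Rightarrow> edge set" where
  "graph_edges l k =
     {(t, h). t \<in> graph_vertices l k \<and> h \<in> graph_vertices l k \<and>
        (fst h = fst t + 1 \<and> snd h = snd t \<or> fst h = fst t \<and> snd t = snd h + 1)}"

text \<open>\<open>\<delta>(e) = h(e) - t(e)\<close>, with the stars projected to \<open>0\<close>.\<close>

definition delta :: "nat \<Rightarrow> (nat \<Rightarrow> nat) \<Rightarrow> edge \<Rightarrow> (vertex \<Rightarrow>\<^sub>0 real)" where
  "delta l k e =
     (if snd e \<in> dots l k then Poly_Mapping.single (snd e) 1 else 0)
     - (if fst e \<in> dots l k then Poly_Mapping.single (fst e) 1 else 0)"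

text \<open>The unit square with lower left vertex \<open>(a, c)\<close>, and its two edges at that vertex.\<close>

definition unit_square :: "vertex \<Rightarrow> edge set" where
  "unit_square = (\<lambda>(a, c).
     {((a, c), (a+1, c)), ((a, c+1), (a+1, c+1)), ((a, c+1), (a, c)), ((a+1, c+1), (a+1, c))})"

definition corner :: "vertex \<Rightarrow> edge set" where
  "corner = (\<lambda>(a, c). {((a, c), (a+1, c)), ((a, c+1), (a, c))})"

definition corners :: "nat \<Rightarrow> (nat \<Rightarrow> nat) \<Rightarrow> edge set set" where
  "corners l k = {corner v | v. unit_square v \<subseteq> graph_edges l k}"

definition roof :: "nat \<Rightarrow> (nat \<Rightarrow> nat) \<Rightarrow> nat \<Rightarrow> edge set" where
  "roof l k i =
     (let n = psum k (l + 1);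
          hi = n - psum k i;            \<comment> \<open>height of the horizontal part\<close>
          lo = n - psum k (i + 1) + 1;     \<comment> \<open>height of the last step\<close>
          lft = psum k (i - 1) + 1; rgt = psum k i
      in {(star l k i, (lft, hi))}
         \<union> {((a, hi), (a + 1, hi)) | a. lft \<le> a \<and> a < rgt}
         \<union> {((rgt, c + 1), (rgt, c)) | c. lo \<le> c \<and> c < hi}
         \<union> {((rgt, lo), star l k (i + 1))})"

definition roofs :: "nat \<Rightarrow> (nat \<Rightarrow> nat) \<Rightarrow> edge set set" where
  "roofs l k = roof l k ` {1..l}"


section \<open>The two fans\<close>

definition Delta :: "nat \<Rightarrow> (nat \<Rightarrow> nat) \<Rightarrow> (vertex \<Rightarrow>\<^sub>0 real) set" where
  "Delta l k = convex hull (delta l k ` graph_edges l k)"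

text \<open>The cone over the empty face is \<open>convex_cone hull {} = {0}\<close>.\<close>

definition Sigma_fan :: "nat \<Rightarrow> (nat \<Rightarrow> nat) \<Rightarrow> (vertex \<Rightarrow>\<^sub>0 real) set set" where
  "Sigma_fan l k = {convex_cone hull F | F. F face_of Delta l k \<and> F \<noteq> Delta l k}"

definition maximal_generators :: "nat \<Rightarrow> (nat \<Rightarrow> nat) \<Rightarrow> edge set set" where
  "maximal_generators l k =
     {G. G \<subseteq> graph_edges l k \<and> (\<forall>R \<in> roofs l k \<union> corners l k. \<exists>!e. e \<in> R - G)}"

text \<open>The faces of the simplicial cone generated by \<open>\<delta>(G)\<close> are generated by the \<open>\<delta>(H)\<close>, \<open>H \<subseteq> G\<close>.\<close>

definition Sigma_hat :: "nat \<Rightarrow> (nat \<Rightarrow> nat) \<Rightarrow> (vertex \<Rightarrow>\<^sub>0 real) set set" where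
  "Sigma_hat l k =
     {convex_cone hull (delta l k ` H) | H. \<exists>G\<in>maximal_generators l k. H \<subseteq> G}"

end

theory Submission
  imports Defs
begin

text \<open>
  The proof rests on planar duality for the ladder graph. Every edge \<open>e\<close> points right or down, so it
  has a region to its upper right, which is a box or the region beyond a roof, and a region to its
  lower left, which is a box or the outer region. The edges with a given region to their upper right
  form the corner of a box or a roof. A coefficient vector on the edges is a flow, \<open>\<delta>\<close> takes its
  divergence at the dots, and a flow without divergence is the difference of a potential on the
  regions (\<open>circulation_potential\<close>). Thus two representations of a vector by the \<open>\<delta>(e)\<close> differ by a
  potential, and potentials can be determined recursively from the lower left to the upper right.

  If one edge is selected in each region, exactly one potential makes the coefficients of the
  selected edges vanish, and it is integral for a lattice vector (\<open>selector_representation\<close>,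
  \<open>selector_unique\<close>). So the other edges form a basis of the lattice, and all cones of \<open>\<Sigma>\<close>-hat are
  unimodular. If instead the potential of each region is chosen as the maximum demanded by its
  edges, one obtains the only nonnegative representation with a zero in each region
  (\<open>reduced_representation\<close>, \<open>reduced_unique\<close>). Hence the cones of \<open>\<Sigma>\<close>-hat cover the space and meet in
  common faces.

  The functional that is one on such a basis is at most one on all other edges (\<open>support_le_1\<close>),
  because each box has as many edges above it as in its corner, and the edges of a roof sum up to
  zero. So the basis lies in a facet of the polytope, the polytope is cut out by these functionals
  (\<open>polytope_iff\<close>), and a cone over a proper face is the set on which given ones among them attain
  their maximum (\<open>face_fan_eq_coarse_fan\<close>). This gives the fan property of \<open>\<Sigma>\<close> and the refinement.

  For smoothness, the coordinate ring of a unimodular cone is a ring of polynomials in some variables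
  and Laurent polynomials in others. Its transcendence degree is bounded by counting monomials
  (\<open>algebraically_independent_le\<close>), and the first Taylor polynomial computes its cotangent spaces
  (\<open>has_quotient_dim_cotangent\<close>).

  No divisor is contracted since each \<open>\<delta>(e)\<close> is a vertex of the polytope (\<open>exposed_delta\<close>), so that the
  two fans have the same rays. The morphism is an isomorphism over the charts of the rays. The
  points outside these charts lie in the closures of the finitely many torus orbits belonging to the
  rays; these closures are irreducible, so no divisor can hide in the complement
  (\<open>prime_divisor_meets\<close>), and divisors are transported along the isomorphism
  (\<open>contracts_no_divisor_open_embedding\<close>).
\<close>


section \<open>Pairing, dual monoids and points of affine charts\<close>

abbreviation lookup :: "('a \<Rightarrow>\<^sub>0 'b::zero) \<Rightarrow> 'a \<Rightarrow> 'b" where "lookup \<equiv> Poly_Mapping.lookup"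
abbreviation keys :: "('a \<Rightarrow>\<^sub>0 'b::zero) \<Rightarrow> 'a set" where "keys \<equiv> Poly_Mapping.keys"

lemma lookup_scaleR [simp]: "lookup (r *\<^sub>R v) d = r *\<^sub>R lookup v d"
proof -
  have "finite {i. r *\<^sub>R lookup v i \<noteq> 0}"
    by (rule finite_subset[OF _ finite_keys[of v]]) (auto simp: in_keys_iff)
  then show ?thesis
    by (simp add: scaleR_poly_mapping_def)
qed

lemma keys_subset_iff: "keys v \<subseteq> D \<longleftrightarrow> (\<forall>d. d \<notin> D \<longrightarrow> lookup v d = 0)"
  by (auto simp: in_keys_iff)

lemma keys_add_subset: "keys v \<subseteq> D \<Longrightarrow> keys w \<subseteq> D \<Longrightarrow> keys (v + w) \<subseteq> D"
  by (simp add: keys_subset_iff lookup_add)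

lemma keys_scaleR_subset: "keys v \<subseteq> D \<Longrightarrow> keys (r *\<^sub>R v) \<subseteq> D"
  for v :: "'d \<Rightarrow>\<^sub>0 real"
  by (simp add: keys_subset_iff)

lemma keys_sum_subset: "(\<And>i. i \<in> I \<Longrightarrow> keys (f i) \<subseteq> D) \<Longrightarrow> keys (sum f I) \<subseteq> D"
  by (simp add: keys_subset_iff lookup_sum)

lemma pairing_altdef:
  assumes "finite K" "keys m \<subseteq> K"
  shows "pairing m v = (\<Sum>d\<in>K. real_of_int (lookup m d) * lookup v d)"
  unfolding pairing_def
  by (rule sum.mono_neutral_left) (use assms in \<open>auto simp: in_keys_iff\<close>)

lemma pairing_add_left: "pairing (m + m') v = pairing m v + pairing m' v"
proof -
  let ?K = "keys m \<union> keys m'"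
  have "keys (m + m') \<subseteq> ?K" by (rule keys_add)
  then show ?thesis
    by (simp add: pairing_altdef[of ?K] lookup_add algebra_simps sum.distrib)
qed

lemma pairing_uminus_left: "pairing (- m) v = - pairing m v"
  by (simp add: pairing_altdef[of "keys m"] sum_negf)

lemma pairing_zero_left [simp]: "pairing 0 v = 0"
  by (simp add: pairing_def)

lemma pairing_diff_left: "pairing (m - m') v = pairing m v - pairing m' v"
  using pairing_add_left[of m "- m'" v] by (simp add: pairing_uminus_left)

lemma pairing_sum_left: "pairing (sum m I) v = (\<Sum>i\<in>I. pairing (m i) v)"
  by (induction I rule: infinite_finite_induct) (auto simp: pairing_add_left)

lemma pairing_cmul_left: "pairing (frag_cmul a m) v = real_of_int a * pairing m v"
  by (simp add: pairing_altdef[of "keys m"] keys_cmul sum_distrib_left mult_ac)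

lemma pairing_add_right: "pairing m (v + w) = pairing m v + pairing m w"
  by (simp add: pairing_def lookup_add algebra_simps sum.distrib)

lemma pairing_scaleR_right: "pairing m (r *\<^sub>R v) = r * pairing m v"
  by (simp add: pairing_def sum_distrib_left mult_ac)

lemma pairing_zero_right [simp]: "pairing m 0 = 0"
  by (simp add: pairing_def)

lemma pairing_uminus_right: "pairing m (- v) = - pairing m v"
  using pairing_scaleR_right[of m "-1" v] by simp

lemma pairing_sum_right: "pairing m (sum v I) = (\<Sum>i\<in>I. pairing m (v i))"
  by (induction I rule: infinite_finite_induct) (auto simp: pairing_add_right)

lemma pairing_single_right: "pairing m (Poly_Mapping.single d r) = real_of_int (lookup m d) * r"
proof -
  have "pairing m (Poly_Mapping.single d r) =
      (\<Sum>e\<in>insert d (keys m). real_of_int (lookup m e) * lookup (Poly_Mapping.single d r) e)"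
    by (rule pairing_altdef) auto
  also have "\<dots> = (\<Sum>e\<in>insert d (keys m). if e = d then real_of_int (lookup m d) * r else 0)"
    by (rule sum.cong) (auto simp: lookup_single when_def)
  finally show ?thesis by simp
qed

lemma pairing_single_left: "pairing (Poly_Mapping.single d a) v = real_of_int a * lookup v d"
  by (cases "a = 0") (auto simp: pairing_def)

lemma pairing_lattice_int:
  assumes "v \<in> lattice_points D"
  shows "pairing m v \<in> \<int>"
  using assms by (auto simp: pairing_def lattice_points_def intro!: Ints_sum Ints_mult)

lemma convex_cone_dual_halfspace: "convex_cone {v. 0 \<le> pairing m v}"
  by (simp add: convex_cone_iff pairing_add_right pairing_scaleR_right)

lemma dual_monoid_hull:
  "m \<in> dual_monoid D (convex_cone hull V) \<longleftrightarrow> keys m \<subseteq> D \<and> (\<forall>v\<in>V. 0 \<le> pairing m v)"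
proof -
  have "convex_cone hull V \<subseteq> {v. 0 \<le> pairing m v} \<longleftrightarrow> V \<subseteq> {v. 0 \<le> pairing m v}"
    using hull_minimal[where S = convex_cone, OF _ convex_cone_dual_halfspace[of m]]
      hull_subset[of V convex_cone] by blast
  then show ?thesis
    unfolding dual_monoid_def by blast
qed

lemma zero_in_dual_monoid [simp]: "0 \<in> dual_monoid D \<sigma>"
  by (simp add: dual_monoid_def)

lemma dual_monoid_add:
  "m \<in> dual_monoid D \<sigma> \<Longrightarrow> m' \<in> dual_monoid D \<sigma> \<Longrightarrow> m + m' \<in> dual_monoid D \<sigma>"
  unfolding dual_monoid_def by (auto simp: pairing_add_left dest: subsetD[OF keys_add])

lemma dual_monoid_cmul: "m \<in> dual_monoid D \<sigma> \<Longrightarrow> frag_cmul (int N) m \<in> dual_monoid D \<sigma>"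
  using keys_cmul[of "int N" m] by (auto simp: dual_monoid_def pairing_cmul_left)

lemma dual_monoid_antimono: "\<tau> \<subseteq> \<sigma> \<Longrightarrow> dual_monoid D \<sigma> \<subseteq> dual_monoid D \<tau>"
  by (auto simp: dual_monoid_def)

lemma chart_zero: "x \<in> affine_chart D \<sigma> \<Longrightarrow> x 0 = 1"
  by (simp add: affine_chart_def)

lemma chart_add:
  "x \<in> affine_chart D \<sigma> \<Longrightarrow> m \<in> dual_monoid D \<sigma> \<Longrightarrow> m' \<in> dual_monoid D \<sigma> \<Longrightarrow> x (m + m') = x m * x m'"
  by (simp add: affine_chart_def)

lemma chart_outside: "x \<in> affine_chart D \<sigma> \<Longrightarrow> m \<notin> dual_monoid D \<sigma> \<Longrightarrow> x m = 0"
  by (simp add: affine_chart_def)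

lemma chart_cmul:
  assumes "x \<in> affine_chart D \<sigma>" "m \<in> dual_monoid D \<sigma>"
  shows "x (frag_cmul (int N) m) = x m ^ N"
proof (induction N)
  case 0
  then show ?case using assms chart_zero by simp
next
  case (Suc N)
  have "frag_cmul (int (Suc N)) m = m + frag_cmul (int N) m"
    using frag_cmul_distrib[of 1 "int N" m] by simp
  then show ?case
    using Suc chart_add[OF assms dual_monoid_cmul[OF assms(2)]] by simp
qed

lemma chart_unit:
  assumes "x \<in> affine_chart D \<sigma>" "m \<in> dual_monoid D \<sigma>" "- m \<in> dual_monoid D \<sigma>"
  shows "x m * x (- m) = 1"
  using chart_add[OF assms] chart_zero[OF assms(1)] by simp

lemma restrict_point_chart:
  assumes "\<tau> \<subseteq> \<sigma>" "z \<in> affine_chart D \<tau>"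
  shows "restrict_point D \<sigma> z \<in> affine_chart D \<sigma>"
  using assms dual_monoid_antimono[OF assms(1), of D]
  by (auto simp: affine_chart_def restrict_point_def dual_monoid_add subset_eq)

lemma restrict_point_restrict:
  "\<tau> \<subseteq> \<sigma> \<Longrightarrow> restrict_point D \<sigma> (restrict_point D \<tau> z) = restrict_point D \<sigma> z"
  using dual_monoid_antimono[of \<tau> \<sigma> D] unfolding restrict_point_def fun_eq_iff by auto

lemma restrict_point_self: "x \<in> affine_chart D \<sigma> \<Longrightarrow> restrict_point D \<sigma> x = x"
  by (auto simp: restrict_point_def affine_chart_def)

text \<open>
  Cutting out a face \<open>\<tau> = \<sigma> \<inter> m\<^sup>\<bottom>\<close> inverts the single character \<open>m\<close>: each element of \<open>\<tau>\<^sup>\<or>\<close>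
  becomes nonnegative on the finitely many generators of \<open>\<sigma>\<close> after adding a multiple of \<open>m\<close>, since
  \<open>m\<close> is positive on the generators outside \<open>\<tau>\<close>.
\<close>

lemma dual_monoid_face:
  assumes poly: "rational_polyhedral_cone D \<sigma>"
    and m: "m \<in> dual_monoid D \<sigma>" and \<tau>: "\<tau> = {v \<in> \<sigma>. pairing m v = 0}"
    and q: "q \<in> dual_monoid D \<tau>"
  shows "\<exists>N. q + frag_cmul (int N) m \<in> dual_monoid D \<sigma>"
proof -
  obtain V where V: "finite V" "\<sigma> = convex_cone hull V"
    using poly by (auto simp: rational_polyhedral_cone_def)
  have Vs: "V \<subseteq> \<sigma>" unfolding V(2) by (rule hull_subset)
  have "\<exists>N::nat. 0 \<le> pairing q v + real N * pairing m v" if "v \<in> V" for v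
  proof (cases "pairing m v = 0")
    case True
    then show ?thesis using q that Vs by (auto simp: \<tau> dual_monoid_def)
  next
    case False
    then have "0 < pairing m v" using m that Vs by (force simp: dual_monoid_def)
    then obtain N where "- pairing q v < real N * pairing m v"
      using reals_Archimedean3 by blast
    then show ?thesis by (intro exI[of _ N]) simp
  qed
  then obtain N :: "_ \<Rightarrow> nat" where N: "\<And>v. v \<in> V \<Longrightarrow> 0 \<le> pairing q v + real (N v) * pairing m v"
    by metis
  let ?N = "\<Sum>v\<in>V. N v"
  have "0 \<le> pairing (q + frag_cmul (int ?N) m) v" if v: "v \<in> V" for v
  proof -
    have "real (N v) \<le> real ?N"
      using V(1) v member_le_sum[of v V N] by (simp only: of_nat_le_iff)
    moreover have "0 \<le> pairing m v" using m v Vs by (auto simp: dual_monoid_def)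
    ultimately have "real (N v) * pairing m v \<le> real ?N * pairing m v"
      by (rule mult_right_mono)
    then show ?thesis using N[OF v] by (simp add: pairing_add_left pairing_cmul_left)
  qed
  moreover have "keys (q + frag_cmul (int ?N) m) \<subseteq> D"
    using q m keys_cmul[of "int ?N" m] by (intro keys_add_subset) (auto simp: dual_monoid_def)
  ultimately have "q + frag_cmul (int ?N) m \<in> dual_monoid D \<sigma>"
    unfolding V(2) dual_monoid_hull by blast
  then show ?thesis by blast
qed

text \<open>
  Restriction identifies the chart of the face \<open>\<tau>\<close> with the locus in the chart of \<open>\<sigma>\<close> on which the
  coordinate \<open>m\<close> does not vanish.
\<close>

locale localization =
  fixes D :: "'d set" and \<sigma> \<tau> :: "('d \<Rightarrow>\<^sub>0 real) set" and m :: "'d \<Rightarrow>\<^sub>0 int"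
  assumes poly: "rational_polyhedral_cone D \<sigma>"
    and m: "m \<in> dual_monoid D \<sigma>"
    and \<tau>: "\<tau> = {v \<in> \<sigma>. pairing m v = 0}"
begin

lemma sub: "\<tau> \<subseteq> \<sigma>" by (auto simp: \<tau>)

lemma dual_mono: "q \<in> dual_monoid D \<sigma> \<Longrightarrow> q \<in> dual_monoid D \<tau>"
  using dual_monoid_antimono[OF sub] by auto

lemma neg_m: "- m \<in> dual_monoid D \<tau>"
  using m by (auto simp: \<tau> dual_monoid_def pairing_uminus_left)

lemma unit: "z \<in> affine_chart D \<tau> \<Longrightarrow> z m \<noteq> 0"
  using chart_unit[of z D \<tau> m] dual_mono[OF m] neg_m by force

lemma extension_value:
  assumes "z \<in> affine_chart D \<tau>" "q \<in> dual_monoid D \<tau>" "q + frag_cmul (int N) m \<in> dual_monoid D \<sigma>"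
  shows "z q = restrict_point D \<sigma> z (q + frag_cmul (int N) m) / z m ^ N"
  using chart_add[OF assms(1,2) dual_monoid_cmul[OF dual_mono[OF m]], of N]
    chart_cmul[OF assms(1) dual_mono[OF m], of N] unit[OF assms(1)] assms(3)
  by (simp add: restrict_point_def)

lemma restrict_inj:
  assumes "z \<in> affine_chart D \<tau>" "w \<in> affine_chart D \<tau>" "restrict_point D \<sigma> z = restrict_point D \<sigma> w"
  shows "z = w"
proof
  fix q
  have "z m = w m" using fun_cong[OF assms(3), of m] m by (simp add: restrict_point_def)
  then show "z q = w q"
    using extension_value[OF assms(1), of q] extension_value[OF assms(2), of q]
      dual_monoid_face[OF poly m \<tau>, of q] chart_outside[OF assms(1)] chart_outside[OF assms(2)] assms(3)
    by (cases "q \<in> dual_monoid D \<tau>") auto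
qed

lemma extend:
  assumes x: "x \<in> affine_chart D \<sigma>" and nz: "x m \<noteq> 0"
  shows "\<exists>z\<in>affine_chart D \<tau>. x = restrict_point D \<sigma> z"
proof -
  have "\<forall>q\<in>dual_monoid D \<tau>. \<exists>N. q + frag_cmul (int N) m \<in> dual_monoid D \<sigma>"
    using dual_monoid_face[OF poly m \<tau>] by blast
  then obtain N where N: "\<And>q. q \<in> dual_monoid D \<tau> \<Longrightarrow> q + frag_cmul (int (N q)) m \<in> dual_monoid D \<sigma>"
    by metis
  \<comment> \<open>The only possible value at \<open>q\<close> is a fraction with denominator a power of \<open>x m\<close>.\<close>
  define z where "z q = (if q \<in> dual_monoid D \<tau> then x (q + frag_cmul (int (N q)) m) / x m ^ N q else 0)" for q
  have z: "z q = x (q + frag_cmul (int n) m) / x m ^ n"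
    if q: "q \<in> dual_monoid D \<tau>" and n: "q + frag_cmul (int n) m \<in> dual_monoid D \<sigma>" for q n
  proof -
    have "x (q + frag_cmul (int n) m) * x m ^ N q
        = x ((q + frag_cmul (int n) m) + frag_cmul (int (N q)) m)"
      using chart_add[OF x n dual_monoid_cmul[OF m]] chart_cmul[OF x m] by simp
    also have "\<dots> = x ((q + frag_cmul (int (N q)) m) + frag_cmul (int n) m)"
      by (simp add: add_ac)
    also have "\<dots> = x (q + frag_cmul (int (N q)) m) * x m ^ n"
      using chart_add[OF x N[OF q] dual_monoid_cmul[OF m]] chart_cmul[OF x m] by simp
    finally show ?thesis using nz q by (simp add: z_def field_simps)
  qed
  have "z (q + r) = z q * z r" if q: "q \<in> dual_monoid D \<tau>" and r: "r \<in> dual_monoid D \<tau>" for q r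
  proof -
    have eq: "(q + r) + frag_cmul (int (N q + N r)) m
        = (q + frag_cmul (int (N q)) m) + (r + frag_cmul (int (N r)) m)"
      by (simp add: frag_cmul_distrib add_ac)
    have "z (q + r) = x ((q + r) + frag_cmul (int (N q + N r)) m) / x m ^ (N q + N r)"
      by (intro z) (simp_all only: eq dual_monoid_add N[OF q] N[OF r] q r)
    also have "\<dots> = z q * z r"
      unfolding eq chart_add[OF x N[OF q] N[OF r]] using q r by (simp add: z_def power_add)
    finally show ?thesis .
  qed
  moreover have z\<sigma>: "z q = x q" if "q \<in> dual_monoid D \<sigma>" for q
    using z[OF dual_mono[OF that], of 0] that by simp
  moreover have "z 0 = 1" using z\<sigma>[of 0] chart_zero[OF x] by simp
  moreover have "z q = 0" if "q \<notin> dual_monoid D \<tau>" for q using that by (simp add: z_def)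
  ultimately have "z \<in> affine_chart D \<tau>" unfolding affine_chart_def by blast
  moreover have "x = restrict_point D \<sigma> z"
    using z\<sigma> chart_outside[OF x] unfolding restrict_point_def fun_eq_iff by metis
  ultimately show ?thesis by blast
qed

end

section \<open>Gluing the charts of a fan\<close>

text \<open>
  Faces of rational polyhedral cones are cut out by elements of the dual lattice. This is taken as
  part of the data, because the two fans below come with explicit such elements.
\<close>

locale toric_fan =
  fixes D :: "'d set" and \<Sigma> :: "('d \<Rightarrow>\<^sub>0 real) set set"
  assumes fan: "is_fan D \<Sigma>"
    and exposed: "\<sigma> \<in> \<Sigma> \<Longrightarrow> \<tau> \<in> \<Sigma> \<Longrightarrow> \<tau> \<subseteq> \<sigma> \<Longrightarrow>
      \<exists>m\<in>dual_monoid D \<sigma>. \<tau> = {v \<in> \<sigma>. pairing m v = 0}"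
begin

lemma polyhedral: "\<sigma> \<in> \<Sigma> \<Longrightarrow> rational_polyhedral_cone D \<sigma>"
  using fan by (simp add: is_fan_def)

lemma zero_in_cone: "\<sigma> \<in> \<Sigma> \<Longrightarrow> 0 \<in> \<sigma>"
  using fan by (auto simp: is_fan_def strongly_convex_def)

lemma inter: "\<sigma> \<in> \<Sigma> \<Longrightarrow> \<tau> \<in> \<Sigma> \<Longrightarrow> \<sigma> \<inter> \<tau> \<in> \<Sigma>"
  using fan zero_in_cone unfolding is_fan_def by (metis IntI empty_iff)

lemma obtain_localization:
  assumes "\<sigma> \<in> \<Sigma>" "\<tau> \<in> \<Sigma>" "\<tau> \<subseteq> \<sigma>"
  obtains m where "localization D \<sigma> \<tau> m"
  using exposed[OF assms] polyhedral[OF assms(1)] unfolding localization_def by blast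

lemma restrict_inj:
  assumes "\<sigma> \<in> \<Sigma>" "\<tau> \<in> \<Sigma>" "\<tau> \<subseteq> \<sigma>" "z \<in> affine_chart D \<tau>" "w \<in> affine_chart D \<tau>"
    "restrict_point D \<sigma> z = restrict_point D \<sigma> w"
  shows "z = w"
  using obtain_localization[OF assms(1-3)] localization.restrict_inj assms(4-6) by metis

text \<open>
  Inside one chart, the overlaps with two other charts meet in the overlap with their intersection:
  if \<open>m\<close> and \<open>m'\<close> cut out two faces of \<open>\<tau>\<close>, then \<open>m + m'\<close> cuts out their intersection, and a
  character value at \<open>m + m'\<close> is nonzero if those at \<open>m\<close> and \<open>m'\<close> are.
\<close>

lemma extend_to_inter:
  assumes "\<tau> \<in> \<Sigma>" "\<rho> \<in> \<Sigma>" "\<rho>' \<in> \<Sigma>" "\<rho> \<subseteq> \<tau>" "\<rho>' \<subseteq> \<tau>"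
    and z: "z \<in> affine_chart D \<rho>" and z': "z' \<in> affine_chart D \<rho>'"
    and eq: "restrict_point D \<tau> z = restrict_point D \<tau> z'"
  shows "\<exists>w\<in>affine_chart D (\<rho> \<inter> \<rho>'). z = restrict_point D \<rho> w \<and> z' = restrict_point D \<rho>' w"
proof -
  obtain m where m: "localization D \<tau> \<rho> m" using obtain_localization assms(1,2,4) by blast
  obtain m' where m': "localization D \<tau> \<rho>' m'" using obtain_localization assms(1,3,5) by blast
  interpret l: localization D \<tau> \<rho> m by fact
  interpret l': localization D \<tau> \<rho>' m' by fact
  have "\<rho> \<inter> \<rho>' = {v \<in> \<tau>. pairing (m + m') v = 0}"
  proof -
    have "pairing m v = 0 \<and> pairing m' v = 0 \<longleftrightarrow> pairing m v + pairing m' v = 0" if "v \<in> \<tau>" for v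
      using l.m l'.m that by (smt (verit) dual_monoid_def mem_Collect_eq)
    then show ?thesis
      unfolding l.\<tau> l'.\<tau> by (auto simp: pairing_add_left)
  qed
  then interpret s: localization D \<tau> "\<rho> \<inter> \<rho>'" "m + m'"
    using l.poly l.m l'.m by unfold_locales (auto simp: dual_monoid_add)
  let ?y = "restrict_point D \<tau> z"
  have y: "?y \<in> affine_chart D \<tau>" using restrict_point_chart[OF l.sub z] .
  have "?y m \<noteq> 0" using l.unit[OF z] l.m by (simp add: restrict_point_def)
  moreover have "?y m' \<noteq> 0" unfolding eq using l'.unit[OF z'] l'.m by (simp add: restrict_point_def)
  ultimately have "?y (m + m') \<noteq> 0" using chart_add[OF y l.m l'.m] by simp
  then obtain w where w: "w \<in> affine_chart D (\<rho> \<inter> \<rho>')" "?y = restrict_point D \<tau> w"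
    using s.extend[OF y] by blast
  have "z = restrict_point D \<rho> w"
    using l.restrict_inj[OF z restrict_point_chart[OF Int_lower1 w(1)]] w(2)
    by (simp add: restrict_point_restrict l.sub)
  moreover have "z' = restrict_point D \<rho>' w"
    using l'.restrict_inj[OF z' restrict_point_chart[OF Int_lower2 w(1)]] w(2) eq
    by (simp add: restrict_point_restrict l'.sub)
  ultimately show ?thesis using w by blast
qed

lemma glue_iff:
  "((\<sigma>, x), (\<tau>, y)) \<in> glue D \<Sigma> \<longleftrightarrow>
     \<sigma> \<in> \<Sigma> \<and> \<tau> \<in> \<Sigma> \<and> (\<exists>z\<in>affine_chart D (\<sigma> \<inter> \<tau>). x = restrict_point D \<sigma> z \<and> y = restrict_point D \<tau> z)"
  using restrict_point_chart[of "\<sigma> \<inter> \<tau>" \<sigma>] restrict_point_chart[of "\<sigma> \<inter> \<tau>" \<tau>]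
  by (auto simp: glue_def chart_points_def)

lemma glue_self_iff:
  assumes "x \<in> affine_chart D \<sigma>"
  shows "((\<sigma>, x), (\<sigma>, y)) \<in> glue D \<Sigma> \<longleftrightarrow> \<sigma> \<in> \<Sigma> \<and> x = y"
  using assms restrict_point_self by (fastforce simp: glue_iff)

lemma glue_face:
  assumes "\<sigma> \<in> \<Sigma>" "\<tau> \<in> \<Sigma>" "\<tau> \<subseteq> \<sigma>" "z \<in> affine_chart D \<tau>"
  shows "((\<tau>, z), (\<sigma>, restrict_point D \<sigma> z)) \<in> glue D \<Sigma>"
  using assms restrict_point_self[OF assms(4)] by (auto simp: glue_iff Int_absorb2 intro!: bexI[of _ z])

lemma equiv_glue: "equiv (chart_points D \<Sigma>) (glue D \<Sigma>)"
proof (rule equivI)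
  show "glue D \<Sigma> \<subseteq> chart_points D \<Sigma> \<times> chart_points D \<Sigma>"
    by (auto simp: glue_def)
  show "refl_on (chart_points D \<Sigma>) (glue D \<Sigma>)"
    by (auto simp: refl_on_def chart_points_def glue_self_iff)
  show "sym (glue D \<Sigma>)"
    by (auto simp: sym_def glue_iff Int_commute)
  show "trans (glue D \<Sigma>)"
  proof (rule transI, clarify)
    fix \<sigma> x \<tau> y \<rho> w
    assume "((\<sigma>, x), (\<tau>, y)) \<in> glue D \<Sigma>" "((\<tau>, y), (\<rho>, w)) \<in> glue D \<Sigma>"
    then obtain z z' where
      F: "\<sigma> \<in> \<Sigma>" "\<tau> \<in> \<Sigma>" "\<rho> \<in> \<Sigma>" and
      z: "z \<in> affine_chart D (\<sigma> \<inter> \<tau>)" "x = restrict_point D \<sigma> z" "y = restrict_point D \<tau> z" and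
      z': "z' \<in> affine_chart D (\<tau> \<inter> \<rho>)" "y = restrict_point D \<tau> z'" "w = restrict_point D \<rho> z'"
      by (auto simp: glue_iff)
    obtain u where u: "u \<in> affine_chart D ((\<sigma> \<inter> \<tau>) \<inter> (\<tau> \<inter> \<rho>))"
      "z = restrict_point D (\<sigma> \<inter> \<tau>) u" "z' = restrict_point D (\<tau> \<inter> \<rho>) u"
      using extend_to_inter[OF F(2) inter[OF F(1,2)] inter[OF F(2,3)] _ _ z(1) z'(1)] z(3) z'(2) by auto
    let ?v = "restrict_point D (\<sigma> \<inter> \<rho>) u"
    have "?v \<in> affine_chart D (\<sigma> \<inter> \<rho>)"
      by (rule restrict_point_chart[OF _ u(1)]) auto
    moreover have "x = restrict_point D \<sigma> ?v" "w = restrict_point D \<rho> ?v"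
      using z(2) z'(3) u by (simp_all add: restrict_point_restrict)
    ultimately show "((\<sigma>, x), (\<rho>, w)) \<in> glue D \<Sigma>"
      using F by (auto simp: glue_iff)
  qed
qed

abbreviation pt :: "('d \<Rightarrow>\<^sub>0 real) set \<Rightarrow> (('d \<Rightarrow>\<^sub>0 int) \<Rightarrow> complex) \<Rightarrow> 'd chart_point set" where
  "pt \<sigma> x \<equiv> glue D \<Sigma> `` {(\<sigma>, x)}"

lemma pt_eq_iff:
  assumes "\<sigma> \<in> \<Sigma>" "x \<in> affine_chart D \<sigma>" "\<tau> \<in> \<Sigma>" "y \<in> affine_chart D \<tau>"
  shows "pt \<sigma> x = pt \<tau> y \<longleftrightarrow> ((\<sigma>, x), (\<tau>, y)) \<in> glue D \<Sigma>"
  using eq_equiv_class_iff[OF equiv_glue] assms by (simp add: chart_points_def)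

lemma pt_inj:
  assumes "\<sigma> \<in> \<Sigma>" "x \<in> affine_chart D \<sigma>" "y \<in> affine_chart D \<sigma>" "pt \<sigma> x = pt \<sigma> y"
  shows "x = y"
  using assms pt_eq_iff glue_self_iff by blast

lemma pt_face:
  assumes "\<sigma> \<in> \<Sigma>" "\<tau> \<in> \<Sigma>" "\<tau> \<subseteq> \<sigma>" "z \<in> affine_chart D \<tau>"
  shows "pt \<sigma> (restrict_point D \<sigma> z) = pt \<tau> z"
  using glue_face[OF assms] pt_eq_iff assms restrict_point_chart by metis

lemma in_toric_variety_iff:
  "p \<in> toric_variety D \<Sigma> \<longleftrightarrow> (\<exists>\<sigma>\<in>\<Sigma>. \<exists>x\<in>affine_chart D \<sigma>. p = pt \<sigma> x)"
  by (auto simp: toric_variety_def quotient_def chart_points_def)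

end

section \<open>Regular functions and the Zariski topology\<close>

lemma eval_at_altdef:
  assumes "finite K" "keys f \<subseteq> K"
  shows "eval_at x f = (\<Sum>m\<in>K. lookup f m * x m)"
  unfolding eval_at_def
  by (rule sum.mono_neutral_left) (use assms in \<open>auto simp: in_keys_iff\<close>)

lemma eval_at_single [simp]: "eval_at x (Poly_Mapping.single m a) = a * x m"
  by (cases "a = 0") (auto simp: eval_at_def)

lemma eval_at_zero [simp]: "eval_at x 0 = 0"
  by (simp add: eval_at_def)

lemma eval_at_add: "eval_at x (f + g) = eval_at x f + eval_at x g"
proof -
  have "keys (f + g) \<subseteq> keys f \<union> keys g" by (rule keys_add)
  then show ?thesis
    by (simp add: eval_at_altdef[of "keys f \<union> keys g"] lookup_add algebra_simps sum.distrib)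
qed

lemma eval_at_sum: "eval_at x (sum f I) = (\<Sum>i\<in>I. eval_at x (f i))"
  by (induction I rule: infinite_finite_induct) (auto simp: eval_at_add)

lemma poly_mapping_sum_singles: "f = (\<Sum>m\<in>keys f. Poly_Mapping.single m (lookup f m))"
proof (rule poly_mapping_eqI)
  fix k
  have "lookup (\<Sum>m\<in>keys f. Poly_Mapping.single m (lookup f m)) k =
      (\<Sum>m\<in>keys f. if m = k then lookup f m else 0)"
    unfolding lookup_sum by (rule sum.cong) (auto simp: lookup_single when_def)
  then show "lookup f k = lookup (\<Sum>m\<in>keys f. Poly_Mapping.single m (lookup f m)) k"
    by (simp add: in_keys_iff)
qed

lemma eval_at_mult_sum:
  fixes f g :: "'m::comm_monoid_add \<Rightarrow>\<^sub>0 complex"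
  shows "eval_at y (f * g) = (\<Sum>m\<in>keys f. \<Sum>m'\<in>keys g. lookup f m * lookup g m' * y (m + m'))"
proof -
  have "f * g = (\<Sum>m\<in>keys f. \<Sum>m'\<in>keys g. Poly_Mapping.single (m + m') (lookup f m * lookup g m'))"
    by (subst poly_mapping_sum_singles[of f], subst poly_mapping_sum_singles[of g])
      (simp add: sum_product mult_single)
  then show ?thesis by (simp add: eval_at_sum)
qed

lemma eval_at_mult:
  fixes f g :: "'m::comm_monoid_add \<Rightarrow>\<^sub>0 complex"
  assumes "\<And>m m'. m \<in> keys f \<Longrightarrow> m' \<in> keys g \<Longrightarrow> x (m + m') = x m * x m'"
  shows "eval_at x (f * g) = eval_at x f * eval_at x g"
  unfolding eval_at_mult_sum eval_at_def[of x f] eval_at_def[of x g]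
  by (simp add: sum_product assms mult_ac)

lemma coordinate_ring_mult:
  assumes "f \<in> coordinate_ring D \<sigma>" "g \<in> coordinate_ring D \<sigma>"
  shows "f * g \<in> coordinate_ring D \<sigma>"
  using assms keys_mult[of f g] by (fastforce simp: coordinate_ring_def dual_monoid_add)

lemma eval_at_mult_chart:
  assumes "x \<in> affine_chart D \<sigma>" "f \<in> coordinate_ring D \<sigma>" "g \<in> coordinate_ring D \<sigma>"
  shows "eval_at x (f * g) = eval_at x f * eval_at x g"
  using assms by (intro eval_at_mult) (auto simp: coordinate_ring_def intro!: chart_add[OF assms(1)])

lemma eval_at_one_chart: "x \<in> affine_chart D \<sigma> \<Longrightarrow> eval_at x 1 = 1"
  using chart_zero eval_at_single[of x 0 1] by simp

lemma one_in_coordinate_ring: "1 \<in> coordinate_ring D \<sigma>"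
  by (simp add: coordinate_ring_def)

lemma coordinate_ring_antimono: "\<tau> \<subseteq> \<sigma> \<Longrightarrow> coordinate_ring D \<sigma> \<subseteq> coordinate_ring D \<tau>"
  using dual_monoid_antimono[of \<tau> \<sigma> D] by (auto simp: coordinate_ring_def)

lemma eval_at_restrict:
  assumes "f \<in> coordinate_ring D \<sigma>"
  shows "eval_at (restrict_point D \<sigma> z) f = eval_at z f"
  unfolding eval_at_def
  by (rule sum.cong) (use assms in \<open>auto simp: coordinate_ring_def restrict_point_def\<close>)

text \<open>A regular function on \<open>U\<^bsub>\<tau>\<^esub>\<close> becomes regular on \<open>U\<^bsub>\<sigma>\<^esub>\<close> after clearing the denominator \<open>m\<close>.\<close>

lemma (in localization) clear_denominator:
  assumes f: "f \<in> coordinate_ring D \<tau>"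
  shows "\<exists>N. f * Poly_Mapping.single (frag_cmul (int N) m) 1 \<in> coordinate_ring D \<sigma>"
proof -
  have "\<forall>q\<in>keys f. \<exists>N. q + frag_cmul (int N) m \<in> dual_monoid D \<sigma>"
    using f dual_monoid_face[OF poly m \<tau>] by (auto simp: coordinate_ring_def)
  then obtain N where N: "\<And>q. q \<in> keys f \<Longrightarrow> q + frag_cmul (int (N q)) m \<in> dual_monoid D \<sigma>"
    by metis
  let ?N = "\<Sum>q\<in>keys f. N q"
  have "q + frag_cmul (int ?N) m \<in> dual_monoid D \<sigma>" if q: "q \<in> keys f" for q
  proof -
    have "N q \<le> ?N" using q by (intro member_le_sum) auto
    then have "int ?N = int (N q) + int (?N - N q)" by simp
    then have "q + frag_cmul (int ?N) m
        = (q + frag_cmul (int (N q)) m) + frag_cmul (int (?N - N q)) m"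
      by (metis add.assoc frag_cmul_distrib)
    also have "\<dots> \<in> dual_monoid D \<sigma>"
      by (intro dual_monoid_add N[OF q] dual_monoid_cmul m)
    finally show ?thesis .
  qed
  then have "keys (f * Poly_Mapping.single (frag_cmul (int ?N) m) 1) \<subseteq> dual_monoid D \<sigma>"
    using keys_mult[of f "Poly_Mapping.single (frag_cmul (int ?N) m) (1::complex)"] by fastforce
  then show ?thesis unfolding coordinate_ring_def by blast
qed

context toric_fan
begin

definition chart :: "('d \<Rightarrow>\<^sub>0 real) set \<Rightarrow> 'd chart_point set set" where
  "chart \<sigma> = pt \<sigma> ` affine_chart D \<sigma>"

lemma principal_open_iff:
  assumes "\<sigma> \<in> \<Sigma>" "x \<in> affine_chart D \<sigma>"
  shows "pt \<sigma> x \<in> principal_open D \<Sigma> \<sigma> f \<longleftrightarrow> eval_at x f \<noteq> 0"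
  using assms pt_inj by (auto simp: principal_open_def)

lemma principal_open_subset: "principal_open D \<Sigma> \<sigma> f \<subseteq> chart \<sigma>"
  by (auto simp: principal_open_def chart_def)

lemma principal_open_one: "principal_open D \<Sigma> \<sigma> 1 = chart \<sigma>"
  by (auto simp: principal_open_def chart_def eval_at_one_chart)

text \<open>
  A principal open set of one chart cuts a principal open set out of every other chart. The
  overlap of the charts of \<open>\<tau>\<close> and \<open>\<sigma>\<close> is the locus in \<open>U\<^bsub>\<tau>\<^esub>\<close> where the character cutting out
  \<open>\<sigma> \<inter> \<tau>\<close> is invertible, and on it \<open>f\<close> is a fraction with denominator a power of that character.
\<close>

lemma principal_open_localize:
  assumes \<sigma>: "\<sigma> \<in> \<Sigma>" and \<tau>: "\<tau> \<in> \<Sigma>" and f: "f \<in> coordinate_ring D \<sigma>"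
  shows "\<exists>g\<in>coordinate_ring D \<tau>. \<forall>x\<in>affine_chart D \<tau>.
      pt \<tau> x \<in> principal_open D \<Sigma> \<sigma> f \<longleftrightarrow> eval_at x g \<noteq> 0"
proof -
  obtain m where "localization D \<tau> (\<sigma> \<inter> \<tau>) m"
    using obtain_localization[OF \<tau> inter[OF \<sigma> \<tau>]] by auto
  then interpret l: localization D \<tau> "\<sigma> \<inter> \<tau>" m .
  have f': "f \<in> coordinate_ring D (\<sigma> \<inter> \<tau>)" using coordinate_ring_antimono[of "\<sigma> \<inter> \<tau>" \<sigma>] f by auto
  obtain N where N: "f * Poly_Mapping.single (frag_cmul (int N) m) 1 \<in> coordinate_ring D \<tau>" (is "?h \<in> _")
    using l.clear_denominator[OF f'] by blast
  have mr: "Poly_Mapping.single m 1 \<in> coordinate_ring D \<tau>"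
    using l.m by (simp add: coordinate_ring_def)
  let ?g = "?h * Poly_Mapping.single m 1"
  have ev: "eval_at (restrict_point D \<tau> z) ?g = eval_at z f * z m ^ Suc N"
    if z: "z \<in> affine_chart D (\<sigma> \<inter> \<tau>)" for z
  proof -
    have "Poly_Mapping.single (frag_cmul (int N) m) 1 \<in> coordinate_ring D (\<sigma> \<inter> \<tau>)"
      using dual_monoid_cmul[OF l.dual_mono[OF l.m], of N] by (simp add: coordinate_ring_def)
    then have "eval_at z ?h = eval_at z f * z m ^ N"
      using eval_at_mult_chart[OF z f'] chart_cmul[OF z l.dual_mono[OF l.m]] by simp
    moreover have "restrict_point D \<tau> z m = z m" using l.m by (simp add: restrict_point_def)
    ultimately show ?thesis
      using eval_at_mult_chart[OF restrict_point_chart[OF l.sub z] N mr]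
      by (simp add: eval_at_restrict[OF N])
  qed
  have "pt \<tau> x \<in> principal_open D \<Sigma> \<sigma> f \<longleftrightarrow> eval_at x ?g \<noteq> 0" if x: "x \<in> affine_chart D \<tau>" for x
  proof
    assume "pt \<tau> x \<in> principal_open D \<Sigma> \<sigma> f"
    then obtain y where y: "y \<in> affine_chart D \<sigma>" "pt \<tau> x = pt \<sigma> y" "eval_at y f \<noteq> 0"
      by (auto simp: principal_open_def)
    then have "((\<sigma>, y), (\<tau>, x)) \<in> glue D \<Sigma>"
      using pt_eq_iff \<sigma> \<tau> x by metis
    then obtain z where z: "z \<in> affine_chart D (\<sigma> \<inter> \<tau>)"
      "y = restrict_point D \<sigma> z" "x = restrict_point D \<tau> z"
      by (auto simp: glue_iff)
    then show "eval_at x ?g \<noteq> 0"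
      using ev[OF z(1)] y(3) l.unit[OF z(1)] eval_at_restrict[OF f] by simp
  next
    assume nz: "eval_at x ?g \<noteq> 0"
    then have "x m \<noteq> 0" using eval_at_mult_chart[OF x N mr] by auto
    then obtain z where z: "z \<in> affine_chart D (\<sigma> \<inter> \<tau>)" "x = restrict_point D \<tau> z"
      using l.extend[OF x] by blast
    then have "eval_at (restrict_point D \<sigma> z) f \<noteq> 0"
      using ev nz eval_at_restrict[OF f] by auto
    moreover have "pt \<tau> x = pt \<sigma> (restrict_point D \<sigma> z)"
      using pt_face[OF \<tau> inter[OF \<sigma> \<tau>] _ z(1)] pt_face[OF \<sigma> inter[OF \<sigma> \<tau>] _ z(1)] z(2) by simp
    moreover have "restrict_point D \<sigma> z \<in> affine_chart D \<sigma>"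
      by (rule restrict_point_chart[OF _ z(1)]) auto
    ultimately show "pt \<tau> x \<in> principal_open D \<Sigma> \<sigma> f"
      by (auto simp: principal_open_def)
  qed
  then show ?thesis using coordinate_ring_mult[OF N mr] by blast
qed

lemma openin_principal:
  "\<sigma> \<in> \<Sigma> \<Longrightarrow> f \<in> coordinate_ring D \<sigma> \<Longrightarrow> openin (zariski D \<Sigma>) (principal_open D \<Sigma> \<sigma> f)"
  unfolding zariski_def by (rule topology_generated_by_Basis) blast

lemma openin_chart: "\<sigma> \<in> \<Sigma> \<Longrightarrow> openin (zariski D \<Sigma>) (chart \<sigma>)"
  using openin_principal[OF _ one_in_coordinate_ring] by (simp add: principal_open_one)

lemma topspace_zariski: "topspace (zariski D \<Sigma>) = toric_variety D \<Sigma>"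
proof -
  have "\<Union> {principal_open D \<Sigma> \<sigma> f |\<sigma> f. \<sigma> \<in> \<Sigma> \<and> f \<in> coordinate_ring D \<sigma>} = (\<Union>\<sigma>\<in>\<Sigma>. chart \<sigma>)"
  proof
    show "(\<Union>\<sigma>\<in>\<Sigma>. chart \<sigma>) \<subseteq> \<Union> {principal_open D \<Sigma> \<sigma> f |\<sigma> f. \<sigma> \<in> \<Sigma> \<and> f \<in> coordinate_ring D \<sigma>}"
      unfolding principal_open_one[symmetric] using one_in_coordinate_ring by blast
  qed (use principal_open_subset in blast)
  also have "\<dots> = toric_variety D \<Sigma>"
    using in_toric_variety_iff unfolding chart_def by blast
  finally show ?thesis
    unfolding zariski_def topology_generated_by_topspace .
qed

lemma pt_in_topspace: "\<sigma> \<in> \<Sigma> \<Longrightarrow> x \<in> affine_chart D \<sigma> \<Longrightarrow> pt \<sigma> x \<in> topspace (zariski D \<Sigma>)"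
  unfolding topspace_zariski in_toric_variety_iff by blast

text \<open>The principal open sets of a single chart form a basis of its topology.\<close>

lemma open_contains_principal:
  assumes "openin (zariski D \<Sigma>) W" "\<tau> \<in> \<Sigma>" "x \<in> affine_chart D \<tau>" "pt \<tau> x \<in> W"
  shows "\<exists>g\<in>coordinate_ring D \<tau>. eval_at x g \<noteq> 0 \<and> principal_open D \<Sigma> \<tau> g \<subseteq> W"
proof -
  have "generate_topology_on {principal_open D \<Sigma> \<sigma> f |\<sigma> f. \<sigma> \<in> \<Sigma> \<and> f \<in> coordinate_ring D \<sigma>} W"
    using assms(1) by (simp add: zariski_def openin_topology_generated_by_iff)
  then show ?thesis using assms(4)
  proof induction
    case Empty
    then show ?case by simp
  next
    case (Int a b)
    then obtain g h where
      g: "g \<in> coordinate_ring D \<tau>" "eval_at x g \<noteq> 0" "principal_open D \<Sigma> \<tau> g \<subseteq> a" and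
      h: "h \<in> coordinate_ring D \<tau>" "eval_at x h \<noteq> 0" "principal_open D \<Sigma> \<tau> h \<subseteq> b"
      by auto
    have "principal_open D \<Sigma> \<tau> (g * h) \<subseteq> principal_open D \<Sigma> \<tau> g \<inter> principal_open D \<Sigma> \<tau> h"
      using eval_at_mult_chart[OF _ g(1) h(1)] by (auto simp: principal_open_def)
    then show ?case
      using g h eval_at_mult_chart[OF assms(3) g(1) h(1)]
      by (intro bexI[of _ "g * h"] coordinate_ring_mult) auto
  next
    case (UN K)
    then show ?case by blast
  next
    case (Basis s)
    then obtain \<sigma> f where s: "s = principal_open D \<Sigma> \<sigma> f" "\<sigma> \<in> \<Sigma>" "f \<in> coordinate_ring D \<sigma>"
      by blast
    obtain g where g: "g \<in> coordinate_ring D \<tau>"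
      "\<And>y. y \<in> affine_chart D \<tau> \<Longrightarrow> pt \<tau> y \<in> s \<longleftrightarrow> eval_at y g \<noteq> 0"
      using principal_open_localize[OF s(2) assms(2) s(3)] s(1) by blast
    then show ?case
      using Basis.prems assms(3) by (intro bexI[of _ g]) (auto simp: principal_open_def)
  qed
qed

end

section \<open>Divisors under maps that are isomorphisms in codimension one\<close>

lemma irreducible_closed_subset_closure:
  assumes Z: "irreducible_closed T Z" and U: "openin T U" and meet: "Z \<inter> U \<noteq> {}"
  shows "Z \<subseteq> T closure_of (Z \<inter> U)"
proof -
  have sub: "Z \<subseteq> topspace T" using Z by (simp add: irreducible_closed_def closedin_subset)
  have "Z \<inter> U \<subseteq> T closure_of (Z \<inter> U)"
    by (rule closure_of_subset) (use sub in auto)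
  then have "Z \<subseteq> T closure_of (Z \<inter> U) \<union> (topspace T - U)"
    using sub by auto
  moreover have "closedin T (topspace T - U)" using U by auto
  ultimately show ?thesis
    using Z meet unfolding irreducible_closed_def by (metis closedin_closure_of disjoint_iff DiffE subset_iff)
qed

lemma irreducible_closed_closure_of:
  assumes S: "S \<subseteq> topspace T" "S \<noteq> {}"
    and meet: "\<And>V W. openin T V \<Longrightarrow> openin T W \<Longrightarrow> V \<inter> S \<noteq> {} \<Longrightarrow> W \<inter> S \<noteq> {} \<Longrightarrow> V \<inter> W \<inter> S \<noteq> {}"
  shows "irreducible_closed T (T closure_of S)"
  unfolding irreducible_closed_def
proof (intro conjI allI impI; (elim conjE)?)
  show "T closure_of S \<noteq> {}" using closure_of_subset[OF S(1)] S(2) by auto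
next
  fix A B assume AB: "closedin T A" "closedin T B" "T closure_of S \<subseteq> A \<union> B"
  then have "S \<subseteq> A \<union> B" using closure_of_subset[OF S(1)] by auto
  then have "S \<subseteq> A \<or> S \<subseteq> B"
    using meet[of "topspace T - A" "topspace T - B"] AB(1,2) S(1) by blast
  then show "T closure_of S \<subseteq> A \<or> T closure_of S \<subseteq> B"
    using AB(1,2) closure_of_minimal by metis
qed auto

lemma irreducible_closed_finite_union:
  assumes "finite \<C>" "irreducible_closed T Z" "\<And>C. C \<in> \<C> \<Longrightarrow> closedin T C" "Z \<subseteq> \<Union>\<C>"
  shows "\<exists>C\<in>\<C>. Z \<subseteq> C"
  using assms(1,3,4)
proof (induction \<C>)
  case empty
  then show ?case using assms(2) by (auto simp: irreducible_closed_def)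
next
  case (insert C \<C>)
  then have "closedin T C" "closedin T (\<Union>\<C>)" "Z \<subseteq> C \<union> \<Union>\<C>" by (auto intro: closedin_Union)
  then have "Z \<subseteq> C \<or> Z \<subseteq> \<Union>\<C>" using assms(2) by (simp add: irreducible_closed_def)
  then show ?case using insert by auto
qed

text \<open>
  A divisor cannot lie in the complement of \<open>U\<close>: by irreducibility it would lie in one member of
  the cover, which is irreducible, proper and strictly larger, since it meets \<open>U\<close>.
\<close>

lemma prime_divisor_meets:
  assumes Z: "prime_divisor T Z" and fin: "finite \<C>" and cover: "topspace T - U \<subseteq> \<Union>\<C>"
    and \<C>: "\<And>C. C \<in> \<C> \<Longrightarrow> irreducible_closed T C \<and> C \<inter> U \<noteq> {} \<and> C \<noteq> topspace T"
  shows "Z \<inter> U \<noteq> {}"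
proof
  assume disj: "Z \<inter> U = {}"
  have irr: "irreducible_closed T Z" and sub: "Z \<subseteq> topspace T"
    using Z by (auto simp: prime_divisor_def)
  obtain C where C: "C \<in> \<C>" "Z \<subseteq> C"
    using irreducible_closed_finite_union[OF fin irr] \<C> disj sub cover
    unfolding irreducible_closed_def by (metis (no_types, lifting) Diff_iff disjoint_iff subset_iff)
  have "Z \<subset> C" using C disj \<C> by blast
  moreover have "C \<subset> topspace T"
    using \<C>[OF C(1)] closedin_subset[of T C] by (auto simp: irreducible_closed_def)
  ultimately show False using Z \<C>[OF C(1)] by (auto simp: prime_divisor_def)
qed

text \<open>
  A divisor \<open>Z\<close> upstairs is the closure of its trace on the open set \<open>U\<close> on which \<open>\<phi>\<close> is an open
  embedding, so the closure of its image has trace \<open>\<phi>(Z \<inter> U)\<close> on \<open>\<phi>(U)\<close>. An irreducible closed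
  set strictly between this closure and the whole space downstairs could be transported back along
  the embedding to one strictly between \<open>Z\<close> and the whole space upstairs.
\<close>

lemma contracts_no_divisor_open_embedding:
  assumes cont: "continuous_map X Y \<phi>"
    and U: "openin X U" and inj: "inj_on \<phi> U"
    and op: "\<And>W. openin X W \<Longrightarrow> W \<subseteq> U \<Longrightarrow> openin Y (\<phi> ` W)"
    and denseX: "\<And>W. openin X W \<Longrightarrow> W \<noteq> {} \<Longrightarrow> W \<inter> U \<noteq> {}"
    and denseY: "\<And>W. openin Y W \<Longrightarrow> W \<noteq> {} \<Longrightarrow> W \<inter> \<phi> ` U \<noteq> {}"
    and meets: "\<And>Z. prime_divisor X Z \<Longrightarrow> Z \<inter> U \<noteq> {}"
  shows "contracts_no_divisor X Y \<phi>"
  unfolding contracts_no_divisor_def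
proof (intro allI impI)
  fix Z assume Z: "prime_divisor X Z"
  let ?C = "Y closure_of (\<phi> ` Z)"
  have irrZ: "irreducible_closed X Z" and Zsub: "Z \<subset> topspace X"
    using Z by (auto simp: prime_divisor_def)
  have Zcl: "closedin X Z" using irrZ by (simp add: irreducible_closed_def)
  have \<phi>Z: "\<phi> ` Z \<subseteq> topspace Y"
    using cont Zsub continuous_map_image_subset_topspace by fastforce
  have pre: "closedin X {x \<in> topspace X. \<phi> x \<in> A}" if "closedin Y A" for A
    using cont that by (rule closedin_continuous_map_preimage)
  have Zdense: "Z \<subseteq> X closure_of (Z \<inter> U)"
    by (rule irreducible_closed_subset_closure[OF irrZ U meets[OF Z]])
  have Csub: "?C \<subseteq> Y closure_of (\<phi> ` (Z \<inter> U))"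
  proof -
    have "\<phi> ` Z \<subseteq> \<phi> ` (X closure_of (Z \<inter> U))" using Zdense by auto
    also have "\<dots> \<subseteq> Y closure_of (\<phi> ` (Z \<inter> U))"
      by (rule continuous_map_image_closure_subset[OF cont])
    finally show ?thesis by (simp add: closure_of_minimal)
  qed
  have irrC: "irreducible_closed Y ?C"
    unfolding irreducible_closed_def
  proof (intro conjI allI impI; (elim conjE)?)
    show "?C \<noteq> {}" using closure_of_subset[OF \<phi>Z] irrZ by (auto simp: irreducible_closed_def)
  next
    fix A B assume AB: "closedin Y A" "closedin Y B" "?C \<subseteq> A \<union> B"
    then have "Z \<subseteq> {x \<in> topspace X. \<phi> x \<in> A} \<union> {x \<in> topspace X. \<phi> x \<in> B}"
      using closure_of_subset[OF \<phi>Z] Zsub by blast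
    then have "Z \<subseteq> {x \<in> topspace X. \<phi> x \<in> A} \<or> Z \<subseteq> {x \<in> topspace X. \<phi> x \<in> B}"
      using irrZ pre[OF AB(1)] pre[OF AB(2)] by (auto simp: irreducible_closed_def)
    then have "\<phi> ` Z \<subseteq> A \<or> \<phi> ` Z \<subseteq> B" by auto
    then show "?C \<subseteq> A \<or> ?C \<subseteq> B" using AB closure_of_minimal by metis
  qed auto
  have trace: "u \<in> Z" if u: "u \<in> U" "\<phi> u \<in> ?C" for u
  proof (rule ccontr)
    assume "u \<notin> Z"
    have "openin Y (\<phi> ` (U - Z))" using U Zcl by (intro op openin_diff) auto
    moreover have "\<phi> u \<in> \<phi> ` (U - Z)" using u \<open>u \<notin> Z\<close> by auto
    moreover have "\<phi> u \<in> Y closure_of (\<phi> ` (Z \<inter> U))" using Csub u(2) by (rule subsetD)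
    ultimately obtain y where "y \<in> \<phi> ` (Z \<inter> U)" "y \<in> \<phi> ` (U - Z)"
      by (metis in_closure_of)
    then show False using inj by (auto simp: inj_on_def)
  qed
  have proper: "?C \<noteq> topspace Y"
  proof
    assume eq: "?C = topspace Y"
    have "U \<subseteq> Z"
      using trace continuous_map_image_subset_topspace[OF cont] openin_subset[OF U] unfolding eq by blast
    moreover have "openin X (topspace X - Z)" using Zcl by auto
    ultimately show False using denseX[of "topspace X - Z"] Zsub by blast
  qed
  have maximal: "False" if Y': "irreducible_closed Y Y'" "?C \<subset> Y'" "Y' \<subset> topspace Y" for Y'
  proof -
    let ?P = "U \<inter> {x \<in> topspace X. \<phi> x \<in> Y'}"
    let ?Z' = "X closure_of ?P"
    have Ycl: "closedin Y Y'" using Y'(1) by (simp add: irreducible_closed_def)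
    have P: "?P \<subseteq> ?Z'" by (rule closure_of_subset) auto
    have ZP: "Z \<inter> U \<subseteq> ?P"
      using closure_of_subset[OF \<phi>Z] Y'(2) Zsub by auto
    have "Z \<subseteq> ?Z'" using Zdense closure_of_mono[OF ZP] by auto
    have "irreducible_closed X ?Z'"
      unfolding irreducible_closed_def
    proof (intro conjI allI impI; (elim conjE)?)
      show "?Z' \<noteq> {}" using P ZP meets[OF Z] by auto
    next
      fix A B assume AB: "closedin X A" "closedin X B" "?Z' \<subseteq> A \<union> B"
      have "closedin Y (topspace Y - \<phi> ` (U - A))" "closedin Y (topspace Y - \<phi> ` (U - B))"
        using op[of "U - A"] op[of "U - B"] U AB by auto
      moreover have "Y' \<subseteq> (topspace Y - \<phi> ` (U - A)) \<union> (topspace Y - \<phi> ` (U - B))"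
      proof (rule ccontr)
        assume "\<not> ?thesis"
        then obtain u u' where "u \<in> U - A" "u' \<in> U - B" "\<phi> u = \<phi> u'" "\<phi> u \<in> Y'"
          using Y'(3) by blast
        moreover from this have "u = u'" using inj by (auto simp: inj_on_def)
        ultimately have "u \<in> ?P" "u \<notin> A \<union> B" using openin_subset[OF U] by auto
        then show False using P AB(3) by blast
      qed
      ultimately have "Y' \<subseteq> topspace Y - \<phi> ` (U - A) \<or> Y' \<subseteq> topspace Y - \<phi> ` (U - B)"
        using Y'(1) by (simp add: irreducible_closed_def)
      then have "?P \<subseteq> A \<or> ?P \<subseteq> B" by blast
      then show "?Z' \<subseteq> A \<or> ?Z' \<subseteq> B" using AB closure_of_minimal by metis
    qed auto
    moreover have "?Z' \<noteq> Z"
    proof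
      assume eq: "?Z' = Z"
      have "openin Y (\<phi> ` U)" using op[OF U] by simp
      moreover have "Y' \<inter> \<phi> ` U \<noteq> {}" using ZP meets[OF Z] by blast
      ultimately have "Y' \<subseteq> Y closure_of (Y' \<inter> \<phi> ` U)"
        by (rule irreducible_closed_subset_closure[OF Y'(1)])
      also have "Y' \<inter> \<phi> ` U \<subseteq> \<phi> ` Z" using P openin_subset[OF U] unfolding eq by blast
      then have "Y closure_of (Y' \<inter> \<phi> ` U) \<subseteq> ?C" by (rule closure_of_mono)
      finally show False using Y'(2) by auto
    qed
    moreover have "?Z' \<noteq> topspace X"
    proof
      assume eq: "?Z' = topspace X"
      have "u \<in> ?P" if u: "u \<in> U" for u
      proof (rule ccontr)
        assume "u \<notin> ?P"
        let ?W = "U \<inter> (topspace X - {x \<in> topspace X. \<phi> x \<in> Y'})"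
        have "openin X ?W" using U pre[OF Ycl] by auto
        then have "?W \<inter> ?Z' = {}" by (subst openin_Int_closure_of_eq_empty) auto
        moreover have "u \<in> topspace X" using u openin_subset[OF U] by blast
        moreover from this have "u \<in> ?W" using u \<open>u \<notin> ?P\<close> by blast
        ultimately show False unfolding eq by blast
      qed
      then have "\<phi> ` U \<subseteq> Y'" by auto
      moreover have "openin Y (topspace Y - Y')" using Ycl by auto
      ultimately show False using denseY[of "topspace Y - Y'"] Y'(3) by blast
    qed
    moreover have "?Z' \<subseteq> topspace X" by (rule closure_of_subset_topspace)
    ultimately show False using Z \<open>Z \<subseteq> ?Z'\<close> unfolding prime_divisor_def by blast
  qed
  have "?C \<subset> topspace Y" using proper closure_of_subset_topspace by (rule psubsetI[rotated])
  moreover have "\<nexists>Y'. irreducible_closed Y Y' \<and> ?C \<subset> Y' \<and> Y' \<subset> topspace Y"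
  proof
    assume "\<exists>Y'. irreducible_closed Y Y' \<and> ?C \<subset> Y' \<and> Y' \<subset> topspace Y"
    then show False by (elim exE conjE) (rule maximal)
  qed
  ultimately show "prime_divisor Y ?C"
    using irrC by (simp only: prime_divisor_def simp_thms)
qed

section \<open>Density of the torus\<close>

lemma exp_sum_eventually_nonzero:
  fixes c :: "'a \<Rightarrow> complex" and w :: "'a \<Rightarrow> real"
  assumes K: "finite K" "K \<noteq> {}" and inj: "inj_on w K" and c: "\<And>m. m \<in> K \<Longrightarrow> c m \<noteq> 0"
  shows "\<forall>\<^sub>F s in at_top. (\<Sum>m\<in>K. c m * of_real (exp (s * w m))) \<noteq> 0"
proof -
  have "Max (w ` K) \<in> w ` K" using K by (intro Max_in) auto
  then obtain m0 where m0: "m0 \<in> K" "Max (w ` K) = w m0" by blast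
  have less: "w m - w m0 < 0" if m: "m \<in> K" "m \<noteq> m0" for m
  proof -
    have "w m \<le> w m0" using Max_ge[of "w ` K" "w m"] K(1) m(1) m0(2) by simp
    moreover have "w m \<noteq> w m0" using inj_onD[OF inj] m m0(1) by blast
    ultimately show ?thesis by simp
  qed
  have lim: "((\<lambda>s. c m * of_real (exp (s * (w m - w m0)))) \<longlongrightarrow> (if m = m0 then c m0 else 0)) at_top"
    if m: "m \<in> K" for m
  proof (cases "m = m0")
    case False
    have "filterlim (\<lambda>s. s * (w m - w m0)) at_bot at_top"
      using filterlim_tendsto_neg_mult_at_bot[OF tendsto_const less[OF m False] filterlim_ident]
      by (simp add: mult.commute)
    then have "((\<lambda>s. exp (s * (w m - w m0))) \<longlongrightarrow> 0) at_top"
      by (rule filterlim_compose[OF exp_at_bot])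
    then have "((\<lambda>s. c m * of_real (exp (s * (w m - w m0)))) \<longlongrightarrow> c m * of_real 0) at_top"
      by (intro tendsto_intros)
    then show ?thesis using False by simp
  qed auto
  have "((\<lambda>s. \<Sum>m\<in>K. c m * of_real (exp (s * (w m - w m0)))) \<longlongrightarrow>
      (\<Sum>m\<in>K. if m = m0 then c m0 else 0)) at_top"
    by (rule tendsto_sum) (rule lim)
  then have "\<forall>\<^sub>F s in at_top. (\<Sum>m\<in>K. c m * of_real (exp (s * (w m - w m0)))) \<noteq> 0"
    using m0 K c by (intro tendsto_imp_eventually_ne[where c = "c m0"]) auto
  then show ?thesis
  proof eventually_elim
    case (elim s)
    have "(\<Sum>m\<in>K. c m * of_real (exp (s * w m))) =
        of_real (exp (s * w m0)) * (\<Sum>m\<in>K. c m * of_real (exp (s * (w m - w m0))))"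
      unfolding sum_distrib_left
      by (rule sum.cong) (simp_all add: exp_diff right_diff_distrib exp_not_eq_zero)
    then show ?case using elim by simp
  qed
qed

text \<open>Finitely many hyperplanes do not cover the space.\<close>

lemma exists_generic_vector:
  assumes "finite Q" "0 \<notin> Q"
  shows "\<exists>v. \<forall>q\<in>Q. pairing q v \<noteq> 0"
  using assms
proof (induction Q)
  case (insert q Q)
  then obtain v where v: "\<And>q. q \<in> Q \<Longrightarrow> pairing q v \<noteq> 0" by auto
  obtain d where d: "lookup q d \<noteq> 0"
    using insert.prems by (metis insertI1 lookup_zero poly_mapping_eqI)
  let ?bad = "insert 0 ((\<lambda>p. - pairing p v / real_of_int (lookup p d)) ` insert q Q)"
  obtain \<epsilon> where \<epsilon>: "\<epsilon> \<notin> ?bad"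
    using ex_new_if_finite[OF infinite_UNIV_char_0, of ?bad] insert.hyps(1) by blast
  have "pairing p (v + Poly_Mapping.single d \<epsilon>) \<noteq> 0" if p: "p \<in> insert q Q" for p
  proof (cases "lookup p d = 0")
    case True
    then show ?thesis using p d v by (auto simp: pairing_add_right pairing_single_right)
  next
    case False
    have "\<epsilon> \<noteq> - pairing p v / real_of_int (lookup p d)" using \<epsilon> p by auto
    then show ?thesis using False
      by (simp add: pairing_add_right pairing_single_right field_simps add_eq_0_iff)
  qed
  then show ?case by blast
qed auto

lemma dual_monoid_zero_cone: "dual_monoid D {0} = {m. keys m \<subseteq> D}"
  by (auto simp: dual_monoid_def)

lemma torus_point:
  "(\<lambda>m. if keys m \<subseteq> D then of_real (exp (s * pairing m v)) else 0) \<in> affine_chart D {0}"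
  using keys_add_subset[of _ D] 
  by (auto simp: affine_chart_def dual_monoid_zero_cone pairing_add_left distrib_left exp_add)

text \<open>
  Along a one-parameter subgroup \<open>s \<mapsto> (m \<mapsto> exp (s \<langle>m, v\<rangle>))\<close> in a generic direction \<open>v\<close> the
  characters occurring in \<open>f\<close> and \<open>g\<close> grow at different rates, so both functions are eventually
  dominated by a single term.
\<close>

lemma torus_nonvanishing:
  assumes f: "f \<in> coordinate_ring D {0}" "f \<noteq> 0" and g: "g \<in> coordinate_ring D {0}" "g \<noteq> 0"
  shows "\<exists>t\<in>affine_chart D {0}. eval_at t f \<noteq> 0 \<and> eval_at t g \<noteq> 0"
proof -
  define K where "K = keys f \<union> keys g"
  have "finite ((\<lambda>(m, m'). m - m') ` (K \<times> K) - {0})"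
    by (simp add: K_def)
  then obtain v where v: "\<And>q. q \<in> (\<lambda>(m, m'). m - m') ` (K \<times> K) - {0} \<Longrightarrow> pairing q v \<noteq> 0"
    using exists_generic_vector by (metis Diff_iff singletonI)
  have inj: "inj_on (\<lambda>m. pairing m v) K"
  proof (rule inj_onI, rule ccontr)
    fix m m' assume "m \<in> K" "m' \<in> K" "pairing m v = pairing m' v" "m \<noteq> m'"
    then show False using v[of "m - m'"] by (force simp: pairing_diff_left)
  qed
  define t where "t s = (\<lambda>m. if keys m \<subseteq> D then complex_of_real (exp (s * pairing m v)) else 0)" for s
  have "\<forall>\<^sub>F s in at_top. eval_at (t s) h \<noteq> 0"
    if h: "h \<in> coordinate_ring D {0}" "h \<noteq> 0" "keys h \<subseteq> K" for h
  proof -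
    have "\<forall>\<^sub>F s in at_top. (\<Sum>m\<in>keys h. lookup h m * of_real (exp (s * pairing m v))) \<noteq> 0"
      using h inj by (intro exp_sum_eventually_nonzero) (auto simp: in_keys_iff intro: inj_on_subset)
    moreover have "eval_at (t s) h = (\<Sum>m\<in>keys h. lookup h m * of_real (exp (s * pairing m v)))" for s
      unfolding eval_at_def using h(1)
      by (intro sum.cong) (auto simp: t_def coordinate_ring_def dual_monoid_zero_cone)
    ultimately show ?thesis by simp
  qed
  then have "\<forall>\<^sub>F s in at_top. eval_at (t s) f \<noteq> 0 \<and> eval_at (t s) g \<noteq> 0"
    using f g by (intro eventually_conj) (simp_all add: K_def)
  then obtain s where "eval_at (t s) f \<noteq> 0 \<and> eval_at (t s) g \<noteq> 0"
    using eventually_happens'[OF trivial_limit_at_top_linorder] by blast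
  moreover have "t s \<in> affine_chart D {0}" unfolding t_def by (rule torus_point)
  ultimately show ?thesis by blast
qed

text \<open>
  The points of the chart of a ray whose nonzero coordinates are the characters orthogonal to the
  ray; these make up the torus orbit of codimension one that belongs to the ray.
\<close>

definition orbit_point ::
    "'d set \<Rightarrow> ('d \<Rightarrow>\<^sub>0 real) \<Rightarrow> (('d \<Rightarrow>\<^sub>0 int) \<Rightarrow> complex) \<Rightarrow> ('d \<Rightarrow>\<^sub>0 int) \<Rightarrow> complex" where
  "orbit_point D v t m = (if keys m \<subseteq> D \<and> pairing m v = 0 then t m else 0)"

definition orthogonal_part :: "('d \<Rightarrow>\<^sub>0 real) \<Rightarrow> (('d \<Rightarrow>\<^sub>0 int) \<Rightarrow>\<^sub>0 complex) \<Rightarrow> (('d \<Rightarrow>\<^sub>0 int) \<Rightarrow>\<^sub>0 complex)" where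
  "orthogonal_part v f = (\<Sum>m\<in>{m\<in>keys f. pairing m v = 0}. Poly_Mapping.single m (lookup f m))"

lemma orbit_point_in_chart:
  assumes t: "t \<in> affine_chart D {0}"
  shows "orbit_point D v t \<in> affine_chart D (convex_cone hull {v})"
  using chart_zero[OF t] chart_add[OF t]
  by (auto simp: affine_chart_def orbit_point_def dual_monoid_hull dual_monoid_zero_cone
      pairing_add_left add_nonneg_eq_0_iff keys_add_subset)

lemma eval_at_orthogonal_part:
  "eval_at x (orthogonal_part v f) = (\<Sum>m\<in>{m\<in>keys f. pairing m v = 0}. lookup f m * x m)"
  by (simp add: orthogonal_part_def eval_at_sum)

lemma eval_at_supported:
  assumes "\<And>m. m \<in> keys f \<Longrightarrow> x m \<noteq> 0 \<Longrightarrow> pairing m v = 0"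
  shows "eval_at x f = eval_at x (orthogonal_part v f)"
  unfolding eval_at_orthogonal_part unfolding eval_at_def
  by (rule sum.mono_neutral_right) (use assms in auto)

lemma eval_at_orbit_point:
  assumes "f \<in> coordinate_ring D \<sigma>"
  shows "eval_at (orbit_point D v t) f = eval_at t (orthogonal_part v f)"
proof -
  have "eval_at (orbit_point D v t) f = eval_at (orbit_point D v t) (orthogonal_part v f)"
    by (rule eval_at_supported) (auto simp: orbit_point_def split: if_splits)
  also have "\<dots> = eval_at t (orthogonal_part v f)"
    unfolding eval_at_orthogonal_part using assms
    by (intro sum.cong) (auto simp: orbit_point_def coordinate_ring_def dual_monoid_def)
  finally show ?thesis .
qed

lemma orthogonal_part_in_torus_ring:
  assumes "f \<in> coordinate_ring D \<sigma>"
  shows "orthogonal_part v f \<in> coordinate_ring D {0}"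
proof -
  have "keys (orthogonal_part v f) \<subseteq> {m. keys m \<subseteq> D}"
    unfolding orthogonal_part_def using assms
    by (intro keys_sum_subset) (auto simp: coordinate_ring_def dual_monoid_def)
  then show ?thesis by (simp add: coordinate_ring_def dual_monoid_zero_cone)
qed

context toric_fan
begin

text \<open>A function that does not vanish at some point of a chart is nonzero, hence nonzero at some torus point.\<close>

lemma torus_dense:
  assumes "{0} \<in> \<Sigma>" and W: "openin (zariski D \<Sigma>) W" "W \<noteq> {}"
  shows "W \<inter> chart {0} \<noteq> {}"
proof -
  obtain p where p: "p \<in> W" using W by auto
  then obtain \<sigma> x where x: "\<sigma> \<in> \<Sigma>" "x \<in> affine_chart D \<sigma>" "p = pt \<sigma> x"
    using openin_subset[OF W(1)] topspace_zariski in_toric_variety_iff by blast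
  obtain g where g: "g \<in> coordinate_ring D \<sigma>" "eval_at x g \<noteq> 0" "principal_open D \<Sigma> \<sigma> g \<subseteq> W"
    using open_contains_principal[OF W(1) x(1,2)] p x(3) by blast
  have sub: "{0} \<subseteq> \<sigma>" using zero_in_cone x(1) by auto
  have "g \<in> coordinate_ring D {0}" using g(1) coordinate_ring_antimono[OF sub] by auto
  then obtain t where t: "t \<in> affine_chart D {0}" "eval_at t g \<noteq> 0"
    using torus_nonvanishing[of g D g] g(2) by fastforce
  have "pt \<sigma> (restrict_point D \<sigma> t) \<in> principal_open D \<Sigma> \<sigma> g"
    using principal_open_iff[OF x(1) restrict_point_chart[OF sub t(1)]] eval_at_restrict[OF g(1)] t(2)
    by simp
  moreover have "pt \<sigma> (restrict_point D \<sigma> t) = pt {0} t" by (rule pt_face[OF x(1) assms(1) sub t(1)])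
  ultimately show ?thesis using g(3) t(1) by (auto simp: chart_def)
qed

definition orbit :: "('d \<Rightarrow>\<^sub>0 real) \<Rightarrow> 'd chart_point set set" where
  "orbit v = (\<lambda>t. pt (convex_cone hull {v}) (orbit_point D v t)) ` affine_chart D {0}"

context
  fixes v
  assumes zero_cone: "{0} \<in> \<Sigma>" and ray: "convex_cone hull {v} \<in> \<Sigma>"
    and v: "v \<in> lattice_points D" "v \<noteq> 0"
begin

lemma orbit_subset_chart: "orbit v \<subseteq> chart (convex_cone hull {v})"
  using orbit_point_in_chart by (auto simp: orbit_def chart_def)

lemma orbit_subset_topspace: "orbit v \<subseteq> topspace (zariski D \<Sigma>)"
  using orbit_subset_chart openin_subset[OF openin_chart[OF ray]] by blast

lemma orbit_nonempty: "orbit v \<noteq> {}"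
  using torus_point[of D 0 0] by (auto simp: orbit_def)

lemma open_meets_orbit:
  assumes "openin (zariski D \<Sigma>) W" "W \<inter> orbit v \<noteq> {}"
  shows "\<exists>h\<in>coordinate_ring D {0}. h \<noteq> 0 \<and>
    (\<forall>t\<in>affine_chart D {0}. eval_at t h \<noteq> 0 \<longrightarrow> pt (convex_cone hull {v}) (orbit_point D v t) \<in> W)"
proof -
  obtain t where t: "t \<in> affine_chart D {0}" "pt (convex_cone hull {v}) (orbit_point D v t) \<in> W"
    using assms(2) by (auto simp: orbit_def)
  obtain g where g: "g \<in> coordinate_ring D (convex_cone hull {v})" "eval_at (orbit_point D v t) g \<noteq> 0"
    "principal_open D \<Sigma> (convex_cone hull {v}) g \<subseteq> W"
    using open_contains_principal[OF assms(1) ray orbit_point_in_chart[OF t(1)] t(2)] by blast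
  then show ?thesis
    using principal_open_iff[OF ray orbit_point_in_chart] eval_at_orbit_point[OF g(1)]
    by (intro bexI[of _ "orthogonal_part v g"] orthogonal_part_in_torus_ring[OF g(1)]) auto
qed

text \<open>
  Two open sets meeting the orbit are detected by two nonzero functions on the torus, which do not
  vanish at a common torus point.
\<close>

lemma irreducible_orbit_closure: "irreducible_closed (zariski D \<Sigma>) (zariski D \<Sigma> closure_of orbit v)"
proof (rule irreducible_closed_closure_of[OF orbit_subset_topspace orbit_nonempty])
  fix V W assume "openin (zariski D \<Sigma>) V" "openin (zariski D \<Sigma>) W" "V \<inter> orbit v \<noteq> {}" "W \<inter> orbit v \<noteq> {}"
  then obtain g h where gh: "g \<in> coordinate_ring D {0}" "g \<noteq> 0" "h \<in> coordinate_ring D {0}" "h \<noteq> 0"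
    "\<And>t. t \<in> affine_chart D {0} \<Longrightarrow> eval_at t g \<noteq> 0 \<Longrightarrow> pt (convex_cone hull {v}) (orbit_point D v t) \<in> V"
    "\<And>t. t \<in> affine_chart D {0} \<Longrightarrow> eval_at t h \<noteq> 0 \<Longrightarrow> pt (convex_cone hull {v}) (orbit_point D v t) \<in> W"
    using open_meets_orbit by metis
  obtain t where "t \<in> affine_chart D {0}" "eval_at t g \<noteq> 0" "eval_at t h \<noteq> 0"
    using torus_nonvanishing[OF gh(1-4)] by blast
  then show "V \<inter> W \<inter> orbit v \<noteq> {}" using gh(5,6) by (auto simp: orbit_def)
qed

text \<open>A character positive on \<open>v\<close> vanishes on the orbit, but is invertible on the torus.\<close>

lemma orbit_disjoint_torus: "orbit v \<inter> chart {0} = {}"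
proof (rule ccontr)
  let ?\<rho> = "convex_cone hull {v}"
  assume "orbit v \<inter> chart {0} \<noteq> {}"
  then obtain t z where t: "t \<in> affine_chart D {0}" "z \<in> affine_chart D {0}"
    "pt ?\<rho> (orbit_point D v t) = pt {0} z"
    by (auto simp: orbit_def chart_def)
  have sub: "{0} \<subseteq> ?\<rho>" using zero_in_cone[OF ray] by auto
  have "pt ?\<rho> (orbit_point D v t) = pt ?\<rho> (restrict_point D ?\<rho> z)"
    using t(3) pt_face[OF ray zero_cone sub t(2)] by simp
  then have eq: "orbit_point D v t = restrict_point D ?\<rho> z"
    using pt_inj[OF ray orbit_point_in_chart[OF t(1)] restrict_point_chart[OF sub t(2)]] by simp
  obtain d where d: "lookup v d \<noteq> 0"
    using v(2) by (metis lookup_zero poly_mapping_eqI)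
  define m where "m = Poly_Mapping.single d (if lookup v d > 0 then 1 else - 1 :: int)"
  have m: "0 < pairing m v" using d by (simp add: m_def pairing_single_left)
  have k: "keys m \<subseteq> D" using v(1) d by (auto simp: m_def lattice_points_def in_keys_iff split: if_splits)
  then have "m \<in> dual_monoid D ?\<rho>" using m by (simp add: dual_monoid_hull)
  then have "z m = 0" using fun_cong[OF eq, of m] m by (simp add: orbit_point_def restrict_point_def)
  moreover have "m \<in> dual_monoid D {0}" "- m \<in> dual_monoid D {0}" using k by (auto simp: dual_monoid_zero_cone)
  ultimately show False using chart_unit[OF t(2), of m] by simp
qed

lemma orbit_closure_proper: "zariski D \<Sigma> closure_of orbit v \<noteq> topspace (zariski D \<Sigma>)"
proof
  assume "zariski D \<Sigma> closure_of orbit v = topspace (zariski D \<Sigma>)"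
  moreover have "pt {0} (\<lambda>m. if keys m \<subseteq> D then of_real (exp (0 * pairing m 0)) else 0) \<in> chart {0}" (is "?p \<in> _")
    using torus_point[of D 0 0] unfolding chart_def by blast
  moreover have "openin (zariski D \<Sigma>) (chart {0})" by (rule openin_chart[OF zero_cone])
  ultimately have "orbit v \<inter> chart {0} \<noteq> {}"
    using openin_subset unfolding in_closure_of set_eq_iff by blast
  then show False using orbit_disjoint_torus by simp
qed

text \<open>
  Near a point with all nonzero coordinates orthogonal to \<open>v\<close>, a function \<open>f\<close> that does not vanish
  there has a nonzero part \<open>f\<^sub>0\<close> orthogonal to \<open>v\<close>; a torus point with \<open>f\<^sub>0 \<noteq> 0\<close> gives a point
  of the orbit with \<open>f \<noteq> 0\<close>.
\<close>

lemma in_orbit_closure: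
  assumes \<sigma>: "\<sigma> \<in> \<Sigma>" "convex_cone hull {v} \<subseteq> \<sigma>" and x: "x \<in> affine_chart D \<sigma>"
    and supp: "\<And>m. m \<in> dual_monoid D \<sigma> \<Longrightarrow> x m \<noteq> 0 \<Longrightarrow> pairing m v = 0"
  shows "pt \<sigma> x \<in> zariski D \<Sigma> closure_of orbit v"
  unfolding in_closure_of
proof (intro conjI allI impI pt_in_topspace \<sigma> x, elim conjE)
  let ?\<rho> = "convex_cone hull {v}"
  fix W assume W: "pt \<sigma> x \<in> W" "openin (zariski D \<Sigma>) W"
  obtain g where g: "g \<in> coordinate_ring D \<sigma>" "eval_at x g \<noteq> 0" "principal_open D \<Sigma> \<sigma> g \<subseteq> W"
    using open_contains_principal[OF W(2) \<sigma>(1) x W(1)] by blast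
  have "eval_at x g = eval_at x (orthogonal_part v g)"
    using supp g(1) by (intro eval_at_supported) (auto simp: coordinate_ring_def)
  then have "orthogonal_part v g \<noteq> 0" using g(2) by auto
  then obtain t where t: "t \<in> affine_chart D {0}" "eval_at t (orthogonal_part v g) \<noteq> 0"
    using torus_nonvanishing orthogonal_part_in_torus_ring[OF g(1)] by blast
  let ?y = "restrict_point D \<sigma> (orbit_point D v t)"
  have "eval_at ?y g \<noteq> 0"
    using t(2) by (simp add: eval_at_restrict[OF g(1)] eval_at_orbit_point[OF g(1)])
  then have "pt \<sigma> ?y \<in> W"
    using principal_open_iff[OF \<sigma>(1) restrict_point_chart[OF \<sigma>(2) orbit_point_in_chart[OF t(1)]]] g(3) by blast
  moreover have "pt \<sigma> ?y = pt ?\<rho> (orbit_point D v t)"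
    by (rule pt_face[OF \<sigma>(1) ray \<sigma>(2) orbit_point_in_chart[OF t(1)]])
  ultimately show "\<exists>y. y \<in> orbit v \<and> y \<in> W" using t(1) by (auto simp: orbit_def)
qed

end

end

section \<open>The morphism of a refinement without new rays\<close>

text \<open>
  The assumption \<open>vanishing_ray\<close> says that a point of a chart outside the torus lies on the divisor
  of one of the common rays.
\<close>

locale small_refinement = fine: toric_fan D \<Sigma>' + coarse: toric_fan D \<Sigma>
  for D :: "'d set" and \<Sigma>' \<Sigma> +
  fixes rays :: "('d \<Rightarrow>\<^sub>0 real) set"
  assumes refines: "\<sigma>' \<in> \<Sigma>' \<Longrightarrow> \<exists>\<sigma>\<in>\<Sigma>. \<sigma>' \<subseteq> \<sigma>"
    and zero_cone: "{0} \<in> \<Sigma>'" "{0} \<in> \<Sigma>"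
    and finite_rays: "finite rays"
    and rays: "v \<in> rays \<Longrightarrow> v \<in> lattice_points D" "v \<in> rays \<Longrightarrow> v \<noteq> 0"
      "v \<in> rays \<Longrightarrow> convex_cone hull {v} \<in> \<Sigma>'" "v \<in> rays \<Longrightarrow> convex_cone hull {v} \<in> \<Sigma>"
    and vanishing_ray: "\<sigma>' \<in> \<Sigma>' \<Longrightarrow> x \<in> affine_chart D \<sigma>' \<Longrightarrow> m \<in> dual_monoid D \<sigma>' \<Longrightarrow> x m = 0 \<Longrightarrow>
      \<exists>v\<in>rays. convex_cone hull {v} \<subseteq> \<sigma>' \<and> (\<forall>q\<in>dual_monoid D \<sigma>'. x q \<noteq> 0 \<longrightarrow> pairing q v = 0)"
begin

lemma toric_morphism_pt:
  assumes \<sigma>': "\<sigma>' \<in> \<Sigma>'" "x \<in> affine_chart D \<sigma>'" and \<sigma>: "\<sigma> \<in> \<Sigma>" "\<sigma>' \<subseteq> \<sigma>"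
  shows "toric_morphism D \<Sigma> (fine.pt \<sigma>' x) = coarse.pt \<sigma> (restrict_point D \<sigma> x)"
proof -
  have eq: "coarse.pt \<tau> (restrict_point D \<tau> y) = coarse.pt \<sigma> (restrict_point D \<sigma> x)"
    if y: "(\<tau>', y) \<in> fine.pt \<sigma>' x" and \<tau>: "\<tau> \<in> \<Sigma>" "\<tau>' \<subseteq> \<tau>" for \<tau>' y \<tau>
  proof -
    obtain z where z: "z \<in> affine_chart D (\<sigma>' \<inter> \<tau>')"
      "x = restrict_point D \<sigma>' z" "y = restrict_point D \<tau>' z"
      using y by (auto simp: fine.glue_iff)
    let ?w = "restrict_point D (\<sigma> \<inter> \<tau>) z"
    have w: "?w \<in> affine_chart D (\<sigma> \<inter> \<tau>)"
      by (rule restrict_point_chart[OF _ z(1)]) (use \<sigma> \<tau> in auto)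
    have "restrict_point D \<sigma> x = restrict_point D \<sigma> ?w" "restrict_point D \<tau> y = restrict_point D \<tau> ?w"
      using z \<sigma> \<tau> by (simp_all add: restrict_point_restrict)
    then show ?thesis
      using coarse.pt_face[OF \<sigma>(1) coarse.inter[OF \<sigma>(1) \<tau>(1)] _ w]
        coarse.pt_face[OF \<tau>(1) coarse.inter[OF \<sigma>(1) \<tau>(1)] _ w] by simp
  qed
  have self: "(\<sigma>', x) \<in> fine.pt \<sigma>' x"
    using fine.glue_self_iff[OF \<sigma>'(2)] \<sigma>'(1) by simp
  show ?thesis
  proof
    show "toric_morphism D \<Sigma> (fine.pt \<sigma>' x) \<subseteq> coarse.pt \<sigma> (restrict_point D \<sigma> x)"
      using eq unfolding toric_morphism_def by blast
    show "coarse.pt \<sigma> (restrict_point D \<sigma> x) \<subseteq> toric_morphism D \<Sigma> (fine.pt \<sigma>' x)"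
      using self \<sigma> unfolding toric_morphism_def by blast
  qed
qed

lemma continuous_toric_morphism:
  "continuous_map (zariski D \<Sigma>') (zariski D \<Sigma>) (toric_morphism D \<Sigma>)"
proof -
  let ?\<phi> = "toric_morphism D \<Sigma>"
  have im: "?\<phi> p \<in> topspace (zariski D \<Sigma>)" if p: "p \<in> topspace (zariski D \<Sigma>')" for p
  proof -
    obtain \<sigma>' x where x: "\<sigma>' \<in> \<Sigma>'" "x \<in> affine_chart D \<sigma>'" "p = fine.pt \<sigma>' x"
      using p fine.topspace_zariski fine.in_toric_variety_iff by blast
    obtain \<sigma> where \<sigma>: "\<sigma> \<in> \<Sigma>" "\<sigma>' \<subseteq> \<sigma>" using refines x(1) by blast
    show ?thesis
      unfolding x(3) toric_morphism_pt[OF x(1,2) \<sigma>]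
      by (rule coarse.pt_in_topspace[OF \<sigma>(1) restrict_point_chart[OF \<sigma>(2) x(2)]])
  qed
  have "openin (zariski D \<Sigma>') (?\<phi> -` principal_open D \<Sigma> \<tau> f \<inter> topspace (zariski D \<Sigma>'))"
    if \<tau>: "\<tau> \<in> \<Sigma>" and f: "f \<in> coordinate_ring D \<tau>" for \<tau> f
  proof (subst openin_subopen, rule ballI)
    fix p assume p: "p \<in> ?\<phi> -` principal_open D \<Sigma> \<tau> f \<inter> topspace (zariski D \<Sigma>')"
    then obtain \<sigma>' x where x: "\<sigma>' \<in> \<Sigma>'" "x \<in> affine_chart D \<sigma>'" "p = fine.pt \<sigma>' x"
      using fine.topspace_zariski fine.in_toric_variety_iff by blast
    obtain \<sigma> where \<sigma>: "\<sigma> \<in> \<Sigma>" "\<sigma>' \<subseteq> \<sigma>" using refines x(1) by blast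
    obtain g where g: "g \<in> coordinate_ring D \<sigma>" and
      g_iff: "\<And>y. y \<in> affine_chart D \<sigma> \<Longrightarrow> coarse.pt \<sigma> y \<in> principal_open D \<Sigma> \<tau> f \<longleftrightarrow> eval_at y g \<noteq> 0"
      using coarse.principal_open_localize[OF \<tau> \<sigma>(1) f] by blast
    have iff: "?\<phi> (fine.pt \<sigma>' y) \<in> principal_open D \<Sigma> \<tau> f \<longleftrightarrow> eval_at y g \<noteq> 0"
      if y: "y \<in> affine_chart D \<sigma>'" for y
      unfolding toric_morphism_pt[OF x(1) y \<sigma>] g_iff[OF restrict_point_chart[OF \<sigma>(2) y]]
      by (simp add: eval_at_restrict[OF g])
    have "openin (zariski D \<Sigma>') (principal_open D \<Sigma>' \<sigma>' g)"
      using fine.openin_principal[OF x(1)] g coordinate_ring_antimono[OF \<sigma>(2)] by blast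
    moreover have "p \<in> principal_open D \<Sigma>' \<sigma>' g"
      using p iff[OF x(2)] fine.principal_open_iff[OF x(1,2)] unfolding x(3) by blast
    moreover have "principal_open D \<Sigma>' \<sigma>' g \<subseteq> ?\<phi> -` principal_open D \<Sigma> \<tau> f \<inter> topspace (zariski D \<Sigma>')"
    proof
      fix r assume "r \<in> principal_open D \<Sigma>' \<sigma>' g"
      then obtain y where y: "y \<in> affine_chart D \<sigma>'" "eval_at y g \<noteq> 0" and r: "r = fine.pt \<sigma>' y"
        unfolding principal_open_def by blast
      show "r \<in> ?\<phi> -` principal_open D \<Sigma> \<tau> f \<inter> topspace (zariski D \<Sigma>')"
        using iff[OF y(1)] y(2) fine.pt_in_topspace[OF x(1) y(1)] unfolding r by blast
    qed
    ultimately show "\<exists>T. openin (zariski D \<Sigma>') T \<and> p \<in> T \<and>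
        T \<subseteq> ?\<phi> -` principal_open D \<Sigma> \<tau> f \<inter> topspace (zariski D \<Sigma>')" by blast
  qed
  moreover have "?\<phi> ` topspace (zariski D \<Sigma>') \<subseteq>
      \<Union> {principal_open D \<Sigma> \<sigma> f |\<sigma> f. \<sigma> \<in> \<Sigma> \<and> f \<in> coordinate_ring D \<sigma>}"
    using im unfolding zariski_def[of D \<Sigma>] topology_generated_by_topspace by blast
  ultimately show ?thesis
    unfolding zariski_def[of D \<Sigma>] continuous_on_generated_topo_iff by blast
qed

text \<open>The part of the finer variety on which nothing changes: the charts of the common cones.\<close>

definition common :: "'d chart_point set set" where
  "common = (\<Union>\<kappa>\<in>\<Sigma>' \<inter> \<Sigma>. fine.chart \<kappa>)"

lemma toric_morphism_common:
  assumes "\<kappa> \<in> \<Sigma>' \<inter> \<Sigma>" "x \<in> affine_chart D \<kappa>"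
  shows "toric_morphism D \<Sigma> (fine.pt \<kappa> x) = coarse.pt \<kappa> x"
  using toric_morphism_pt[of \<kappa> x \<kappa>] assms restrict_point_self[OF assms(2)] by simp

text \<open>
  The gluing of the charts of two cones refers to these two cones only, so it is the same in both
  varieties.
\<close>

lemma inj_on_common: "inj_on (toric_morphism D \<Sigma>) common"
proof (rule inj_onI)
  fix p q assume "p \<in> common" "q \<in> common" and eq: "toric_morphism D \<Sigma> p = toric_morphism D \<Sigma> q"
  then obtain \<kappa> x \<mu> y where
    x: "\<kappa> \<in> \<Sigma>' \<inter> \<Sigma>" "x \<in> affine_chart D \<kappa>" "p = fine.pt \<kappa> x" and
    y: "\<mu> \<in> \<Sigma>' \<inter> \<Sigma>" "y \<in> affine_chart D \<mu>" "q = fine.pt \<mu> y"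
    unfolding common_def fine.chart_def by blast
  have "coarse.pt \<kappa> x = coarse.pt \<mu> y"
    using eq unfolding x(3) y(3) toric_morphism_common[OF x(1,2)] toric_morphism_common[OF y(1,2)] .
  then have "((\<kappa>, x), (\<mu>, y)) \<in> glue D \<Sigma>" using coarse.pt_eq_iff x y by blast
  then have "((\<kappa>, x), (\<mu>, y)) \<in> glue D \<Sigma>'"
    using x(1) y(1) unfolding fine.glue_iff coarse.glue_iff by blast
  then show "p = q" using fine.pt_eq_iff x y by blast
qed

lemma open_image_common:
  assumes W: "openin (zariski D \<Sigma>') W" "W \<subseteq> common"
  shows "openin (zariski D \<Sigma>) (toric_morphism D \<Sigma> ` W)"
proof (subst openin_subopen, rule ballI)
  fix q assume "q \<in> toric_morphism D \<Sigma> ` W"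
  then obtain \<kappa> x where x: "\<kappa> \<in> \<Sigma>' \<inter> \<Sigma>" "x \<in> affine_chart D \<kappa>" "fine.pt \<kappa> x \<in> W"
    "q = toric_morphism D \<Sigma> (fine.pt \<kappa> x)"
    using W(2) unfolding common_def fine.chart_def by blast
  obtain g where g: "g \<in> coordinate_ring D \<kappa>" "eval_at x g \<noteq> 0" "principal_open D \<Sigma>' \<kappa> g \<subseteq> W"
    using fine.open_contains_principal[OF W(1) _ x(2,3)] x(1) by blast
  have "openin (zariski D \<Sigma>) (principal_open D \<Sigma> \<kappa> g)"
    using coarse.openin_principal g(1) x(1) by blast
  moreover have "q \<in> principal_open D \<Sigma> \<kappa> g"
    unfolding x(4) toric_morphism_common[OF x(1,2)] using coarse.principal_open_iff x g(2) by blast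
  moreover have "principal_open D \<Sigma> \<kappa> g \<subseteq> toric_morphism D \<Sigma> ` W"
  proof
    fix r assume "r \<in> principal_open D \<Sigma> \<kappa> g"
    then obtain y where y: "y \<in> affine_chart D \<kappa>" "eval_at y g \<noteq> 0" and r: "r = coarse.pt \<kappa> y"
      unfolding principal_open_def by blast
    have "fine.pt \<kappa> y \<in> W" using fine.principal_open_iff[of \<kappa> y g] x(1) y g(3) by blast
    then show "r \<in> toric_morphism D \<Sigma> ` W"
      unfolding r toric_morphism_common[OF x(1) y(1), symmetric] by blast
  qed
  ultimately show "\<exists>T. openin (zariski D \<Sigma>) T \<and> q \<in> T \<and> T \<subseteq> toric_morphism D \<Sigma> ` W" by blast
qed

lemma outside_common:
  assumes p: "p \<in> topspace (zariski D \<Sigma>') - common"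
  shows "\<exists>v\<in>rays. p \<in> zariski D \<Sigma>' closure_of fine.orbit v"
proof -
  obtain \<sigma> x where x: "\<sigma> \<in> \<Sigma>'" "x \<in> affine_chart D \<sigma>" "p = fine.pt \<sigma> x"
    using p fine.topspace_zariski fine.in_toric_variety_iff by blast
  have sub: "{0} \<subseteq> \<sigma>" using fine.zero_in_cone[OF x(1)] by auto
  obtain m where "localization D \<sigma> {0} m" using fine.obtain_localization[OF x(1) zero_cone(1) sub] .
  then interpret l: localization D \<sigma> "{0}" m .
  have "x m = 0"
  proof (rule ccontr)
    assume "x m \<noteq> 0"
    then obtain z where z: "z \<in> affine_chart D {0}" "x = restrict_point D \<sigma> z"
      using l.extend[OF x(2)] by blast
    then have "p = fine.pt {0} z" unfolding x(3) using fine.pt_face[OF x(1) zero_cone(1) sub] by simp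
    then have "p \<in> common" using z(1) zero_cone unfolding common_def fine.chart_def by blast
    then show False using p by simp
  qed
  then obtain v where v: "v \<in> rays" "convex_cone hull {v} \<subseteq> \<sigma>"
    "\<And>q. q \<in> dual_monoid D \<sigma> \<Longrightarrow> x q \<noteq> 0 \<Longrightarrow> pairing q v = 0"
    using vanishing_ray[OF x(1,2) l.m] by blast
  have "p \<in> zariski D \<Sigma>' closure_of fine.orbit v"
    unfolding x(3)
    by (rule fine.in_orbit_closure[OF zero_cone(1) rays(3,1,2)[OF v(1)] x(1) v(2) x(2) v(3)])
  then show ?thesis using v by blast
qed

theorem contracts_no_divisor:
  "contracts_no_divisor (zariski D \<Sigma>') (zariski D \<Sigma>) (toric_morphism D \<Sigma>)"
proof (rule contracts_no_divisor_open_embedding[OF continuous_toric_morphism _ inj_on_common open_image_common])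
  show "openin (zariski D \<Sigma>') common"
    unfolding common_def by (rule openin_Union) (auto intro: fine.openin_chart)
  have torus: "fine.chart {0} \<subseteq> common" using zero_cone by (auto simp: common_def)
  show "W \<inter> common \<noteq> {}" if "openin (zariski D \<Sigma>') W" "W \<noteq> {}" for W
    using fine.torus_dense[OF zero_cone(1) that] torus by blast
  have "coarse.chart {0} \<subseteq> toric_morphism D \<Sigma> ` fine.chart {0}"
    using toric_morphism_common[of "{0}"] zero_cone unfolding fine.chart_def coarse.chart_def by force
  then show "W \<inter> toric_morphism D \<Sigma> ` common \<noteq> {}" if "openin (zariski D \<Sigma>) W" "W \<noteq> {}" for W
    using coarse.torus_dense[OF zero_cone(2) that] torus by blast
  show "Z \<inter> common \<noteq> {}" if Z: "prime_divisor (zariski D \<Sigma>') Z" for Z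
  proof -
    let ?cl = "\<lambda>v. zariski D \<Sigma>' closure_of fine.orbit v"
    have irr: "irreducible_closed (zariski D \<Sigma>') C \<and> C \<inter> common \<noteq> {} \<and> C \<noteq> topspace (zariski D \<Sigma>')"
      if C: "C \<in> ?cl ` rays" for C
    proof -
      obtain v where v: "v \<in> rays" "C = ?cl v" using C by blast
      note orbit = zero_cone(1) rays(3,1,2)[OF v(1)]
      have "fine.orbit v \<subseteq> C"
        unfolding v(2) by (rule closure_of_subset[OF fine.orbit_subset_topspace[OF orbit]])
      moreover have "fine.orbit v \<subseteq> common"
        using fine.orbit_subset_chart[OF orbit] rays(3,4)[OF v(1)] by (auto simp: common_def)
      ultimately show ?thesis
        using fine.irreducible_orbit_closure[OF orbit] fine.orbit_nonempty[OF orbit]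
          fine.orbit_closure_proper[OF orbit] v(2) by blast
    qed
    have "topspace (zariski D \<Sigma>') - common \<subseteq> \<Union> (?cl ` rays)" using outside_common by blast
    then show ?thesis by (rule prime_divisor_meets[OF Z finite_imageI[OF finite_rays] _ irr])
  qed
qed

end

section \<open>Transcendence degree of the coordinate ring of a smooth cone\<close>

lemma single_prod:
  fixes \<mu> :: "'i \<Rightarrow> 'm::comm_monoid_add"
  shows "(\<Prod>i\<in>I. Poly_Mapping.single (\<mu> i) (1::complex)) = Poly_Mapping.single (\<Sum>i\<in>I. \<mu> i) 1"
  by (induction I rule: infinite_finite_induct) (simp_all add: mult_single)

lemma single_cmul_power:
  "Poly_Mapping.single \<mu> (1::complex) ^ n = Poly_Mapping.single (frag_cmul (int n) \<mu>) 1"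
proof (induction n)
  case (Suc n)
  have "frag_cmul (int (Suc n)) \<mu> = \<mu> + frag_cmul (int n) \<mu>"
    using frag_cmul_distrib[of 1 "int n" \<mu>] by simp
  then show ?case using Suc by (simp add: mult_single)
qed simp

lemma linear_dependence:
  fixes v :: "'j \<Rightarrow> ('m::comm_monoid_add \<Rightarrow>\<^sub>0 complex)"
  assumes J: "finite J" and B: "finite B" "card B < card J" and v: "\<And>j. j \<in> J \<Longrightarrow> keys (v j) \<subseteq> B"
  shows "\<exists>c. (\<exists>j\<in>J. c j \<noteq> 0) \<and> (\<Sum>j\<in>J. const_char (c j) * v j) = 0"
proof -
  interpret V: vector_space "\<lambda>(c::complex) (f :: 'm \<Rightarrow>\<^sub>0 complex). const_char c * f"
    by unfold_locales (simp_all add: algebra_simps single_add mult_single flip: mult.assoc)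
  show ?thesis
  proof (cases "inj_on v J")
    case False
    then obtain i j where ij: "i \<in> J" "j \<in> J" "i \<noteq> j" "v i = v j" by (auto simp: inj_on_def)
    define c :: "'j \<Rightarrow> complex" where "c k = (if k = i then 1 else if k = j then - 1 else 0)" for k
    have "(\<Sum>k\<in>J. const_char (c k) * v k) = (\<Sum>k\<in>{i, j}. const_char (c k) * v k)"
      using ij J by (intro sum.mono_neutral_right) (auto simp: c_def)
    also have "\<dots> = 0" using ij by (simp add: c_def single_uminus)
    finally show ?thesis using ij(1) by (intro exI[of _ c]) (auto simp: c_def)
  next
    case True
    let ?T = "(\<lambda>b. Poly_Mapping.single b (1::complex)) ` B"
    have "v j \<in> V.span ?T" if j: "j \<in> J" for j
    proof -
      have "v j = (\<Sum>m\<in>keys (v j). const_char (lookup (v j) m) * Poly_Mapping.single m 1)"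
        by (subst poly_mapping_sum_singles) (simp add: mult_single)
      also have "\<dots> \<in> V.span ?T"
        using v[OF j] by (intro V.span_sum V.span_scale V.span_base) auto
      finally show ?thesis .
    qed
    then have span: "v ` J \<subseteq> V.span ?T" by auto
    have "V.dependent (v ` J)"
    proof (rule ccontr)
      assume "\<not> V.dependent (v ` J)"
      then have "card (v ` J) \<le> card ?T"
        using V.independent_span_bound[OF _ _ span] B(1) by blast
      also have "\<dots> \<le> card B" using B(1) by (rule card_image_le)
      finally show False using B(2) True by (simp add: card_image)
    qed
    then obtain u where u: "\<exists>w\<in>v ` J. u w \<noteq> 0" "(\<Sum>w\<in>v ` J. const_char (u w) * w) = 0"
      using V.dependent_finite[of "v ` J"] J by auto
    then show ?thesis
      using True by (intro exI[of _ "u \<circ> v"]) (auto simp: sum.reindex)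
  qed
qed

text \<open>
  A cone \<open>\<sigma>\<close> whose dual monoid is \<open>\<nat>\<^sup>H \<times> \<int>\<^bsup>I-H\<^esup>\<close> in the coordinates of a basis \<open>\<mu>\<close> of the dual
  lattice.
\<close>

locale smooth_cone =
  fixes D :: "'d set" and \<sigma> :: "('d \<Rightarrow>\<^sub>0 real) set" and I H :: "'e set"
    and \<mu> :: "'e \<Rightarrow> ('d \<Rightarrow>\<^sub>0 int)" and coef :: "'e \<Rightarrow> ('d \<Rightarrow>\<^sub>0 int) \<Rightarrow> int"
  assumes finite_I: "finite I" and H: "H \<subseteq> I"
    and keys_\<mu>: "e \<in> I \<Longrightarrow> keys (\<mu> e) \<subseteq> D"
    and coef_add: "coef e (m + m') = coef e m + coef e m'"
    and coef_\<mu>: "e \<in> I \<Longrightarrow> e' \<in> I \<Longrightarrow> coef e (\<mu> e') = (if e = e' then 1 else 0)"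
    and expansion: "keys m \<subseteq> D \<Longrightarrow> m = (\<Sum>e\<in>I. frag_cmul (coef e m) (\<mu> e))"
    and dual: "dual_monoid D \<sigma> = {m. keys m \<subseteq> D \<and> (\<forall>e\<in>H. 0 \<le> coef e m)}"
begin

abbreviation A :: "(('d \<Rightarrow>\<^sub>0 int) \<Rightarrow>\<^sub>0 complex) set" where "A \<equiv> coordinate_ring D \<sigma>"

abbreviation mon :: "('d \<Rightarrow>\<^sub>0 int) \<Rightarrow> (('d \<Rightarrow>\<^sub>0 int) \<Rightarrow>\<^sub>0 complex)" where "mon m \<equiv> Poly_Mapping.single m 1"

lemma coef_zero [simp]: "coef e 0 = 0"
  using coef_add[of e 0 0] by simp

lemma coef_uminus: "coef e (- m) = - coef e m"
  using coef_add[of e m "- m"] by simp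

lemma coef_diff: "coef e (m - m') = coef e m - coef e m'"
  using coef_add[of e m "- m'"] by (simp add: coef_uminus)

lemma coef_sum: "coef e (sum m J) = (\<Sum>j\<in>J. coef e (m j))"
  by (induction J rule: infinite_finite_induct) (auto simp: coef_add)

lemma coef_cmul_nat: "coef e (frag_cmul (int n) m) = int n * coef e m"
proof (induction n)
  case (Suc n)
  then show ?case
    using frag_cmul_distrib[of 1 "int n" m] by (simp add: coef_add algebra_simps)
qed simp

lemma \<mu>_in_dual: "e \<in> I \<Longrightarrow> \<mu> e \<in> dual_monoid D \<sigma>"
  using keys_\<mu> coef_\<mu> H by (auto simp: dual)

lemma mon_in_A: "m \<in> dual_monoid D \<sigma> \<Longrightarrow> mon m \<in> A"
  by (simp add: coordinate_ring_def)

lemma algebraically_independent_basis: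
  assumes h: "bij_betw h {..<card I} I"
  shows "algebraically_independent (card I) (\<lambda>i. mon (\<mu> (h i)))"
  unfolding algebraically_independent_def
proof (intro allI impI, elim conjE)
  fix P :: "(nat \<Rightarrow>\<^sub>0 nat) \<Rightarrow>\<^sub>0 complex"
  assume P: "\<forall>a\<in>keys P. keys a \<subseteq> {..<card I}"
    and zero: "(\<Sum>a\<in>keys P. const_char (lookup P a) * (\<Prod>i<card I. mon (\<mu> (h i)) ^ lookup a i)) = 0"
  define M where "M a = (\<Sum>i<card I. frag_cmul (int (lookup a i)) (\<mu> (h i)))" for a :: "nat \<Rightarrow>\<^sub>0 nat"
  have hI: "h i \<in> I" if "i < card I" for i using h that by (auto simp: bij_betw_def)
  have coef_M: "coef (h j) (M a) = int (lookup a j)" if j: "j < card I" for a j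
  proof -
    have "coef (h j) (M a) = (\<Sum>i<card I. if i = j then int (lookup a i) else 0)"
      unfolding M_def coef_sum coef_cmul_nat using hI j h
      by (intro sum.cong) (auto simp: coef_\<mu> bij_betw_def dest: inj_onD)
    then show ?thesis using j by simp
  qed
  have inj: "inj_on M (keys P)"
  proof (rule inj_onI, rule poly_mapping_eqI)
    fix a b j assume ab: "a \<in> keys P" "b \<in> keys P" "M a = M b"
    show "lookup a j = lookup b j"
    proof (cases "j < card I")
      case True
      then show ?thesis using coef_M[of j a] coef_M[of j b] ab(3) by simp
    next
      case False
      then show ?thesis using P ab(1,2) by (metis in_keys_iff lessThan_iff subsetD)
    qed
  qed
  have "(\<Sum>a\<in>keys P. Poly_Mapping.single (M a) (lookup P a)) = 0"
    using zero by (simp add: single_cmul_power single_prod mult_single M_def)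
  then have sum0: "(\<Sum>a\<in>keys P. lookup (Poly_Mapping.single (M a) (lookup P a)) k) = 0" for k
    by (metis lookup_sum lookup_zero)
  have "b \<notin> keys P" for b
  proof
    assume b: "b \<in> keys P"
    have "(\<Sum>a\<in>keys P. lookup (Poly_Mapping.single (M a) (lookup P a)) (M b))
        = (\<Sum>a\<in>keys P. if a = b then lookup P b else 0)"
      using inj b by (intro sum.cong) (auto simp: lookup_single when_def dest: inj_onD)
    then show False using sum0[of "M b"] b by (simp add: in_keys_iff)
  qed
  then have "keys P = {}" by blast
  then show "P = 0" by simp
qed

definition bounded_exponents :: "nat \<Rightarrow> ('d \<Rightarrow>\<^sub>0 int) set" where
  "bounded_exponents L = {m. keys m \<subseteq> D \<and> (\<forall>e\<in>I. \<bar>coef e m\<bar> \<le> int L)}"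

lemma bounded_exponents_card:
  "finite (bounded_exponents L) \<and> card (bounded_exponents L) \<le> (2 * L + 1) ^ card I"
proof -
  let ?P = "PiE I (\<lambda>_. {- int L..int L})"
  let ?f = "\<lambda>m. restrict (\<lambda>e. coef e m) I"
  have fin: "finite ?P" using finite_I by (intro finite_PiE) auto
  have im: "?f ` bounded_exponents L \<subseteq> ?P"
    by (force simp: bounded_exponents_def)
  have "inj_on ?f (bounded_exponents L)"
  proof (rule inj_onI)
    fix m m' assume m: "m \<in> bounded_exponents L" "m' \<in> bounded_exponents L" "?f m = ?f m'"
    have "coef e m = coef e m'" if "e \<in> I" for e using fun_cong[OF m(3), of e] that by simp
    then have "(\<Sum>e\<in>I. frag_cmul (coef e m) (\<mu> e)) = (\<Sum>e\<in>I. frag_cmul (coef e m') (\<mu> e))"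
      by (intro sum.cong) auto
    then show "m = m'" using m expansion[of m] expansion[of m'] by (simp add: bounded_exponents_def)
  qed
  then have "finite (bounded_exponents L)" "card (bounded_exponents L) \<le> card ?P"
    using inj_on_finite[OF _ im fin] card_inj_on_le[OF _ im fin] by auto
  moreover have "card ?P = (2 * L + 1) ^ card I"
    using finite_I by (simp add: card_PiE prod_constant nat_add_distrib nat_mult_distrib)
  ultimately show ?thesis by simp
qed

lemma bounded_exponents_mult:
  fixes f g :: "('d \<Rightarrow>\<^sub>0 int) \<Rightarrow>\<^sub>0 complex"
  assumes "keys f \<subseteq> bounded_exponents L" "keys g \<subseteq> bounded_exponents L'"
  shows "keys (f * g) \<subseteq> bounded_exponents (L + L')"
proof
  fix k assume "k \<in> keys (f * g)"
  then obtain m m' where k: "k = m + m'" "m \<in> keys f" "m' \<in> keys g" using keys_mult by blast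
  then have m: "m \<in> bounded_exponents L" "m' \<in> bounded_exponents L'" using assms by auto
  then have "keys k \<subseteq> D" unfolding k(1) by (intro keys_add_subset) (auto simp: bounded_exponents_def)
  moreover have "\<bar>coef e k\<bar> \<le> int (L + L')" if e: "e \<in> I" for e
    using m e abs_triangle_ineq[of "coef e m" "coef e m'"] unfolding k(1) coef_add
    by (auto simp: bounded_exponents_def dest!: bspec[of _ _ e])
  ultimately show "k \<in> bounded_exponents (L + L')" by (simp add: bounded_exponents_def)
qed

lemma bounded_exponents_power:
  fixes f :: "('d \<Rightarrow>\<^sub>0 int) \<Rightarrow>\<^sub>0 complex"
  assumes "keys f \<subseteq> bounded_exponents L"
  shows "keys (f ^ n) \<subseteq> bounded_exponents (n * L)"
proof (induction n)
  case 0
  then show ?case by (simp add: bounded_exponents_def)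
next
  case (Suc n)
  show ?case using bounded_exponents_mult[OF assms Suc] by simp
qed

lemma bounded_exponents_mono: "L \<le> L' \<Longrightarrow> bounded_exponents L \<subseteq> bounded_exponents L'"
  by (force simp: bounded_exponents_def)

text \<open>
  The upper bound for the transcendence degree is a dimension count. If the \<open>s\<close> functions \<open>f\<^sub>i\<close> have
  exponents of size at most \<open>L\<close>, their monomials with all degrees at most \<open>t\<close> have exponents of size
  at most \<open>s L t\<close>. These are \<open>(t + 1)\<^sup>s\<close> monomials in a space of dimension at most
  \<open>(2 s L t + 1)\<^bsup>card I\<^esup>\<close>, so they are linearly dependent for large \<open>t\<close> if \<open>s > card I\<close>.
\<close>

lemma algebraically_independent_le:
  assumes fA: "\<forall>i<s. f i \<in> A" and indep: "algebraically_independent s f"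
  shows "s \<le> card I"
proof (rule ccontr)
  assume "\<not> s \<le> card I"
  then have s: "card I < s" by simp
  have "\<exists>L. keys (f i) \<subseteq> bounded_exponents L" if "i < s" for i
  proof -
    let ?L = "\<Sum>m\<in>keys (f i). \<Sum>e\<in>I. nat \<bar>coef e m\<bar>"
    have "\<bar>coef e m\<bar> \<le> int ?L" if m: "m \<in> keys (f i)" and e: "e \<in> I" for m e
    proof -
      have "nat \<bar>coef e m\<bar> \<le> (\<Sum>e\<in>I. nat \<bar>coef e m\<bar>)"
        using e finite_I by (intro member_le_sum) auto
      also have "\<dots> \<le> ?L" using m by (intro member_le_sum[of m]) auto
      finally show ?thesis by linarith
    qed
    moreover have "keys m \<subseteq> D" if "m \<in> keys (f i)" for m
      using fA \<open>i < s\<close> that by (auto simp: coordinate_ring_def dual_monoid_def)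
    ultimately show ?thesis by (intro exI[of _ ?L]) (auto simp: bounded_exponents_def)
  qed
  then obtain Li where Li: "\<And>i. i < s \<Longrightarrow> keys (f i) \<subseteq> bounded_exponents (Li i)" by metis
  define L where "L = (\<Sum>i<s. Li i)"
  have L: "keys (f i) \<subseteq> bounded_exponents L" if "i < s" for i
    using Li[OF that] bounded_exponents_mono[of "Li i" L] member_le_sum[of i "{..<s}" Li] that
    by (auto simp: L_def)
  define C where "C = 2 * s * L + 1"
  define t where "t = C ^ card I"
  define tup where "tup x = Abs_poly_mapping (\<lambda>i. if i < s then x i else 0)" for x :: "nat \<Rightarrow> nat"
  have lookup_tup: "lookup (tup x) i = (if i < s then x i else 0)" for x i
  proof -
    have "finite {i. (if i < s then x i else 0) \<noteq> 0}" by (rule finite_subset[of _ "{..<s}"]) auto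
    then show ?thesis by (simp add: tup_def)
  qed
  define J where "J = tup ` PiE {..<s} (\<lambda>_. {..t})"
  have J: "keys a \<subseteq> {..<s} \<and> (\<forall>i<s. lookup a i \<le> t)" if a: "a \<in> J" for a
  proof -
    obtain x where x: "x \<in> PiE {..<s} (\<lambda>_. {..t})" "a = tup x" using a unfolding J_def by blast
    then show ?thesis
      using PiE_mem[OF x(1)] by (simp add: subset_iff in_keys_iff lookup_tup)
  qed
  have "finite J" unfolding J_def by (intro finite_imageI finite_PiE) auto
  have "inj_on tup (PiE {..<s} (\<lambda>_. {..t}))"
  proof (rule inj_onI)
    fix x y assume xy: "x \<in> PiE {..<s} (\<lambda>_. {..t})" "y \<in> PiE {..<s} (\<lambda>_. {..t})" "tup x = tup y"
    have "x i = y i" if "i \<in> {..<s}" for i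
      using lookup_tup[of x i] lookup_tup[of y i] that xy(3) by simp
    then show "x = y" using PiE_ext[OF xy(1,2)] by blast
  qed
  then have card_J: "card J = (t + 1) ^ s" by (simp add: J_def card_image card_PiE)
  define v where "v a = (\<Prod>i<s. f i ^ lookup a i)" for a
  have v: "keys (v a) \<subseteq> bounded_exponents (s * (t * L))" if a: "a \<in> J" for a
  proof -
    have "keys (\<Prod>i<n. f i ^ lookup a i) \<subseteq> bounded_exponents (n * (t * L))" if "n \<le> s" for n
      using that
    proof (induction n)
      case 0
      then show ?case by (simp add: bounded_exponents_def)
    next
      case (Suc n)
      have "keys (f n ^ lookup a n) \<subseteq> bounded_exponents (lookup a n * L)"
        using Suc.prems by (intro bounded_exponents_power L) auto
      also have "\<dots> \<subseteq> bounded_exponents (t * L)"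
        using J[OF a] Suc.prems by (intro bounded_exponents_mono mult_le_mono1) auto
      finally show ?case
        using bounded_exponents_mult[of "\<Prod>i<n. f i ^ lookup a i" "n * (t * L)"] Suc by (simp add: add.commute)
    qed
    then show ?thesis by (simp add: v_def)
  qed
  have "card (bounded_exponents (s * (t * L))) \<le> (2 * (s * (t * L)) + 1) ^ card I"
    using bounded_exponents_card by blast
  also have "2 * (s * (t * L)) + 1 \<le> C * (t + 1)"
    by (simp add: C_def algebra_simps)
  then have "(2 * (s * (t * L)) + 1) ^ card I \<le> (C * (t + 1)) ^ card I"
    by (rule power_mono) simp
  also have "\<dots> = t * (t + 1) ^ card I" by (simp only: power_mult_distrib t_def)
  also have "\<dots> < (t + 1) * (t + 1) ^ card I" by simp
  also have "\<dots> = (t + 1) ^ Suc (card I)" by simp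
  also have "\<dots> \<le> (t + 1) ^ s" using s by (intro power_increasing) auto
  finally have less: "card (bounded_exponents (s * (t * L))) < card J" by (simp add: card_J)
  have "\<exists>c. (\<exists>j\<in>J. c j \<noteq> 0) \<and> (\<Sum>j\<in>J. const_char (c j) * v j) = 0"
    by (rule linear_dependence[OF \<open>finite J\<close> conjunct1[OF bounded_exponents_card] less v])
  then obtain c where c: "\<exists>j\<in>J. c j \<noteq> 0" "(\<Sum>j\<in>J. const_char (c j) * v j) = 0"
    by (elim exE conjE)
  define P where "P = (\<Sum>a\<in>J. Poly_Mapping.single a (c a))"
  have lookup_P: "lookup P a = (if a \<in> J then c a else 0)" for a
    using \<open>finite J\<close> by (simp add: P_def lookup_sum lookup_single when_def if_distrib cong: if_cong)
  have keys_P: "keys P \<subseteq> J" by (auto simp: in_keys_iff lookup_P split: if_splits)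
  have "(\<Sum>a\<in>keys P. const_char (lookup P a) * v a) = (\<Sum>a\<in>J. const_char (lookup P a) * v a)"
    by (rule sum.mono_neutral_left[OF \<open>finite J\<close> keys_P]) (simp add: in_keys_iff)
  also have "\<dots> = (\<Sum>a\<in>J. const_char (c a) * v a)" by (intro sum.cong) (auto simp: lookup_P)
  finally have "(\<Sum>a\<in>keys P. const_char (lookup P a) * (\<Prod>i<s. f i ^ lookup a i)) = 0"
    using c(2) by (simp add: v_def)
  moreover have "\<forall>a\<in>keys P. keys a \<subseteq> {..<s}" using keys_P J by blast
  ultimately have "P = 0" using indep unfolding algebraically_independent_def by blast
  then have "lookup P a = 0" for a by simp
  moreover obtain j where "j \<in> J" "c j \<noteq> 0" using c(1) by blast
  ultimately show False using lookup_P[of j] by simp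
qed

lemma has_trdeg_coordinate_ring: "has_trdeg A (card I)"
proof -
  obtain h where h: "bij_betw h {..<card I} I"
    using ex_bij_betw_nat_finite[OF finite_I] by (auto simp: atLeast0LessThan)
  then have "\<forall>i<card I. mon (\<mu> (h i)) \<in> A"
    using \<mu>_in_dual mon_in_A by (auto simp: bij_betw_def)
  then have "\<exists>f. (\<forall>i<card I. f i \<in> A) \<and> algebraically_independent (card I) f"
    using algebraically_independent_basis[OF h] by (intro exI conjI)
  moreover have "s \<le> card I" if "(\<forall>i<s. f i \<in> A) \<and> algebraically_independent s f" for s f
    using that by (elim conjE) (rule algebraically_independent_le)
  ultimately show ?thesis unfolding has_trdeg_def by (intro conjI allI impI)
qed

end

section \<open>Cotangent spaces of the chart of a smooth cone\<close>

lemma eval_at_uminus: "eval_at x (- f) = - eval_at x f"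
  using eval_at_add[of x f "- f"] by (simp add: eq_neg_iff_add_eq_0 add.commute)

lemma eval_at_diff: "eval_at x (f - g) = eval_at x f - eval_at x g"
  using eval_at_add[of x f "- g"] by (simp add: eval_at_uminus)

lemma eval_at_const_mult:
  fixes f :: "'m::comm_monoid_add \<Rightarrow>\<^sub>0 complex"
  shows "eval_at x (const_char c * f) = c * eval_at x f"
  by (simp add: eval_at_mult_sum eval_at_def[of x f] sum_distrib_left mult_ac)

lemma coordinate_ring_add: "f \<in> coordinate_ring D \<sigma> \<Longrightarrow> g \<in> coordinate_ring D \<sigma> \<Longrightarrow> f + g \<in> coordinate_ring D \<sigma>"
  unfolding coordinate_ring_def using keys_add[of f g] by blast

lemma coordinate_ring_const: "const_char c \<in> coordinate_ring D \<sigma>"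
  by (simp add: coordinate_ring_def)

lemma coordinate_ring_uminus: "f \<in> coordinate_ring D \<sigma> \<Longrightarrow> - f \<in> coordinate_ring D \<sigma>"
  by (simp add: coordinate_ring_def keys_subset_iff)

lemma coordinate_ring_diff: "f \<in> coordinate_ring D \<sigma> \<Longrightarrow> g \<in> coordinate_ring D \<sigma> \<Longrightarrow> f - g \<in> coordinate_ring D \<sigma>"
  using coordinate_ring_add[of f D \<sigma> "- g"] coordinate_ring_uminus[of g D \<sigma>] by simp

lemma coordinate_ring_sum: "(\<And>i. i \<in> J \<Longrightarrow> f i \<in> coordinate_ring D \<sigma>) \<Longrightarrow> sum f J \<in> coordinate_ring D \<sigma>"
  unfolding coordinate_ring_def mem_Collect_eq by (rule keys_sum_subset)

lemma ideal_square_zero: "0 \<in> ideal_square V"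
  unfolding ideal_square_def by (rule CollectI, rule exI[of _ "0::nat"]) simp

lemma ideal_square_add_product:
  assumes "q \<in> ideal_square V" "f \<in> V" "g \<in> V"
  shows "q + f * g \<in> ideal_square V"
proof -
  obtain r :: nat and F G where q: "q = (\<Sum>i<r. F i * G i)" "\<forall>i<r. F i \<in> V \<and> G i \<in> V"
    using assms(1) unfolding ideal_square_def by blast
  let ?F = "F(r := f)" and ?G = "G(r := g)"
  have "q + f * g = (\<Sum>i<Suc r. ?F i * ?G i)" unfolding q(1) by simp
  moreover have "\<forall>i<Suc r. ?F i \<in> V \<and> ?G i \<in> V" using q(2) assms(2,3) by (auto simp: less_Suc_eq)
  ultimately show ?thesis unfolding ideal_square_def by blast
qed

lemma ideal_square_product: "f \<in> V \<Longrightarrow> g \<in> V \<Longrightarrow> f * g \<in> ideal_square V"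
  using ideal_square_add_product[OF ideal_square_zero] by fastforce

lemma ideal_square_add:
  assumes "p \<in> ideal_square V" "q \<in> ideal_square V"
  shows "p + q \<in> ideal_square V"
proof -
  obtain r :: nat and F G where q: "q = (\<Sum>i<r. F i * G i)" "\<forall>i<r. F i \<in> V \<and> G i \<in> V"
    using assms(2) unfolding ideal_square_def by blast
  have "p + (\<Sum>i<n. F i * G i) \<in> ideal_square V" if "n \<le> r" for n
    using that
  proof (induction n)
    case (Suc n)
    then show ?case
      using ideal_square_add_product[of "p + (\<Sum>i<n. F i * G i)" V "F n" "G n"] q(2) by (simp add: add.assoc)
  qed (use assms(1) in simp)
  then show ?thesis unfolding q(1) by blast
qed

lemma ideal_square_mult:
  assumes q: "q \<in> ideal_square V" and h: "\<And>f. f \<in> V \<Longrightarrow> h * f \<in> V"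
  shows "h * q \<in> ideal_square V"
proof -
  obtain r :: nat and F G where q: "q = (\<Sum>i<r. F i * G i)" "\<forall>i<r. F i \<in> V \<and> G i \<in> V"
    using q unfolding ideal_square_def by blast
  have "h * q = (\<Sum>i<r. (h * F i) * G i)" unfolding q(1) by (simp add: sum_distrib_left mult.assoc)
  moreover have "\<forall>i<r. h * F i \<in> V \<and> G i \<in> V" using q(2) h by blast
  ultimately show ?thesis
    unfolding ideal_square_def by (intro CollectI exI[of _ r] exI[of _ "\<lambda>i. h * F i"] exI[of _ G] conjI)
qed

text \<open>
  At a point \<open>x\<close> of the chart the functions \<open>mon (\<mu> e) - x (\<mu> e)\<close> represent a basis of the cotangent
  space. They are independent because the partial derivatives separate them and vanish on the square
  of the maximal ideal. They span because every function agrees with its Taylor polynomial of degree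
  one modulo this square, which is checked on the generators of the coordinate ring and passes to
  products.
\<close>

locale smooth_cone_point = smooth_cone D \<sigma> I H \<mu> coef
  for D :: "'d set" and \<sigma> and I H :: "'e set" and \<mu> coef +
  fixes x :: "('d \<Rightarrow>\<^sub>0 int) \<Rightarrow> complex"
  assumes x: "x \<in> affine_chart D \<sigma>"
begin

abbreviation V where "V \<equiv> maximal_ideal_at A x"

text \<open>
  The partial derivative at \<open>x\<close> in the direction of the coordinate \<open>e\<close>, as the linear functional
  given by its values on characters. For \<open>m\<close> in the dual monoid the factor \<open>coef e m\<close> is zero
  whenever \<open>m - \<mu> e\<close> leaves the monoid.
\<close>

definition deriv_char :: "'e \<Rightarrow> ('d \<Rightarrow>\<^sub>0 int) \<Rightarrow> complex" where
  "deriv_char e m = of_int (coef e m) * x (m - \<mu> e)"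

lemma diff_in_dual:
  assumes "m \<in> dual_monoid D \<sigma>" "e \<in> I" "coef e m \<noteq> 0"
  shows "m - \<mu> e \<in> dual_monoid D \<sigma>"
proof -
  have "keys (m - \<mu> e) \<subseteq> D"
    using assms(1) keys_\<mu>[OF assms(2)] keys_diff[of m "\<mu> e"] by (auto simp: dual)
  moreover have "0 \<le> coef e' (m - \<mu> e)" if e': "e' \<in> H" for e'
  proof -
    have "e' \<in> I" "0 \<le> coef e' m" using e' H assms(1) by (auto simp: dual)
    then show ?thesis using assms(2,3) by (auto simp: coef_diff coef_\<mu>)
  qed
  ultimately show ?thesis by (simp add: dual)
qed

lemma deriv_char_add:
  assumes m: "m \<in> dual_monoid D \<sigma>" "m' \<in> dual_monoid D \<sigma>" and e: "e \<in> I"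
  shows "deriv_char e (m + m') = deriv_char e m * x m' + x m * deriv_char e m'"
proof -
  have *: "of_int (coef e m) * x (m + m' - \<mu> e) = deriv_char e m * x m'"
    if m: "m \<in> dual_monoid D \<sigma>" "m' \<in> dual_monoid D \<sigma>" for m m'
  proof (cases "coef e m = 0")
    case False
    then have "x ((m - \<mu> e) + m') = x (m - \<mu> e) * x m'"
      by (intro chart_add[OF x] diff_in_dual m e)
    then have "x (m + m' - \<mu> e) = x (m - \<mu> e) * x m'" by (simp add: algebra_simps)
    then show ?thesis by (simp add: deriv_char_def)
  qed (simp add: deriv_char_def)
  have "deriv_char e (m + m') =
      of_int (coef e m) * x (m + m' - \<mu> e) + of_int (coef e m') * x (m' + m - \<mu> e)"
    by (simp add: deriv_char_def coef_add distrib_right add.commute)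
  then show ?thesis unfolding *[OF m] *[OF m(2,1)] by simp
qed

lemma leibniz:
  assumes f: "f \<in> A" and g: "g \<in> A" and e: "e \<in> I"
  shows "eval_at (deriv_char e) (f * g) =
    eval_at (deriv_char e) f * eval_at x g + eval_at x f * eval_at (deriv_char e) g"
proof -
  have "eval_at (deriv_char e) (f * g) =
      (\<Sum>m\<in>keys f. \<Sum>m'\<in>keys g. (lookup f m * deriv_char e m) * (lookup g m' * x m')
        + (lookup f m * x m) * (lookup g m' * deriv_char e m'))"
    unfolding eval_at_mult_sum
  proof (intro sum.cong refl)
    fix m m' assume "m \<in> keys f" "m' \<in> keys g"
    then have "m \<in> dual_monoid D \<sigma>" "m' \<in> dual_monoid D \<sigma>" using f g by (auto simp: coordinate_ring_def)
    from deriv_char_add[OF this e] show "lookup f m * lookup g m' * deriv_char e (m + m') =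
        (lookup f m * deriv_char e m) * (lookup g m' * x m') + (lookup f m * x m) * (lookup g m' * deriv_char e m')"
      by (simp add: algebra_simps)
  qed
  then show ?thesis by (simp add: eval_at_def sum.distrib sum_product)
qed

lemma deriv_const: "eval_at (deriv_char e) (const_char c) = 0"
  by (simp add: deriv_char_def)

definition cotangent :: "'e \<Rightarrow> (('d \<Rightarrow>\<^sub>0 int) \<Rightarrow>\<^sub>0 complex)" where
  "cotangent e = mon (\<mu> e) - const_char (x (\<mu> e))"

lemma x_zero [simp]: "x 0 = 1"
  by (rule chart_zero[OF x])

lemma cotangent_in_V: "e \<in> I \<Longrightarrow> cotangent e \<in> V"
  unfolding maximal_ideal_at_def cotangent_def
  by (simp add: coordinate_ring_diff coordinate_ring_const mon_in_A \<mu>_in_dual eval_at_diff)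

lemma deriv_cotangent:
  "e \<in> I \<Longrightarrow> e' \<in> I \<Longrightarrow> eval_at (deriv_char e) (cotangent e') = (if e = e' then 1 else 0)"
  by (simp add: cotangent_def eval_at_diff deriv_const) (simp add: deriv_char_def coef_\<mu>)

lemma deriv_ideal_square:
  assumes q: "q \<in> ideal_square V" and e: "e \<in> I"
  shows "eval_at (deriv_char e) q = 0"
proof -
  obtain r :: nat and F G where q: "q = (\<Sum>i<r. F i * G i)" "\<forall>i<r. F i \<in> V \<and> G i \<in> V"
    using q unfolding ideal_square_def by blast
  have "eval_at (deriv_char e) (F i * G i) = 0" if "i < r" for i
    using q(2) that leibniz[OF _ _ e, of "F i" "G i"] by (simp add: maximal_ideal_at_def)
  then show ?thesis unfolding q(1) eval_at_sum by simp
qed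

definition taylor :: "(('d \<Rightarrow>\<^sub>0 int) \<Rightarrow>\<^sub>0 complex) \<Rightarrow> (('d \<Rightarrow>\<^sub>0 int) \<Rightarrow>\<^sub>0 complex)" where
  "taylor f = const_char (eval_at x f) + (\<Sum>e\<in>I. const_char (eval_at (deriv_char e) f) * cotangent e)"

abbreviation linearizable :: "(('d \<Rightarrow>\<^sub>0 int) \<Rightarrow>\<^sub>0 complex) \<Rightarrow> bool" where
  "linearizable f \<equiv> f \<in> A \<and> f - taylor f \<in> ideal_square V"

lemma V_mult: "h \<in> A \<Longrightarrow> f \<in> V \<Longrightarrow> h * f \<in> V"
  using eval_at_mult_chart[OF x] by (auto simp: maximal_ideal_at_def coordinate_ring_mult)

lemma V_subset: "f \<in> V \<Longrightarrow> f \<in> A"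
  by (simp add: maximal_ideal_at_def)

lemma linear_part_in_V: "(\<Sum>e\<in>I. const_char (c e) * cotangent e) \<in> V"
proof -
  have "const_char (c e) * cotangent e \<in> V" if "e \<in> I" for e
    by (rule V_mult[OF coordinate_ring_const cotangent_in_V[OF that]])
  then show ?thesis by (simp add: maximal_ideal_at_def coordinate_ring_sum eval_at_sum)
qed

lemma taylor_add: "taylor (f + g) = taylor f + taylor g"
  by (simp add: taylor_def eval_at_add single_add distrib_right sum.distrib)

lemma taylor_const_mult: "taylor (const_char c * f) = const_char c * taylor f"
  by (simp add: taylor_def eval_at_const_mult mult_single sum_distrib_left distrib_left flip: mult.assoc)

lemma linearizable_add: "linearizable f \<Longrightarrow> linearizable g \<Longrightarrow> linearizable (f + g)"
  using ideal_square_add[of "f - taylor f" V "g - taylor g"]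
  by (simp add: taylor_add coordinate_ring_add algebra_simps)

lemma linearizable_const_mult:
  assumes "linearizable f"
  shows "linearizable (const_char c * f)"
proof
  show "const_char c * f \<in> A" using assms by (simp add: coordinate_ring_mult coordinate_ring_const)
  have "const_char c * (f - taylor f) \<in> ideal_square V"
    using assms V_mult[OF coordinate_ring_const] by (intro ideal_square_mult) auto
  then show "const_char c * f - taylor (const_char c * f) \<in> ideal_square V"
    by (simp add: taylor_const_mult right_diff_distrib)
qed

text \<open>
  Modulo the square of the maximal ideal the product of two Taylor polynomials of degree one is the
  Taylor polynomial of the product, by the Leibniz rule.
\<close>

lemma linearizable_mult:
  assumes f: "linearizable f" and g: "linearizable g"
  shows "linearizable (f * g)"
proof
  show "f * g \<in> A" using f g by (simp add: coordinate_ring_mult)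
  define f0 g0 :: "('d \<Rightarrow>\<^sub>0 int) \<Rightarrow>\<^sub>0 complex"
    where "f0 = const_char (eval_at x f)" and "g0 = const_char (eval_at x g)"
  define f1 g1 where "f1 = (\<Sum>e\<in>I. const_char (eval_at (deriv_char e) f) * cotangent e)"
    and "g1 = (\<Sum>e\<in>I. const_char (eval_at (deriv_char e) g) * cotangent e)"
  define q q' where "q = f - taylor f" and "q' = g - taylor g"
  have eq: "f = f0 + f1 + q" "g = g0 + g1 + q'"
    by (simp_all add: q_def q'_def taylor_def f0_def g0_def f1_def g1_def)
  have "taylor (f * g) = f0 * g0 + (f1 * g0 + f0 * g1)"
  proof -
    have "(\<Sum>e\<in>I. const_char (eval_at (deriv_char e) (f * g)) * cotangent e) =
        (\<Sum>e\<in>I. (const_char (eval_at (deriv_char e) f) * cotangent e) * g0 +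
          f0 * (const_char (eval_at (deriv_char e) g) * cotangent e))"
      using f g by (intro sum.cong refl)
        (simp add: leibniz f0_def g0_def single_add algebra_simps flip: mult_single[of 0 _ 0, simplified])
    then show ?thesis
      using f g by (simp add: taylor_def eval_at_mult_chart[OF x] mult_single f1_def g1_def f0_def g0_def
          sum.distrib sum_distrib_left sum_distrib_right)
  qed
  then have *: "f * g - taylor (f * g) = f1 * g1 + (g * q + (f - q) * q')"
    by (subst eq(1), subst eq(2), subst (2) eq(1), subst (2) eq(2)) (simp add: algebra_simps)
  have fq: "f - q \<in> A"
  proof -
    have "f - q = taylor f" by (simp add: q_def)
    then show ?thesis
      by (simp only: taylor_def coordinate_ring_add coordinate_ring_const V_subset[OF linear_part_in_V])
  qed
  have "f1 * g1 \<in> ideal_square V"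
    unfolding f1_def g1_def by (intro ideal_square_product linear_part_in_V)
  moreover have "g * q \<in> ideal_square V"
    using f g V_mult by (intro ideal_square_mult) (auto simp: q_def)
  moreover have "(f - q) * q' \<in> ideal_square V"
    using g fq V_mult by (intro ideal_square_mult) (auto simp: q'_def)
  ultimately show "f * g - taylor (f * g) \<in> ideal_square V"
    unfolding * by (intro ideal_square_add)
qed

lemma linearizable_one: "linearizable 1"
proof -
  have "taylor 1 = 1" using deriv_const[of _ 1] by (simp add: taylor_def eval_at_one_chart[OF x])
  then show ?thesis by (simp add: one_in_coordinate_ring ideal_square_zero)
qed

lemma linearizable_power: "linearizable f \<Longrightarrow> linearizable (f ^ n)"
proof (induction n)
  case 0
  then show ?case using linearizable_one by simp
next
  case (Suc n)
  then show ?case using linearizable_mult[of f "f ^ n"] by simp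
qed

lemma linearizable_prod: "(\<And>e. e \<in> J \<Longrightarrow> linearizable (f e)) \<Longrightarrow> linearizable (prod f J)"
proof (induction J rule: infinite_finite_induct)
  case (insert e J)
  then show ?case using linearizable_mult[of "f e" "prod f J"] by simp
qed (use linearizable_one in simp_all)

lemma sum_single_index:
  fixes f :: "'e \<Rightarrow> 'c::comm_monoid_add"
  assumes "e \<in> I" "\<And>e'. e' \<in> I \<Longrightarrow> e' \<noteq> e \<Longrightarrow> f e' = 0"
  shows "sum f I = f e"
proof -
  have "sum f I = sum f {e}"
    using assms finite_I by (intro sum.mono_neutral_right) auto
  then show ?thesis by simp
qed

lemma linearizable_generator:
  assumes e: "e \<in> I"
  shows "linearizable (mon (\<mu> e))"
proof -
  have "(\<Sum>e'\<in>I. const_char (eval_at (deriv_char e') (mon (\<mu> e))) * cotangent e') = cotangent e"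
    by (subst sum_single_index[OF e]) (simp_all add: deriv_char_def coef_\<mu> e)
  then have "taylor (mon (\<mu> e)) = mon (\<mu> e)" by (simp add: taylor_def cotangent_def)
  then show ?thesis using e by (simp add: mon_in_A \<mu>_in_dual ideal_square_zero)
qed

lemma linearizable_inverse:
  assumes e: "e \<in> I" "e \<notin> H"
  shows "linearizable (mon (- \<mu> e))"
proof
  have "0 \<le> coef e' (- \<mu> e)" if "e' \<in> H" for e'
  proof -
    have "e' \<in> I" "e' \<noteq> e" using that H e by auto
    then show ?thesis using e(1) by (simp add: coef_uminus coef_\<mu>)
  qed
  then have neg: "- \<mu> e \<in> dual_monoid D \<sigma>" using keys_\<mu>[OF e(1)] by (simp add: dual)
  then show "mon (- \<mu> e) \<in> A" by (rule mon_in_A)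
  define u w u0 w0 :: "('d \<Rightarrow>\<^sub>0 int) \<Rightarrow>\<^sub>0 complex"
    where "u = mon (\<mu> e)" and "w = mon (- \<mu> e)"
    and "u0 = const_char (x (\<mu> e))" and "w0 = const_char (x (- \<mu> e))"
  have uw: "u * w = 1" by (simp add: u_def w_def mult_single)
  have uw0: "u0 * w0 = 1"
    using chart_unit[OF x \<mu>_in_dual[OF e(1)] neg] by (simp add: u0_def w0_def mult_single)
  have "x (- \<mu> e - \<mu> e) = x (- \<mu> e) * x (- \<mu> e)" using chart_add[OF x neg neg] by simp
  then have "eval_at (deriv_char e) (mon (- \<mu> e)) = - (x (- \<mu> e) * x (- \<mu> e))"
    using e(1) by (simp add: deriv_char_def coef_uminus coef_\<mu>)
  moreover have "eval_at (deriv_char e') (mon (- \<mu> e)) = 0" if "e' \<in> I" "e' \<noteq> e" for e'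
    using e(1) that by (simp add: deriv_char_def coef_uminus coef_\<mu>)
  ultimately have "(\<Sum>e'\<in>I. const_char (eval_at (deriv_char e') (mon (- \<mu> e))) * cotangent e') =
      const_char (- (x (- \<mu> e) * x (- \<mu> e))) * cotangent e"
    by (subst sum_single_index[OF e(1)]) simp_all
  then have "taylor w = w0 - w0 * w0 * (u - u0)"
    by (simp add: taylor_def w_def w0_def u_def u0_def cotangent_def mult_single single_uminus)
  \<comment> \<open>That is \<open>1/u - 1/u\<^sub>0 + (u - u\<^sub>0)/u\<^sub>0\<^sup>2 = (u - u\<^sub>0)\<^sup>2 / (u u\<^sub>0\<^sup>2)\<close>, with factors \<open>u w = u\<^sub>0 w\<^sub>0 = 1\<close> inserted.\<close>
  then have "w - taylor w = (u * w) * w0 * w0 * u - w0 * (u * w) * (u0 * w0) - w0 * (u * w) * (u0 * w0) + w * (u0 * w0) * (u0 * w0)"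
    by (simp add: uw uw0 algebra_simps)
  also have "\<dots> = (w * w0 * w0 * (u - u0)) * (u - u0)"
    by (simp add: algebra_simps)
  also have "\<dots> \<in> ideal_square V"
  proof -
    have "u - u0 \<in> V" using cotangent_in_V[OF e(1)] by (simp add: u_def u0_def cotangent_def)
    moreover have "w * w0 * w0 \<in> A"
      unfolding w_def w0_def by (intro coordinate_ring_mult coordinate_ring_const mon_in_A neg)
    ultimately show ?thesis by (intro ideal_square_product V_mult)
  qed
  finally show "mon (- \<mu> e) - taylor (mon (- \<mu> e)) \<in> ideal_square V" by (simp add: w_def)
qed

lemma linearizable_character:
  assumes m: "m \<in> dual_monoid D \<sigma>"
  shows "linearizable (mon m)"
proof -
  have "linearizable (mon (frag_cmul (coef e m) (\<mu> e)))" if e: "e \<in> I" for e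
  proof (cases "0 \<le> coef e m")
    case True
    then have "mon (frag_cmul (coef e m) (\<mu> e)) = mon (\<mu> e) ^ nat (coef e m)"
      by (simp add: single_cmul_power)
    then show ?thesis using linearizable_power[OF linearizable_generator[OF e]] by simp
  next
    case False
    then have "e \<notin> H" using m by (auto simp: dual)
    have "frag_cmul (coef e m) (\<mu> e) = frag_cmul (int (nat (- coef e m))) (- \<mu> e)"
      using False by (intro poly_mapping_eqI) simp
    then have "mon (frag_cmul (coef e m) (\<mu> e)) = mon (- \<mu> e) ^ nat (- coef e m)"
      by (simp only: single_cmul_power)
    then show ?thesis using linearizable_power[OF linearizable_inverse[OF e \<open>e \<notin> H\<close>]] by simp
  qed
  then have prod: "linearizable (\<Prod>e\<in>I. mon (frag_cmul (coef e m) (\<mu> e)))" by (rule linearizable_prod)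
  have "(\<Sum>e\<in>I. frag_cmul (coef e m) (\<mu> e)) = m"
    by (rule expansion[symmetric]) (use m in \<open>simp add: dual\<close>)
  then show ?thesis using prod by (simp only: single_prod)
qed

lemma linearizable_all:
  assumes f: "f \<in> A"
  shows "linearizable f"
proof -
  have partial: "linearizable (\<Sum>m\<in>K. const_char (lookup f m) * mon m)" if "K \<subseteq> keys f" "finite K" for K
    using that(2,1)
  proof (induction K)
    case empty
    then show ?case using linearizable_const_mult[OF linearizable_one, of 0] by simp
  next
    case (insert m K)
    have "m \<in> dual_monoid D \<sigma>" using insert.prems f by (auto simp: coordinate_ring_def)
    then show ?case
      using linearizable_add[OF linearizable_const_mult[OF linearizable_character]] insert by simp
  qed
  have "(\<Sum>m\<in>keys f. const_char (lookup f m) * mon m) = (\<Sum>m\<in>keys f. Poly_Mapping.single m (lookup f m))"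
    by (simp add: mult_single)
  also have "\<dots> = f" by (rule poly_mapping_sum_singles[symmetric])
  finally show ?thesis using partial[OF order_refl finite_keys] by (simp only:)
qed

lemma has_quotient_dim_cotangent: "has_quotient_dim V (ideal_square V) (card I)"
proof -
  obtain h where h: "bij_betw h {..<card I} I"
    using ex_bij_betw_nat_finite[OF finite_I] by (auto simp: atLeast0LessThan)
  have hI: "h i \<in> I" if "i < card I" for i using h that by (auto simp: bij_betw_def)
  have "\<exists>c. f - (\<Sum>i<card I. const_char (c i) * cotangent (h i)) \<in> ideal_square V" if f: "f \<in> V" for f
  proof -
    have "taylor f = (\<Sum>i<card I. const_char (eval_at (deriv_char (h i)) f) * cotangent (h i))"
      using f by (simp add: taylor_def maximal_ideal_at_def flip: sum.reindex_bij_betw[OF h])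
    then show ?thesis
      using linearizable_all[OF V_subset[OF f]] by (intro exI[of _ "\<lambda>i. eval_at (deriv_char (h i)) f"]) simp
  qed
  moreover have "c j = 0"
    if c: "(\<Sum>i<card I. const_char (c i) * cotangent (h i)) \<in> ideal_square V" and j: "j < card I" for c j
  proof -
    have "0 = eval_at (deriv_char (h j)) (\<Sum>i<card I. const_char (c i) * cotangent (h i))"
      using deriv_ideal_square[OF c hI[OF j]] by simp
    also have "\<dots> = (\<Sum>i<card I. if i = j then c j else 0)"
      unfolding eval_at_sum eval_at_const_mult using h j
      by (intro sum.cong) (auto simp: deriv_cotangent hI bij_betw_def dest: inj_onD)
    finally show ?thesis using j by simp
  qed
  ultimately show ?thesis
    unfolding has_quotient_dim_def using cotangent_in_V hI by (intro exI[of _ "\<lambda>i. cotangent (h i)"]) blast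
qed

lemma nonsingular: "nonsingular_at A x"
  unfolding nonsingular_at_def using has_trdeg_coordinate_ring has_quotient_dim_cotangent by blast

end

section \<open>Faces of sets given by finitely many linear inequalities\<close>

lemma small_perturbation:
  fixes a b c :: "'i \<Rightarrow> real"
  assumes "finite K" "\<And>i. i \<in> K \<Longrightarrow> a i < c i"
  shows "\<exists>\<epsilon>>0. \<forall>i\<in>K. a i + \<epsilon> * b i \<le> c i"
  using assms
proof (induction K)
  case empty
  show ?case by (intro exI[of _ 1]) auto
next
  case (insert j K)
  then obtain \<epsilon> where \<epsilon>: "\<epsilon> > 0" "\<And>i. i \<in> K \<Longrightarrow> a i + \<epsilon> * b i \<le> c i" by auto
  define \<eta> where "\<eta> = min \<epsilon> ((c j - a j) / (1 + \<bar>b j\<bar>))"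
  have gap: "a j < c j" using insert.prems by simp
  have \<eta>: "0 < \<eta>" "\<eta> \<le> \<epsilon>" using \<epsilon>(1) gap by (auto simp: \<eta>_def)
  have "a i + \<eta> * b i \<le> c i" if i: "i \<in> insert j K" for i
  proof (cases "i = j")
    case True
    have "\<eta> * b j \<le> \<eta> * (1 + \<bar>b j\<bar>)" using \<eta> by (intro mult_left_mono) auto
    also have "\<dots> \<le> (c j - a j) / (1 + \<bar>b j\<bar>) * (1 + \<bar>b j\<bar>)"
      by (intro mult_right_mono) (auto simp: \<eta>_def)
    also have "\<dots> = c j - a j" by (simp add: add_pos_nonneg[THEN less_imp_neq, symmetric])
    finally show ?thesis using True by simp
  next
    case False
    then have iK: "i \<in> K" using i by simp
    show ?thesis
    proof (cases "b i \<ge> 0")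
      case True
      then have "\<eta> * b i \<le> \<epsilon> * b i" using \<eta> by (intro mult_right_mono)
      then show ?thesis using \<epsilon>(2)[OF iK] by simp
    next
      case False
      then have "\<eta> * b i \<le> 0" using \<eta> by (intro mult_nonneg_nonpos) auto
      then show ?thesis using insert.prems[of i] iK by simp
    qed
  qed
  then show ?case using \<eta>(1) by blast
qed

lemma tight_face:
  fixes L :: "'i \<Rightarrow> 'v::real_vector \<Rightarrow> real"
  assumes W: "subspace W" and lin: "\<And>i. i \<in> K \<Longrightarrow> linear (L i)"
    and P: "P = {v \<in> W. \<forall>i\<in>K. L i v \<le> b i}" and J: "J \<subseteq> K"
  shows "{v \<in> P. \<forall>i\<in>J. L i v = b i} face_of P"
  unfolding face_of_def
proof (intro conjI ballI impI)
  have lin': "L i (s *\<^sub>R v + t *\<^sub>R w) = s * L i v + t * L i w" if "i \<in> K" for i s t v w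
    using lin[OF that] by (simp add: linear_add linear_scale)
  show "convex {v \<in> P. \<forall>i\<in>J. L i v = b i}"
  proof (rule convexI, clarify, intro conjI ballI)
    fix v w and s t :: real
    assume vw: "v \<in> P" "w \<in> P" "\<forall>i\<in>J. L i v = b i" "\<forall>i\<in>J. L i w = b i" and st: "0 \<le> s" "0 \<le> t" "s + t = 1"
    have "L i (s *\<^sub>R v + t *\<^sub>R w) \<le> b i" if i: "i \<in> K" for i
      unfolding lin'[OF i] using vw(1,2) i st by (intro convex_bound_le) (auto simp: P)
    then show "s *\<^sub>R v + t *\<^sub>R w \<in> P"
      using vw(1,2) subspace_add[OF W] subspace_scale[OF W] by (auto simp: P)
    show "L i (s *\<^sub>R v + t *\<^sub>R w) = b i" if i: "i \<in> J" for i
      using vw(3,4) i st J lin'[of i s v t w] by (auto simp flip: distrib_right)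
  qed
  fix v w x
  assume v: "v \<in> P" and w: "w \<in> P" and x: "x \<in> {v \<in> P. \<forall>i\<in>J. L i v = b i}" "x \<in> open_segment v w"
  obtain u where u: "0 < u" "u < 1" "x = (1 - u) *\<^sub>R v + u *\<^sub>R w"
    using x(2) by (auto simp: in_segment)
  have "L i v = b i \<and> L i w = b i" if i: "i \<in> J" for i
  proof -
    have iK: "i \<in> K" using i J by auto
    have le: "L i v \<le> b i" "L i w \<le> b i" using v w iK by (auto simp: P)
    have eq: "(1 - u) * (b i - L i v) + u * (b i - L i w) = 0"
      using x(1) i lin'[OF iK, of "1 - u" v u w] u(3) by (simp add: algebra_simps)
    have "0 \<le> (1 - u) * (b i - L i v)" "0 \<le> u * (b i - L i w)" using le u by auto
    then have "(1 - u) * (b i - L i v) = 0" "u * (b i - L i w) = 0" using eq by linarith+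
    then show ?thesis using u by auto
  qed
  then show "v \<in> {v \<in> P. \<forall>i\<in>J. L i v = b i}" "w \<in> {v \<in> P. \<forall>i\<in>J. L i v = b i}" using v w by auto
qed auto

text \<open>
  A nonempty face \<open>F\<close> contains a point \<open>w\<close> at which only the inequalities tight on all of \<open>F\<close> are
  tight. From a point \<open>v\<close> at which these are tight one can go through \<open>w\<close> and a little
  further without leaving the set, so that \<open>w\<close> is interior to a segment starting at \<open>v\<close>.
\<close>

lemma face_tight:
  fixes L :: "'i \<Rightarrow> 'v::real_vector \<Rightarrow> real"
  assumes W: "subspace W" and lin: "\<And>i. i \<in> K \<Longrightarrow> linear (L i)" and K: "finite K"
    and P: "P = {v \<in> W. \<forall>i\<in>K. L i v \<le> b i}" and F: "F face_of P" "F \<noteq> {}"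
  shows "F = {v \<in> P. \<forall>i\<in>K. (\<forall>w\<in>F. L i w = b i) \<longrightarrow> L i v = b i}"
proof
  show "F \<subseteq> {v \<in> P. \<forall>i\<in>K. (\<forall>w\<in>F. L i w = b i) \<longrightarrow> L i v = b i}"
    using face_of_imp_subset[OF F(1)] by auto
  show "{v \<in> P. \<forall>i\<in>K. (\<forall>w\<in>F. L i w = b i) \<longrightarrow> L i v = b i} \<subseteq> F"
  proof
    fix v assume "v \<in> {v \<in> P. \<forall>i\<in>K. (\<forall>w\<in>F. L i w = b i) \<longrightarrow> L i v = b i}"
    then have v: "v \<in> P" "\<And>i. i \<in> K \<Longrightarrow> \<forall>w\<in>F. L i w = b i \<Longrightarrow> L i v = b i" by auto
    let ?loose = "{i \<in> K. \<exists>w\<in>F. L i w \<noteq> b i}"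
    have FP: "w \<in> W" "\<And>i. i \<in> K \<Longrightarrow> L i w \<le> b i" if "w \<in> F" for w
      using face_of_imp_subset[OF F(1)] that by (auto simp: P)
    have "\<exists>w\<in>F. \<forall>i\<in>M. L i w < b i" if "finite M" "M \<subseteq> ?loose" for M
      using that
    proof (induction M)
      case empty
      then show ?case using F(2) by auto
    next
      case (insert j M)
      then obtain w where w: "w \<in> F" "\<And>i. i \<in> M \<Longrightarrow> L i w < b i" by auto
      obtain w' where w': "w' \<in> F" "L j w' \<noteq> b j" "j \<in> K" using insert.prems by auto
      let ?u = "(1/2) *\<^sub>R w + (1/2) *\<^sub>R w'"
      have "?u \<in> F"
        using face_of_imp_convex[OF F(1)] w(1) w'(1) by (intro convexD) auto
      moreover have "L i ?u < b i" if i: "i \<in> insert j M" for i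
      proof -
        have iK: "i \<in> K" using i insert.prems w'(3) by auto
        have "L i ?u = (L i w + L i w') / 2"
          using lin[OF iK] by (simp add: linear_add linear_scale)
        moreover have "L i w < b i \<or> L i w' < b i"
          using i w(2) w' FP(2)[OF w'(1) w'(3)] by auto
        ultimately show ?thesis using FP(2)[OF w(1) iK] FP(2)[OF w'(1) iK] by auto
      qed
      ultimately show ?case by blast
    qed
    then obtain w where w: "w \<in> F" "\<And>i. i \<in> ?loose \<Longrightarrow> L i w < b i"
      using K by (metis (no_types, lifting) finite_subset mem_Collect_eq subsetI)
    obtain \<epsilon> where \<epsilon>: "\<epsilon> > 0" "\<And>i. i \<in> ?loose \<Longrightarrow> L i w + \<epsilon> * (L i w - L i v) \<le> b i"
      using small_perturbation[of ?loose "\<lambda>i. L i w" b "\<lambda>i. L i w - L i v"] w(2) K by auto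
    define u where "u = w + \<epsilon> *\<^sub>R (w - v)"
    have "L i u \<le> b i" if i: "i \<in> K" for i
    proof -
      have Lu: "L i u = L i w + \<epsilon> * (L i w - L i v)"
        using lin[OF i] by (simp add: u_def linear_add linear_scale linear_diff)
      show ?thesis
      proof (cases "i \<in> ?loose")
        case True
        then show ?thesis using \<epsilon>(2) Lu by simp
      next
        case False
        then have "\<forall>w\<in>F. L i w = b i" using i by auto
        then show ?thesis using Lu v(2)[OF i] w(1) by simp
      qed
    qed
    moreover have "u \<in> W"
      using FP(1)[OF w(1)] v(1) subspace_add[OF W] subspace_scale[OF W] subspace_diff[OF W]
      by (auto simp: u_def P)
    ultimately have u: "u \<in> P" by (simp add: P)
    show "v \<in> F"
    proof (cases "v = w")
      case False
      have "w = (1 - 1 / (1 + \<epsilon>)) *\<^sub>R v + (1 / (1 + \<epsilon>)) *\<^sub>R u"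
      proof -
        have "(1 + \<epsilon>) *\<^sub>R w = \<epsilon> *\<^sub>R v + u" by (simp add: u_def algebra_simps)
        then have "(1 / (1 + \<epsilon>)) *\<^sub>R ((1 + \<epsilon>) *\<^sub>R w) = (1 / (1 + \<epsilon>)) *\<^sub>R (\<epsilon> *\<^sub>R v + u)" by simp
        moreover have "1 - 1 / (1 + \<epsilon>) = \<epsilon> / (1 + \<epsilon>)" using \<epsilon>(1) by (simp add: field_simps)
        ultimately show ?thesis using \<epsilon>(1) by (simp add: scaleR_add_right)
      qed
      moreover have "v \<noteq> u"
      proof
        assume "v = u"
        then have "(1 + \<epsilon>) *\<^sub>R (w - v) = 0" by (simp add: u_def algebra_simps)
        then show False using \<epsilon>(1) False by simp
      qed
      ultimately have "w \<in> open_segment v u"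
        using \<epsilon>(1) unfolding in_segment by (intro conjI exI[of _ "1 / (1 + \<epsilon>)"]) auto
      then show ?thesis using F(1) v(1) u w(1) unfolding face_of_def by blast
    qed (use w(1) in simp)
  qed
qed

lemma linear_pairing: "linear (pairing m)"
  by (rule linearI) (simp_all add: pairing_add_right pairing_scaleR_right)

lemma subspace_keys: "subspace {v :: 'd \<Rightarrow>\<^sub>0 real. keys v \<subseteq> D}"
  by (auto simp: subspace_def keys_add_subset keys_scaleR_subset)

lemma convex_cone_hull_image:
  fixes \<delta> :: "'e \<Rightarrow> 'v::real_vector"
  assumes "finite H"
  shows "convex_cone hull (\<delta> ` H) = {(\<Sum>e\<in>H. c e *\<^sub>R \<delta> e) | c. \<forall>e\<in>H. 0 \<le> c e}" (is "_ = ?C")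
proof
  have "convex_cone ?C"
    unfolding convex_cone_iff
  proof (intro conjI ballI allI impI)
    show "0 \<in> ?C" by (auto intro!: exI[of _ "\<lambda>_. 0"])
    fix x y assume "x \<in> ?C" "y \<in> ?C"
    then obtain c c' where "x = (\<Sum>e\<in>H. c e *\<^sub>R \<delta> e)" "\<forall>e\<in>H. 0 \<le> c e" "y = (\<Sum>e\<in>H. c' e *\<^sub>R \<delta> e)" "\<forall>e\<in>H. 0 \<le> c' e"
      by blast
    then have "x + y = (\<Sum>e\<in>H. (c e + c' e) *\<^sub>R \<delta> e)" "\<forall>e\<in>H. 0 \<le> c e + c' e"
      by (simp_all add: scaleR_add_left sum.distrib)
    then show "x + y \<in> ?C" by (intro CollectI exI[of _ "\<lambda>e. c e + c' e"] conjI)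
  next
    fix x and r :: real assume "x \<in> ?C" "0 \<le> r"
    then obtain c where "x = (\<Sum>e\<in>H. c e *\<^sub>R \<delta> e)" "\<forall>e\<in>H. 0 \<le> c e" by blast
    then have "r *\<^sub>R x = (\<Sum>e\<in>H. (r * c e) *\<^sub>R \<delta> e)" "\<forall>e\<in>H. 0 \<le> r * c e"
      using \<open>0 \<le> r\<close> by (simp_all add: scaleR_sum_right)
    then show "r *\<^sub>R x \<in> ?C" by (intro CollectI exI[of _ "\<lambda>e. r * c e"] conjI)
  qed
  moreover have "\<delta> e \<in> ?C" if e: "e \<in> H" for e
  proof -
    have "\<delta> e = (\<Sum>e'\<in>H. (if e' = e then 1 else 0) *\<^sub>R \<delta> e')"
      using e assms by (simp add: if_distrib[of "\<lambda>r. r *\<^sub>R _"] cong: if_cong)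
    then show ?thesis by (auto intro!: exI[of _ "\<lambda>e'. if e' = e then 1 else 0"])
  qed
  ultimately show "convex_cone hull (\<delta> ` H) \<subseteq> ?C" by (intro hull_minimal) auto
  show "?C \<subseteq> convex_cone hull (\<delta> ` H)"
  proof clarify
    fix c assume c: "\<forall>e\<in>H. 0 \<le> (c e :: real)"
    have "(\<Sum>e\<in>M. c e *\<^sub>R \<delta> e) \<in> convex_cone hull (\<delta> ` H)" if "finite M" "M \<subseteq> H" for M
      using that
    proof (induction M)
      case empty
      then show ?case by (simp add: convex_cone_hull_contains_0)
    next
      case (insert e M)
      have "c e *\<^sub>R \<delta> e \<in> convex_cone hull (\<delta> ` H)"
        using c insert.prems by (intro convex_cone_hull_mul hull_inc) auto
      then show ?case using insert convex_cone_hull_add by simp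
    qed
    then show "(\<Sum>e\<in>H. c e *\<^sub>R \<delta> e) \<in> convex_cone hull (\<delta> ` H)" using assms by blast
  qed
qed

section \<open>Edges separating regions, and bases of the lattice\<close>

text \<open>
  An oriented graph drawn in the plane, each of whose edges separates a region \<open>ur e\<close> from a region
  \<open>ll e\<close>; regions outside \<open>R\<close> count as the outer region. The vector \<open>\<delta> e\<close> is the boundary of \<open>e\<close>, and
  \<open>kernel\<close> is planar duality: the circulations are the differences of potentials on the regions that
  vanish on the outer region.
\<close>

locale edge_regions =
  fixes D :: "'d set" and E :: "'e set" and R :: "'r set"
    and ur ll :: "'e \<Rightarrow> 'r" and rank :: "'r \<Rightarrow> nat" and \<delta> :: "'e \<Rightarrow> ('d \<Rightarrow>\<^sub>0 real)"
  assumes finite_D: "finite D" and finite_E: "finite E" and finite_R: "finite R" and R_nonempty: "R \<noteq> {}"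
    and ur: "e \<in> E \<Longrightarrow> ur e \<in> R"
    and rank: "e \<in> E \<Longrightarrow> ll e \<in> R \<Longrightarrow> rank (ll e) < rank (ur e)"
    and two_edges: "r \<in> R \<Longrightarrow> \<exists>e\<in>E. ur e = r \<and> e \<noteq> e'"
    and balanced: "r \<in> R \<Longrightarrow> card {e\<in>E. ll e = r} \<le> card {e\<in>E. ur e = r}"
    and \<delta>_lattice: "e \<in> E \<Longrightarrow> \<delta> e \<in> lattice_points D"
    and kernel: "(\<Sum>e\<in>E. c e *\<^sub>R \<delta> e) = 0 \<longleftrightarrow>
      (\<exists>x. (\<forall>r. r \<notin> R \<longrightarrow> x r = 0) \<and> (\<forall>e\<in>E. c e = x (ur e) - x (ll e)))"
    and span: "d \<in> D \<Longrightarrow> \<exists>c::'e \<Rightarrow> int. Poly_Mapping.single d 1 = (\<Sum>e\<in>E. of_int (c e) *\<^sub>R \<delta> e)"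
begin

definition comb :: "('e \<Rightarrow> real) \<Rightarrow> ('d \<Rightarrow>\<^sub>0 real)" where
  "comb c = (\<Sum>e\<in>E. c e *\<^sub>R \<delta> e)"

abbreviation edges_of :: "'r \<Rightarrow> 'e set" where
  "edges_of r \<equiv> {e\<in>E. ur e = r}"

definition selectors :: "('r \<Rightarrow> 'e) set" where
  "selectors = PiE R edges_of"

definition gens :: "('r \<Rightarrow> 'e) \<Rightarrow> 'e set" where
  "gens s = E - s ` R"

lemma comb_diff: "comb c - comb c' = comb (\<lambda>e. c e - c' e)"
  by (simp add: comb_def scaleR_left.diff sum_subtractf)

lemma comb_cong: "(\<And>e. e \<in> E \<Longrightarrow> c e = c' e) \<Longrightarrow> comb c = comb c'"
  by (simp add: comb_def)

lemma comb_indicator: "e \<in> E \<Longrightarrow> comb (\<lambda>e'. if e' = e then 1 else 0) = \<delta> e"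
  using finite_E by (simp add: comb_def if_distrib[of "\<lambda>r. r *\<^sub>R _"] cong: if_cong)

lemma comb_shift:
  assumes "\<And>r. r \<notin> R \<Longrightarrow> x r = 0"
  shows "comb (\<lambda>e. c e + x (ur e) - x (ll e)) = comb c"
proof -
  have "comb (\<lambda>e. x (ur e) - x (ll e)) = 0"
    unfolding comb_def kernel using assms by (intro exI[of _ x]) auto
  moreover have "comb (\<lambda>e. c e + x (ur e) - x (ll e)) - comb c = comb (\<lambda>e. x (ur e) - x (ll e))"
    unfolding comb_diff by (rule comb_cong) simp
  ultimately show ?thesis by simp
qed

lemma keys_\<delta>: "e \<in> E \<Longrightarrow> keys (\<delta> e) \<subseteq> D"
  using \<delta>_lattice by (simp add: lattice_points_def)

lemma keys_comb: "keys (comb c) \<subseteq> D"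
  unfolding comb_def by (intro keys_sum_subset keys_scaleR_subset keys_\<delta>)

lemma pairing_\<delta>_int: "e \<in> E \<Longrightarrow> pairing m (\<delta> e) \<in> \<int>"
  using pairing_lattice_int \<delta>_lattice by blast

lemma pairing_comb: "pairing m (comb c) = (\<Sum>e\<in>E. c e * pairing m (\<delta> e))"
  by (simp add: comb_def pairing_sum_right pairing_scaleR_right)

lemma selector_mem: "s \<in> selectors \<Longrightarrow> r \<in> R \<Longrightarrow> s r \<in> E \<and> ur (s r) = r"
  by (auto simp: selectors_def PiE_def Pi_def)

lemma finite_selectors: "finite selectors"
  unfolding selectors_def using finite_R finite_E by (intro finite_PiE) auto

lemma selector_avoiding: "\<exists>s\<in>selectors. e \<notin> s ` R"
proof -
  have "\<forall>r\<in>R. \<exists>a. a \<in> E \<and> ur a = r \<and> a \<noteq> e" using two_edges by blast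
  from bchoice[OF this] obtain s where "\<forall>r\<in>R. s r \<in> E \<and> ur (s r) = r \<and> s r \<noteq> e" by blast
  then show ?thesis by (intro bexI[of _ "restrict s R"]) (auto simp: selectors_def)
qed

lemma selectors_nonempty: "selectors \<noteq> {}"
  using selector_avoiding by blast

lemma gens_subset: "gens s \<subseteq> E"
  by (auto simp: gens_def)

lemma exists_representation:
  assumes "keys y \<subseteq> D"
  shows "\<exists>c. y = comb c \<and> (y \<in> lattice_points D \<longrightarrow> (\<forall>e\<in>E. c e \<in> \<int>))"
proof -
  obtain b :: "'d \<Rightarrow> 'e \<Rightarrow> int" where b: "\<And>d. d \<in> D \<Longrightarrow> Poly_Mapping.single d 1 = (\<Sum>e\<in>E. of_int (b d e) *\<^sub>R \<delta> e)"
    using span by metis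
  define c where "c e = (\<Sum>d\<in>D. lookup y d * of_int (b d e))" for e
  have "comb c = (\<Sum>d\<in>D. lookup y d *\<^sub>R (\<Sum>e\<in>E. of_int (b d e) *\<^sub>R \<delta> e))"
    unfolding comb_def c_def scaleR_sum_left scaleR_sum_right by (subst sum.swap) simp
  also have "\<dots> = (\<Sum>d\<in>D. lookup y d *\<^sub>R Poly_Mapping.single d 1)" using b by simp
  also have "\<dots> = y"
  proof (rule poly_mapping_eqI)
    fix d
    have "lookup (\<Sum>d\<in>D. lookup y d *\<^sub>R Poly_Mapping.single d 1) d = (\<Sum>d'\<in>D. if d' = d then lookup y d else 0)"
      unfolding lookup_sum by (intro sum.cong) (auto simp: lookup_single when_def)
    then show "lookup (\<Sum>d\<in>D. lookup y d *\<^sub>R Poly_Mapping.single d 1) d = lookup y d"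
      using assms finite_D by (auto simp: in_keys_iff subset_iff)
  qed
  finally have "y = comb c" by simp
  moreover have "\<forall>e\<in>E. c e \<in> \<int>" if "y \<in> lattice_points D"
    using that by (auto simp: c_def lattice_points_def intro!: Ints_sum Ints_mult)
  ultimately show ?thesis by blast
qed

text \<open>The truncation of \<open>x\<close> to smaller ranks makes this recursion well-founded for every \<open>\<Phi>\<close>.\<close>

lemma rank_recursion:
  fixes \<Phi> :: "'r \<Rightarrow> ('r \<Rightarrow> real) \<Rightarrow> real"
  shows "\<exists>x. \<forall>r. x r = (if r \<in> R then \<Phi> r (\<lambda>r'. if r' \<in> R \<and> rank r' < rank r then x r' else 0) else 0)"
proof -
  let ?F = "\<lambda>x r. if r \<in> R then \<Phi> r (\<lambda>r'. if r' \<in> R \<and> rank r' < rank r then x r' else 0) else 0"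
  have "adm_wf (Wellfounded.measure rank) ?F"
    unfolding adm_wf_def
  proof (intro allI impI)
    fix f g r assume "\<forall>z. (z, r) \<in> Wellfounded.measure rank \<longrightarrow> f z = (g z :: real)"
    then have "(\<lambda>r'. if r' \<in> R \<and> rank r' < rank r then f r' else 0) =
        (\<lambda>r'. if r' \<in> R \<and> rank r' < rank r then g r' else 0)" by auto
    then show "?F f r = ?F g r" by simp
  qed
  then have "wfrec (Wellfounded.measure rank) ?F = ?F (wfrec (Wellfounded.measure rank) ?F)"
    by (intro wfrec_fixpoint) auto
  then show ?thesis by (intro exI[of _ "wfrec (Wellfounded.measure rank) ?F"]) (metis (no_types, lifting))
qed

text \<open>
  Changing the potential of a region changes the coefficients of all of its edges by the same amount
  and otherwise only those of edges of regions of larger rank. So working upwards one can make the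
  coefficient of the edge selected in each region vanish, and in exactly one way.
\<close>

lemma selector_representation:
  assumes s: "s \<in> selectors" and y: "keys y \<subseteq> D"
  shows "\<exists>c. y = comb c \<and> (\<forall>r\<in>R. c (s r) = 0) \<and> (y \<in> lattice_points D \<longrightarrow> (\<forall>e\<in>E. c e \<in> \<int>))"
proof -
  obtain c0 where c0: "y = comb c0" "y \<in> lattice_points D \<Longrightarrow> e \<in> E \<Longrightarrow> c0 e \<in> \<int>" for e
    using exists_representation[OF y] by blast
  obtain x where x: "\<And>r. x r = (if r \<in> R then
      (\<lambda>r'. if r' \<in> R \<and> rank r' < rank r then x r' else 0) (ll (s r)) - c0 (s r) else 0)"
    using rank_recursion[of "\<lambda>r x. x (ll (s r)) - c0 (s r)"] by metis
  have x0: "x r = 0" if "r \<notin> R" for r using x[of r] that by simp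
  have xR: "x r = x (ll (s r)) - c0 (s r)" if r: "r \<in> R" for r
    using x[of r] x0[of "ll (s r)"] r rank[of "s r"] selector_mem[OF s r] by auto
  define c where "c e = c0 e + x (ur e) - x (ll e)" for e
  have "y = comb c" using comb_shift[of x c0] x0 c0(1) by (simp add: c_def[abs_def])
  moreover have "c (s r) = 0" if "r \<in> R" for r
    using xR[OF that] selector_mem[OF s that] by (simp add: c_def)
  moreover have "c e \<in> \<int>" if lat: "y \<in> lattice_points D" and e: "e \<in> E" for e
  proof -
    have "x r \<in> \<int>" for r
    proof (induction "rank r" arbitrary: r rule: less_induct)
      case less
      show ?case
      proof (cases "r \<in> R")
        case True
        have "x (ll (s r)) \<in> \<int>"
          using less[of "ll (s r)"] rank[of "s r"] selector_mem[OF s True] x0[of "ll (s r)"]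
          by (cases "ll (s r) \<in> R") auto
        then show ?thesis using xR[OF True] c0(2)[OF lat] selector_mem[OF s True] by simp
      qed (simp add: x0)
    qed
    then show ?thesis using c0(2)[OF lat e] by (simp add: c_def)
  qed
  ultimately show ?thesis by blast
qed

lemma selector_unique:
  assumes s: "s \<in> selectors" and eq: "comb c = comb c'" and c: "\<And>r. r \<in> R \<Longrightarrow> c (s r) = c' (s r)"
    and e: "e \<in> E"
  shows "c e = c' e"
proof -
  have "comb (\<lambda>e. c e - c' e) = 0" using eq by (simp flip: comb_diff)
  then obtain x where x: "\<And>r. r \<notin> R \<Longrightarrow> x r = 0" "\<And>e. e \<in> E \<Longrightarrow> c e - c' e = x (ur e) - x (ll e)"
    unfolding comb_def kernel by blast
  have "x r = 0" for r
  proof (induction "rank r" arbitrary: r rule: less_induct)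
    case less
    show ?case
    proof (cases "r \<in> R")
      case True
      have "x (ll (s r)) = 0"
        using less[of "ll (s r)"] rank[of "s r"] selector_mem[OF s True] x(1)[of "ll (s r)"]
        by (cases "ll (s r) \<in> R") auto
      then show ?thesis using x(2)[of "s r"] c[OF True] selector_mem[OF s True] by simp
    qed (simp add: x)
  qed
  then show ?thesis using x(2)[OF e] by simp
qed

text \<open>
  Choosing the potential of each region as the maximum over its edges makes all coefficients
  nonnegative with a zero in each region.
\<close>

lemma reduced_representation:
  assumes y: "keys y \<subseteq> D"
  shows "\<exists>c s. y = comb c \<and> (\<forall>e\<in>E. 0 \<le> c e) \<and> s \<in> selectors \<and> (\<forall>r\<in>R. c (s r) = 0)"
proof -
  obtain c0 where c0: "y = comb c0" using exists_representation[OF y] by blast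
  let ?\<Phi> = "\<lambda>r x. Max ((\<lambda>e. x (ll e) - c0 e) ` edges_of r)"
  obtain x where x: "\<And>r. x r = (if r \<in> R then ?\<Phi> r (\<lambda>r'. if r' \<in> R \<and> rank r' < rank r then x r' else 0) else 0)"
    using rank_recursion[of ?\<Phi>] by (elim exE) (rule that, erule spec)
  have x0: "x r = 0" if "r \<notin> R" for r using x[of r] that by simp
  have xR: "x r = ?\<Phi> r x" if r: "r \<in> R" for r
  proof -
    have "(\<lambda>e. (if ll e \<in> R \<and> rank (ll e) < rank r then x (ll e) else 0) - c0 e) ` edges_of r
        = (\<lambda>e. x (ll e) - c0 e) ` edges_of r"
      using rank x0 by (intro image_cong) auto
    then show ?thesis using x[of r] r by simp
  qed
  define c where "c e = c0 e + x (ur e) - x (ll e)" for e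
  have "y = comb c" using comb_shift[of x c0] x0 c0(1) by (simp add: c_def[abs_def])
  moreover have "0 \<le> c e" if e: "e \<in> E" for e
  proof -
    have "x (ll e) - c0 e \<le> ?\<Phi> (ur e) x" using finite_E e by (intro Max_ge) auto
    then show ?thesis using xR[OF ur[OF e]] by (simp add: c_def)
  qed
  moreover have "\<exists>s\<in>selectors. \<forall>r\<in>R. c (s r) = 0"
  proof -
    have "\<exists>e\<in>edges_of r. c e = 0" if r: "r \<in> R" for r
    proof -
      have "?\<Phi> r x \<in> (\<lambda>e. x (ll e) - c0 e) ` edges_of r"
        using finite_E two_edges[OF r] by (intro Max_in) (simp, blast)
      then obtain e where "e \<in> edges_of r" "?\<Phi> r x = x (ll e) - c0 e" by blast
      then show ?thesis using xR[OF r] by (intro bexI[of _ e]) (auto simp: c_def)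
    qed
    then have "\<forall>r\<in>R. \<exists>e. e \<in> edges_of r \<and> c e = 0" by blast
    from bchoice[OF this] obtain s where s: "\<And>r. r \<in> R \<Longrightarrow> s r \<in> edges_of r \<and> c (s r) = 0" by blast
    then have "restrict s R \<in> selectors" by (auto simp: selectors_def)
    then show ?thesis using s by (intro bexI[of _ "restrict s R"]) auto
  qed
  ultimately show ?thesis by blast
qed

text \<open>
  Two reduced representations differ by a potential. If it vanishes on all regions below \<open>r\<close>, then
  the two coefficients differ by the same amount \<open>x r\<close> on all edges of \<open>r\<close>; the zeros of the one and
  of the other representation show \<open>x r \<le> 0\<close> and \<open>x r \<ge> 0\<close>.
\<close>

lemma reduced_unique:
  assumes eq: "comb c = comb c'" and nonneg: "\<forall>e\<in>E. 0 \<le> c e" "\<forall>e\<in>E. 0 \<le> c' e"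
    and s: "s \<in> selectors" "\<forall>r\<in>R. c (s r) = 0" and s': "s' \<in> selectors" "\<forall>r\<in>R. c' (s' r) = 0"
    and e: "e \<in> E"
  shows "c e = c' e"
proof -
  have "comb (\<lambda>e. c e - c' e) = 0" using eq by (simp flip: comb_diff)
  then obtain x where x: "\<And>r. r \<notin> R \<Longrightarrow> x r = 0" "\<And>e. e \<in> E \<Longrightarrow> c e - c' e = x (ur e) - x (ll e)"
    unfolding comb_def kernel by blast
  have "x r = 0" for r
  proof (induction "rank r" arbitrary: r rule: less_induct)
    case less
    show ?case
    proof (cases "r \<in> R")
      case True
      have "x (ll e) = 0" if "e \<in> edges_of r" for e
        using less[of "ll e"] rank[of e] that x(1)[of "ll e"] by (cases "ll e \<in> R") auto
      then have "c e - c' e = x r" if "e \<in> edges_of r" for e using x(2)[of e] that by simp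
      from this[of "s r"] this[of "s' r"] show ?thesis
        using nonneg s(2) s'(2) selector_mem[OF s(1) True] selector_mem[OF s'(1) True] True
        by (metis (mono_tags, lifting) diff_ge_0_iff_ge diff_le_0_iff_le diff_self mem_Collect_eq order_antisym)
    qed (simp add: x)
  qed
  then show ?thesis using x(2)[OF e] by simp
qed

definition is_dual_basis :: "('r \<Rightarrow> 'e) \<Rightarrow> ('e \<Rightarrow> ('d \<Rightarrow>\<^sub>0 int)) \<Rightarrow> bool" where
  "is_dual_basis s m \<longleftrightarrow> (\<forall>e. keys (m e) \<subseteq> D) \<and> (\<forall>r\<in>R. m (s r) = 0) \<and>
     (\<forall>v. keys v \<subseteq> D \<longrightarrow> v = comb (\<lambda>e. pairing (m e) v))"

text \<open>The basis of the dual lattice dual to the \<open>\<delta> e\<close>, \<open>e \<in> gens s\<close>, extended by zero.\<close>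

definition dual_char :: "('r \<Rightarrow> 'e) \<Rightarrow> 'e \<Rightarrow> ('d \<Rightarrow>\<^sub>0 int)" where
  "dual_char s = (SOME m. is_dual_basis s m)"

lemma exists_dual_basis:
  assumes s: "s \<in> selectors"
  shows "\<exists>m. is_dual_basis s m"
proof -
  have "\<exists>b::'e \<Rightarrow> int. Poly_Mapping.single d 1 = comb (\<lambda>e. of_int (b e)) \<and> (\<forall>r\<in>R. b (s r) = 0)" if d: "d \<in> D" for d
  proof -
    have k: "keys (Poly_Mapping.single d (1::real)) \<subseteq> D" "Poly_Mapping.single d (1::real) \<in> lattice_points D"
      using d by (auto simp: lattice_points_def lookup_single when_def)
    obtain c where c: "Poly_Mapping.single d 1 = comb c" "\<forall>r\<in>R. c (s r) = 0" "\<forall>e\<in>E. c e \<in> \<int>"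
      using selector_representation[OF s k(1)] k(2) by blast
    have "comb (\<lambda>e. of_int \<lfloor>c e\<rfloor>) = comb c" by (rule comb_cong) (use c(3) in simp)
    then show ?thesis using c by (intro exI[of _ "\<lambda>e. \<lfloor>c e\<rfloor>"]) auto
  qed
  then obtain b :: "'d \<Rightarrow> 'e \<Rightarrow> int" where b: "\<And>d. d \<in> D \<Longrightarrow> Poly_Mapping.single d 1 = comb (\<lambda>e. of_int (b d e))"
    "\<And>d r. d \<in> D \<Longrightarrow> r \<in> R \<Longrightarrow> b d (s r) = 0" by metis
  define m where "m e = (\<Sum>d\<in>D. Poly_Mapping.single d (b d e))" for e
  have "v = comb (\<lambda>e. pairing (m e) v)" if v: "keys v \<subseteq> D" for v
  proof -
    have "comb (\<lambda>e. pairing (m e) v) = (\<Sum>d\<in>D. lookup v d *\<^sub>R comb (\<lambda>e. of_int (b d e)))"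
      unfolding comb_def scaleR_sum_right
      by (subst sum.swap) (simp add: m_def pairing_sum_left pairing_single_left scaleR_sum_left mult.commute)
    also have "\<dots> = (\<Sum>d\<in>D. lookup v d *\<^sub>R Poly_Mapping.single d 1)" using b(1) by simp
    also have "\<dots> = v"
    proof (rule poly_mapping_eqI)
      fix d
      have "lookup (\<Sum>d\<in>D. lookup v d *\<^sub>R Poly_Mapping.single d 1) d = (\<Sum>d'\<in>D. if d' = d then lookup v d else 0)"
        unfolding lookup_sum by (intro sum.cong) (auto simp: lookup_single when_def)
      then show "lookup (\<Sum>d\<in>D. lookup v d *\<^sub>R Poly_Mapping.single d 1) d = lookup v d"
        using v finite_D by (auto simp: in_keys_iff subset_iff)
    qed
    finally show ?thesis by simp
  qed
  moreover have "keys (m e) \<subseteq> D" for e unfolding m_def by (intro keys_sum_subset) auto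
  moreover have "m (s r) = 0" if "r \<in> R" for r using b(2) that by (simp add: m_def)
  ultimately show ?thesis unfolding is_dual_basis_def by blast
qed

lemma dual_char:
  assumes "s \<in> selectors"
  shows "keys (dual_char s e) \<subseteq> D" "r \<in> R \<Longrightarrow> dual_char s (s r) = 0"
    "keys v \<subseteq> D \<Longrightarrow> v = comb (\<lambda>e. pairing (dual_char s e) v)"
  using someI_ex[OF exists_dual_basis[OF assms]] unfolding dual_char_def is_dual_basis_def by blast+

lemma dual_char_outside:
  assumes "s \<in> selectors" "e \<in> E - gens s"
  shows "dual_char s e = 0"
  using assms dual_char(2)[OF assms(1)] by (auto simp: gens_def)

lemma dual_char_comb:
  assumes s: "s \<in> selectors" and c: "\<And>r. r \<in> R \<Longrightarrow> c (s r) = 0" and e: "e \<in> E"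
  shows "pairing (dual_char s e) (comb c) = c e"
proof -
  have "comb (\<lambda>e. pairing (dual_char s e) (comb c)) = comb c"
    using dual_char(3)[OF s keys_comb] by simp
  then show ?thesis
    by (rule selector_unique[OF s _ _ e]) (simp add: dual_char(2)[OF s] c)
qed

lemma dual_char_\<delta>:
  assumes s: "s \<in> selectors" and e: "e \<in> E" "e' \<in> gens s"
  shows "pairing (dual_char s e) (\<delta> e') = (if e = e' then 1 else 0)"
proof -
  have "e' \<in> E" using e(2) by (simp add: gens_def)
  moreover have "(if s r = e' then 1 else 0 :: real) = 0" if "r \<in> R" for r
    using e(2) that by (auto simp: gens_def)
  ultimately show ?thesis
    using dual_char_comb[OF s _ e(1), of "\<lambda>a. if a = e' then 1 else 0"] by (simp add: comb_indicator)
qed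

definition support :: "('r \<Rightarrow> 'e) \<Rightarrow> ('d \<Rightarrow>\<^sub>0 int)" where
  "support s = (\<Sum>e\<in>E. dual_char s e)"

lemma keys_support: "s \<in> selectors \<Longrightarrow> keys (support s) \<subseteq> D"
  unfolding support_def by (intro keys_sum_subset dual_char)

lemma support_gens:
  assumes s: "s \<in> selectors" and e: "e \<in> gens s"
  shows "pairing (support s) (\<delta> e) = 1"
  using assms finite_E gens_subset[of s]
  by (simp add: support_def pairing_sum_left dual_char_\<delta> subset_iff)

lemma region_relation:
  assumes r: "r \<in> R"
  shows "(\<Sum>e\<in>edges_of r. \<delta> e) = (\<Sum>e\<in>{e\<in>E. ll e = r}. \<delta> e)"
proof -
  define x where "x r' = (if r' = r then 1 else 0 :: real)" for r'
  have "comb (\<lambda>e. x (ur e) - x (ll e)) = 0"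
    unfolding comb_def kernel using r by (intro exI[of _ x]) (auto simp: x_def)
  moreover have "comb (\<lambda>e. x (ur e) - x (ll e)) = comb (\<lambda>e. x (ur e)) - comb (\<lambda>e. x (ll e))"
    by (simp add: comb_diff)
  moreover have "comb (\<lambda>e. x (p e)) = (\<Sum>e\<in>{e\<in>E. p e = r}. \<delta> e)" for p
  proof -
    have "comb (\<lambda>e. x (p e)) = (\<Sum>e\<in>E. if p e = r then \<delta> e else 0)"
      unfolding comb_def by (rule sum.cong) (auto simp: x_def)
    then show ?thesis using finite_E by (simp add: sum.inter_filter)
  qed
  ultimately show ?thesis by simp
qed

text \<open>
  The functional equal to one on the selected basis is at most one on the omitted edges. By the
  relation of its region \<open>r\<close> the value on the edge omitted in \<open>r\<close> is the sum of the values on the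
  edges with \<open>r\<close> on their lower left minus the number of remaining edges of \<open>r\<close>. The former edges
  belong to regions of larger rank, so this allows an induction downwards along the rank, and by the
  count \<open>balanced\<close> the bound one is inherited.
\<close>

lemma support_le_1:
  assumes s: "s \<in> selectors" and e: "e \<in> E"
  shows "pairing (support s) (\<delta> e) \<le> 1"
  using e
proof (induction "Max (rank ` R) - rank (ur e)" arbitrary: e rule: less_induct)
  case less
  let ?g = "\<lambda>e. pairing (support s) (\<delta> e)"
  let ?r = "ur e"
  have r: "?r \<in> R" by (rule ur[OF less.prems])
  show ?case
  proof (cases "e \<in> gens s")
    case False
    then obtain r' where "r' \<in> R" "e = s r'" using less.prems by (auto simp: gens_def)
    then have e: "e = s ?r" using selector_mem[OF s] by auto
    have others: "?g e' = 1" if "e' \<in> edges_of ?r - {e}" for e'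
    proof -
      have "e' \<notin> s ` R" using that e selector_mem[OF s] by auto
      then show ?thesis using that by (intro support_gens[OF s]) (auto simp: gens_def)
    qed
    have le: "?g e' \<le> 1" if e': "e' \<in> {e\<in>E. ll e = ?r}" for e'
    proof (rule less.hyps)
      have lt: "rank ?r < rank (ur e')" using e' rank[of e'] r by auto
      have "rank (ur e') \<le> Max (rank ` R)" using finite_R ur e' by (intro Max_ge) auto
      then show "Max (rank ` R) - rank (ur e') < Max (rank ` R) - rank ?r" using lt by simp
    qed (use e' in simp)
    have "pairing (support s) (\<Sum>e\<in>edges_of ?r. \<delta> e) = pairing (support s) (\<Sum>e\<in>{e\<in>E. ll e = ?r}. \<delta> e)"
      by (simp only: region_relation[OF r])
    then have "(\<Sum>e'\<in>edges_of ?r. ?g e') = (\<Sum>e'\<in>{e\<in>E. ll e = ?r}. ?g e')"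
      by (simp only: pairing_sum_right)
    also have "\<dots> \<le> (\<Sum>e'\<in>{e\<in>E. ll e = ?r}. 1)" using le by (rule sum_mono)
    also have "\<dots> \<le> real (card (edges_of ?r))" using balanced[OF r] by simp
    finally have "(\<Sum>e'\<in>edges_of ?r. ?g e') \<le> real (card (edges_of ?r))" .
    moreover have "(\<Sum>e'\<in>edges_of ?r. ?g e') = ?g e + (\<Sum>e'\<in>edges_of ?r - {e}. 1)"
      using finite_E less.prems others by (subst sum.remove[of _ e]) auto
    moreover have "card (edges_of ?r) = Suc (card (edges_of ?r - {e}))"
      using finite_E less.prems by (intro card.remove) auto
    ultimately show ?thesis by simp
  qed (simp add: support_gens[OF s])
qed

text \<open>
  The edges with a positive coefficient in a reduced representation \<open>comb c\<close> with zeros at the edges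
  selected by \<open>s\<close> belong to \<open>gens s\<close>. So the functional of \<open>s\<close> takes the sum of the coefficients as its
  value, while the others are at most one on every edge.
\<close>

lemma support_max:
  assumes y: "keys y \<subseteq> D"
  obtains c s where "s \<in> selectors" "\<And>e. e \<in> E \<Longrightarrow> 0 \<le> c e" "\<And>r. r \<in> R \<Longrightarrow> c (s r) = 0"
    "y = comb c" "pairing (support s) y = (\<Sum>e\<in>E. c e)"
    "\<And>s'. s' \<in> selectors \<Longrightarrow> pairing (support s') y \<le> pairing (support s) y"
    "y \<noteq> 0 \<Longrightarrow> 0 < pairing (support s) y"
proof -
  obtain c s where cs: "y = comb c" "\<forall>e\<in>E. 0 \<le> c e" "s \<in> selectors" "\<forall>r\<in>R. c (s r) = 0"
    using reduced_representation[OF y] by blast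
  have sum: "pairing (support s) y = (\<Sum>e\<in>E. c e)"
    unfolding cs(1) pairing_comb
  proof (rule sum.cong)
    fix e assume "e \<in> E"
    then show "c e * pairing (support s) (\<delta> e) = c e"
      using support_gens[OF cs(3), of e] cs(4) by (cases "e \<in> gens s") (auto simp: gens_def)
  qed simp
  have "pairing (support s') y \<le> pairing (support s) y" if "s' \<in> selectors" for s'
    unfolding sum unfolding cs(1) pairing_comb
    using cs(2) support_le_1[OF that] by (intro sum_mono mult_left_le) auto
  moreover have "0 < pairing (support s) y" if "y \<noteq> 0"
  proof (rule ccontr)
    assume "\<not> ?thesis"
    then have "(\<Sum>e\<in>E. c e) = 0" using sum cs(2) sum_nonneg[of E c] by simp
    then have "\<forall>e\<in>E. c e = 0" using finite_E cs(2) by (subst (asm) sum_nonneg_eq_0_iff) auto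
    then have "comb c = 0" by (simp add: comb_def)
    then show False using that cs(1) by simp
  qed
  ultimately show thesis using cs sum by (intro that[of s c]) auto
qed

end

section \<open>The simplicial fan and the fan of the polytope\<close>

context edge_regions
begin

definition fine_fan :: "('d \<Rightarrow>\<^sub>0 real) set set" where
  "fine_fan = {convex_cone hull (\<delta> ` H) | H. \<exists>s\<in>selectors. H \<subseteq> gens s}"

text \<open>
  For nonempty sets \<open>A\<close> of selectors these turn out to be the cones over the proper faces of the
  convex hull of the \<open>\<delta> e\<close>.
\<close>

definition max_cone :: "('r \<Rightarrow> 'e) set \<Rightarrow> ('d \<Rightarrow>\<^sub>0 real) set" where
  "max_cone A = {y. keys y \<subseteq> D \<and>
     (\<forall>s\<in>A. \<forall>s'\<in>selectors. pairing (support s') y \<le> pairing (support s) y)}"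

definition coarse_fan :: "('d \<Rightarrow>\<^sub>0 real) set set" where
  "coarse_fan = {max_cone A | A. A \<subseteq> selectors \<and> A \<noteq> {}}"

lemma fine_fanE:
  assumes "\<sigma> \<in> fine_fan"
  obtains H s where "s \<in> selectors" "H \<subseteq> gens s" "\<sigma> = convex_cone hull (\<delta> ` H)"
  using assms unfolding fine_fan_def by blast

lemma coarse_fanE:
  assumes "\<sigma> \<in> coarse_fan"
  obtains A where "A \<subseteq> selectors" "A \<noteq> {}" "\<sigma> = max_cone A"
  using assms unfolding coarse_fan_def by blast

lemma finite_subset_E: "H \<subseteq> E \<Longrightarrow> finite H"
  using finite_E finite_subset by blast

lemma comb_extend:
  assumes "H \<subseteq> E"
  shows "comb (\<lambda>e. if e \<in> H then c e else 0) = (\<Sum>e\<in>H. c e *\<^sub>R \<delta> e)"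
proof -
  have "comb (\<lambda>e. if e \<in> H then c e else 0) = (\<Sum>e\<in>H. (if e \<in> H then c e else 0) *\<^sub>R \<delta> e)"
    unfolding comb_def using assms finite_E by (intro sum.mono_neutral_right) auto
  then show ?thesis by simp
qed

lemma hull_iff_comb:
  assumes H: "H \<subseteq> E"
  shows "v \<in> convex_cone hull (\<delta> ` H) \<longleftrightarrow>
    (\<exists>c. v = comb c \<and> (\<forall>e\<in>E. 0 \<le> c e) \<and> (\<forall>e\<in>E - H. c e = 0))"
proof
  assume "v \<in> convex_cone hull (\<delta> ` H)"
  then obtain c where c: "v = (\<Sum>e\<in>H. c e *\<^sub>R \<delta> e)" "\<forall>e\<in>H. 0 \<le> c e"
    unfolding convex_cone_hull_image[OF finite_subset_E[OF H]] by blast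
  then show "\<exists>c. v = comb c \<and> (\<forall>e\<in>E. 0 \<le> c e) \<and> (\<forall>e\<in>E - H. c e = 0)"
    using comb_extend[OF H, of c] by (intro exI[of _ "\<lambda>e. if e \<in> H then c e else 0"]) auto
next
  assume "\<exists>c. v = comb c \<and> (\<forall>e\<in>E. 0 \<le> c e) \<and> (\<forall>e\<in>E - H. c e = 0)"
  then obtain c where c: "v = comb c" "\<forall>e\<in>E. 0 \<le> c e" "\<forall>e\<in>E - H. c e = 0" by blast
  have "comb c = comb (\<lambda>e. if e \<in> H then c e else 0)" by (rule comb_cong) (use c(3) in auto)
  then have "v = (\<Sum>e\<in>H. c e *\<^sub>R \<delta> e)" using c(1) comb_extend[OF H] by simp
  then show "v \<in> convex_cone hull (\<delta> ` H)"
    unfolding convex_cone_hull_image[OF finite_subset_E[OF H]] using c(2) H by blast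
qed

lemma simplex_cone_iff:
  assumes s: "s \<in> selectors" and H: "H \<subseteq> gens s"
  shows "v \<in> convex_cone hull (\<delta> ` H) \<longleftrightarrow> keys v \<subseteq> D \<and>
    (\<forall>e\<in>E. 0 \<le> pairing (dual_char s e) v) \<and> (\<forall>e\<in>E - H. pairing (dual_char s e) v = 0)"
proof -
  have HE: "H \<subseteq> E" using H gens_subset by blast
  show ?thesis
    unfolding hull_iff_comb[OF HE]
  proof
    assume "\<exists>c. v = comb c \<and> (\<forall>e\<in>E. 0 \<le> c e) \<and> (\<forall>e\<in>E - H. c e = 0)"
    then obtain c where c: "v = comb c" "\<forall>e\<in>E. 0 \<le> c e" "\<forall>e\<in>E - H. c e = 0" by blast
    have "c (s r) = 0" if "r \<in> R" for r
      using c(3) H selector_mem[OF s that] that by (auto simp: gens_def)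
    then have "pairing (dual_char s e) v = c e" if "e \<in> E" for e
      unfolding c(1) by (intro dual_char_comb[OF s _ that])
    then show "keys v \<subseteq> D \<and> (\<forall>e\<in>E. 0 \<le> pairing (dual_char s e) v) \<and>
        (\<forall>e\<in>E - H. pairing (dual_char s e) v = 0)"
      using c keys_comb by auto
  next
    assume "keys v \<subseteq> D \<and> (\<forall>e\<in>E. 0 \<le> pairing (dual_char s e) v) \<and>
        (\<forall>e\<in>E - H. pairing (dual_char s e) v = 0)"
    then show "\<exists>c. v = comb c \<and> (\<forall>e\<in>E. 0 \<le> c e) \<and> (\<forall>e\<in>E - H. c e = 0)"
      using dual_char(3)[OF s, of v] by (intro exI[of _ "\<lambda>e. pairing (dual_char s e) v"]) auto
  qed
qed

text \<open>
  Writing the cone generated by \<open>H\<close> as a solution set of inequalities \<open>coord s i v \<le> 0\<close> makes the results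
  on faces of such sets available; the flag selects the sign.
\<close>

definition coord :: "('r \<Rightarrow> 'e) \<Rightarrow> 'e \<times> bool \<Rightarrow> ('d \<Rightarrow>\<^sub>0 real) \<Rightarrow> real" where
  "coord s i v = (if snd i then - pairing (dual_char s (fst i)) v else pairing (dual_char s (fst i)) v)"

lemma linear_coord: "linear (coord s i)"
  unfolding coord_def by (rule linearI) (auto simp: pairing_add_right pairing_scaleR_right)

lemma simplex_cone_polyhedron:
  assumes "s \<in> selectors" "H \<subseteq> gens s"
  shows "convex_cone hull (\<delta> ` H) =
    {v \<in> {v. keys v \<subseteq> D}. \<forall>i\<in>E \<times> {True} \<union> (E - H) \<times> {False}. coord s i v \<le> 0}"
proof (rule set_eqI)
  fix v
  have iff: "(\<forall>i\<in>E \<times> {True} \<union> (E - H) \<times> {False}. coord s i v \<le> 0) \<longleftrightarrow>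
      (\<forall>e\<in>E. 0 \<le> pairing (dual_char s e) v) \<and> (\<forall>e\<in>E - H. pairing (dual_char s e) v \<le> 0)"
    unfolding ball_Un coord_def by auto
  then show "v \<in> convex_cone hull (\<delta> ` H) \<longleftrightarrow>
      v \<in> {v \<in> {v. keys v \<subseteq> D}. \<forall>i\<in>E \<times> {True} \<union> (E - H) \<times> {False}. coord s i v \<le> 0}"
    unfolding simplex_cone_iff[OF assms] mem_Collect_eq iff by (auto simp: order_eq_iff)
qed

lemma simplex_face_of:
  assumes s: "s \<in> selectors" and H: "H \<subseteq> gens s" and H': "H' \<subseteq> H"
  shows "convex_cone hull (\<delta> ` H') face_of convex_cone hull (\<delta> ` H)"
proof -
  have HE: "H \<subseteq> E" using H gens_subset by blast
  have "{v \<in> convex_cone hull (\<delta> ` H). \<forall>i\<in>(H - H') \<times> {True}. coord s i v = 0} face_of convex_cone hull (\<delta> ` H)"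
    by (rule tight_face[OF subspace_keys linear_coord simplex_cone_polyhedron[OF s H]]) (use HE in auto)
  moreover have "{v \<in> convex_cone hull (\<delta> ` H). \<forall>i\<in>(H - H') \<times> {True}. coord s i v = 0} = convex_cone hull (\<delta> ` H')"
    unfolding set_eq_iff mem_Collect_eq simplex_cone_iff[OF s H] simplex_cone_iff[OF s order_trans[OF H' H]]
    using H' HE by (auto simp: coord_def)
  ultimately show ?thesis by simp
qed

lemma simplex_faces:
  assumes s: "s \<in> selectors" and H: "H \<subseteq> gens s" and \<tau>: "\<tau> face_of convex_cone hull (\<delta> ` H)" "\<tau> \<noteq> {}"
  shows "\<exists>H'\<subseteq>H. \<tau> = convex_cone hull (\<delta> ` H')"
proof -
  let ?K = "E \<times> {True} \<union> (E - H) \<times> {False}"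
  define H' where "H' = {e\<in>H. \<exists>w\<in>\<tau>. pairing (dual_char s e) w \<noteq> 0}"
  have HE: "H \<subseteq> E" "H' \<subseteq> H" using H gens_subset by (auto simp: H'_def)
  have \<tau>sub: "\<tau> \<subseteq> convex_cone hull (\<delta> ` H)" using \<tau>(1) by (rule face_of_imp_subset)
  have eq: "\<tau> = {v \<in> convex_cone hull (\<delta> ` H). \<forall>i\<in>?K. (\<forall>w\<in>\<tau>. coord s i w = 0) \<longrightarrow> coord s i v = 0}"
    using finite_E by (intro face_tight[OF subspace_keys linear_coord _ simplex_cone_polyhedron[OF s H] \<tau>]) auto
  have "\<tau> \<subseteq> convex_cone hull (\<delta> ` H')"
  proof
    fix v assume v: "v \<in> \<tau>"
    then have "v \<in> convex_cone hull (\<delta> ` H)" using \<tau>sub by blast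
    then show "v \<in> convex_cone hull (\<delta> ` H')"
      unfolding simplex_cone_iff[OF s H] simplex_cone_iff[OF s order_trans[OF HE(2) H]]
      using v by (auto simp: H'_def)
  qed
  moreover have "convex_cone hull (\<delta> ` H') \<subseteq> \<tau>"
  proof
    fix v assume v: "v \<in> convex_cone hull (\<delta> ` H')"
    then have vH: "v \<in> convex_cone hull (\<delta> ` H)"
      using hull_mono[OF image_mono[OF HE(2)], where S = convex_cone] by blast
    have zero: "pairing (dual_char s e) v = 0" if "e \<in> E" "\<forall>w\<in>\<tau>. pairing (dual_char s e) w = 0" for e
    proof -
      have "e \<notin> H'" using that by (auto simp: H'_def)
      then show ?thesis using v that(1) unfolding simplex_cone_iff[OF s order_trans[OF HE(2) H]] by blast
    qed
    have "coord s i v = 0" if "i \<in> ?K" "\<forall>w\<in>\<tau>. coord s i w = 0" for i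
      using zero[of "fst i"] that by (auto simp: coord_def split: if_splits)
    then show "v \<in> \<tau>" by (subst eq) (use vH in blast)
  qed
  ultimately show ?thesis using HE(2) by blast
qed

text \<open>
  A point of both cones has only one reduced representation, whose support then lies in \<open>H\<close> and
  in \<open>H'\<close>.
\<close>

lemma simplex_inter:
  assumes s: "s \<in> selectors" "H \<subseteq> gens s" and s': "s' \<in> selectors" "H' \<subseteq> gens s'"
  shows "convex_cone hull (\<delta> ` H) \<inter> convex_cone hull (\<delta> ` H') = convex_cone hull (\<delta> ` (H \<inter> H'))"
proof
  have HE: "H \<subseteq> E" "H' \<subseteq> E" "H \<inter> H' \<subseteq> E" using s s' gens_subset by blast+
  show "convex_cone hull (\<delta> ` (H \<inter> H')) \<subseteq> convex_cone hull (\<delta> ` H) \<inter> convex_cone hull (\<delta> ` H')"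
    using hull_mono[of "\<delta> ` (H \<inter> H')" "\<delta> ` H" convex_cone] hull_mono[of "\<delta> ` (H \<inter> H')" "\<delta> ` H'" convex_cone]
    by blast
  show "convex_cone hull (\<delta> ` H) \<inter> convex_cone hull (\<delta> ` H') \<subseteq> convex_cone hull (\<delta> ` (H \<inter> H'))"
  proof
    fix v assume "v \<in> convex_cone hull (\<delta> ` H) \<inter> convex_cone hull (\<delta> ` H')"
    then obtain c c' where c: "v = comb c" "\<forall>e\<in>E. 0 \<le> c e" "\<forall>e\<in>E - H. c e = 0"
      and c': "v = comb c'" "\<forall>e\<in>E. 0 \<le> c' e" "\<forall>e\<in>E - H'. c' e = 0"
      unfolding Int_iff hull_iff_comb[OF HE(1)] hull_iff_comb[OF HE(2)] by blast
    have "\<forall>r\<in>R. c (s r) = 0"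
      using c(3) s(2) selector_mem[OF s(1)] by (auto simp: gens_def)
    moreover have "\<forall>r\<in>R. c' (s' r) = 0"
      using c'(3) s'(2) selector_mem[OF s'(1)] by (auto simp: gens_def)
    ultimately have "c e = c' e" if "e \<in> E" for e
      using reduced_unique[OF _ c(2) c'(2) s(1) _ s'(1) _ that] c(1) c'(1) by simp
    then have "\<forall>e\<in>E - H \<inter> H'. c e = 0" using c(3) c'(3) by auto
    then show "v \<in> convex_cone hull (\<delta> ` (H \<inter> H'))"
      unfolding hull_iff_comb[OF HE(3)] using c by blast
  qed
qed

lemma simplex_strongly_convex:
  assumes s: "s \<in> selectors" "H \<subseteq> gens s"
  shows "strongly_convex (convex_cone hull (\<delta> ` H))"
  unfolding strongly_convex_def
proof
  show "{0} \<subseteq> convex_cone hull (\<delta> ` H) \<inter> uminus ` (convex_cone hull (\<delta> ` H))"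
    using convex_cone_hull_contains_0[of "\<delta> ` H"] by force
  show "convex_cone hull (\<delta> ` H) \<inter> uminus ` (convex_cone hull (\<delta> ` H)) \<subseteq> {0}"
  proof
    fix v assume "v \<in> convex_cone hull (\<delta> ` H) \<inter> uminus ` (convex_cone hull (\<delta> ` H))"
    then have v: "v \<in> convex_cone hull (\<delta> ` H)" "- v \<in> convex_cone hull (\<delta> ` H)" by auto
    then have "pairing (dual_char s e) v = 0" if "e \<in> E" for e
      using that unfolding simplex_cone_iff[OF s] by (fastforce simp: pairing_uminus_right)
    moreover have "v = comb (\<lambda>e. pairing (dual_char s e) v)"
      using v(1) unfolding simplex_cone_iff[OF s] by (intro dual_char(3)[OF s(1)]) blast
    ultimately show "v \<in> {0}" by (simp add: comb_def)
  qed
qed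

lemma rational_hull: "H \<subseteq> E \<Longrightarrow> rational_polyhedral_cone D (convex_cone hull (\<delta> ` H))"
  unfolding rational_polyhedral_cone_def
  using finite_subset_E \<delta>_lattice by (intro exI[of _ "\<delta> ` H"]) auto

lemma finite_fine_fan: "finite fine_fan"
proof -
  have "fine_fan \<subseteq> (\<lambda>H. convex_cone hull (\<delta> ` H)) ` Pow E"
    using gens_subset unfolding fine_fan_def by blast
  then show ?thesis using finite_E finite_subset by blast
qed

lemma fine_fanI: "s \<in> selectors \<Longrightarrow> H \<subseteq> gens s \<Longrightarrow> convex_cone hull (\<delta> ` H) \<in> fine_fan"
  unfolding fine_fan_def by blast

lemma is_fan_fine: "is_fan D fine_fan"
  unfolding is_fan_def
proof (intro conjI ballI allI impI finite_fine_fan; (elim conjE)?)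
  obtain s where "s \<in> selectors" using selectors_nonempty by blast
  then show "fine_fan \<noteq> {}" using fine_fanI[of s "{}"] by blast
next
  fix \<sigma> assume "\<sigma> \<in> fine_fan"
  then obtain H s where \<sigma>: "s \<in> selectors" "H \<subseteq> gens s" "\<sigma> = convex_cone hull (\<delta> ` H)" by (rule fine_fanE)
  show "rational_polyhedral_cone D \<sigma>"
    unfolding \<sigma>(3) using \<sigma>(2) gens_subset by (intro rational_hull) blast
  show "strongly_convex \<sigma>" unfolding \<sigma>(3) by (rule simplex_strongly_convex[OF \<sigma>(1,2)])
  show "\<tau> \<in> fine_fan" if "\<tau> face_of \<sigma>" "\<tau> \<noteq> {}" for \<tau>
    using simplex_faces[OF \<sigma>(1,2), of \<tau>] that fine_fanI[OF \<sigma>(1)] \<sigma>(2) unfolding \<sigma>(3) by blast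
  fix \<tau> assume "\<tau> \<in> fine_fan"
  then obtain H' s' where \<tau>: "s' \<in> selectors" "H' \<subseteq> gens s'" "\<tau> = convex_cone hull (\<delta> ` H')" by (rule fine_fanE)
  have eq: "\<sigma> \<inter> \<tau> = convex_cone hull (\<delta> ` (H \<inter> H'))"
    unfolding \<sigma>(3) \<tau>(3) by (rule simplex_inter[OF \<sigma>(1,2) \<tau>(1,2)])
  show "\<sigma> \<inter> \<tau> face_of \<sigma>" unfolding eq unfolding \<sigma>(3) by (rule simplex_face_of[OF \<sigma>(1,2)]) auto
  show "\<sigma> \<inter> \<tau> face_of \<tau>" unfolding eq unfolding \<tau>(3) by (rule simplex_face_of[OF \<tau>(1,2)]) auto
qed

text \<open>A face of a simplicial cone is cut out by the sum of the coordinates that vanish on it.\<close>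

lemma toric_fan_fine: "toric_fan D fine_fan"
proof (unfold_locales, rule is_fan_fine)
  fix \<sigma> \<tau> assume "\<sigma> \<in> fine_fan" "\<tau> \<in> fine_fan" and sub: "\<tau> \<subseteq> \<sigma>"
  then obtain H s H' s' where \<sigma>: "s \<in> selectors" "H \<subseteq> gens s" "\<sigma> = convex_cone hull (\<delta> ` H)"
    and \<tau>: "s' \<in> selectors" "H' \<subseteq> gens s'" "\<tau> = convex_cone hull (\<delta> ` H')" by (elim fine_fanE) blast
  have "\<tau> = \<sigma> \<inter> \<tau>" using sub by blast
  also have "\<dots> = convex_cone hull (\<delta> ` (H \<inter> H'))"
    unfolding \<sigma>(3) \<tau>(3) by (rule simplex_inter[OF \<sigma>(1,2) \<tau>(1,2)])
  finally have \<tau>_eq: "\<tau> = convex_cone hull (\<delta> ` (H \<inter> H'))" .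
  have HE: "H \<subseteq> E" using \<sigma>(2) gens_subset by blast
  let ?m = "\<Sum>e\<in>H - H'. dual_char s e"
  have pm: "pairing ?m v = (\<Sum>e\<in>H - H'. pairing (dual_char s e) v)" for v by (rule pairing_sum_left)
  have nonneg: "0 \<le> pairing (dual_char s e) v" if "v \<in> \<sigma>" "e \<in> E" for v e
    using that unfolding \<sigma>(3) simplex_cone_iff[OF \<sigma>(1,2)] by blast
  show "\<exists>m\<in>dual_monoid D \<sigma>. \<tau> = {v \<in> \<sigma>. pairing m v = 0}"
  proof (intro bexI[of _ ?m])
    have "keys ?m \<subseteq> D" by (intro keys_sum_subset dual_char(1)[OF \<sigma>(1)])
    moreover have "0 \<le> pairing ?m v" if "v \<in> \<sigma>" for v
      unfolding pm[of v] by (rule sum_nonneg) (use nonneg[OF that] HE in blast)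
    ultimately show "?m \<in> dual_monoid D \<sigma>" by (simp add: dual_monoid_def)
    have zero: "pairing ?m v = 0 \<longleftrightarrow> (\<forall>e\<in>H - H'. pairing (dual_char s e) v = 0)" if "v \<in> \<sigma>" for v
      unfolding pm using nonneg[OF that] HE finite_subset_E[OF HE] by (intro sum_nonneg_eq_0_iff) auto
    have "v \<in> \<tau> \<longleftrightarrow> v \<in> \<sigma> \<and> (\<forall>e\<in>H - H'. pairing (dual_char s e) v = 0)" for v
      unfolding \<tau>_eq unfolding \<sigma>(3) simplex_cone_iff[OF \<sigma>(1,2)]
        simplex_cone_iff[OF \<sigma>(1) order_trans[OF Int_lower1 \<sigma>(2)]] using HE by blast
    then show "\<tau> = {v \<in> \<sigma>. pairing ?m v = 0}" using zero by blast
  qed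
qed

lemma Union_fine_fan: "\<Union>fine_fan = {v. keys v \<subseteq> D}"
proof
  show "\<Union>fine_fan \<subseteq> {v. keys v \<subseteq> D}"
    using simplex_cone_iff unfolding fine_fan_def by blast
  show "{v. keys v \<subseteq> D} \<subseteq> \<Union>fine_fan"
  proof clarify
    fix v :: "'d \<Rightarrow>\<^sub>0 real" assume "keys v \<subseteq> D"
    then obtain c s where c: "v = comb c" "\<forall>e\<in>E. 0 \<le> c e" "s \<in> selectors" "\<forall>r\<in>R. c (s r) = 0"
      using reduced_representation by blast
    have "\<forall>e\<in>E - gens s. c e = 0" using c(4) by (auto simp: gens_def)
    then have "v \<in> convex_cone hull (\<delta> ` gens s)"
      unfolding hull_iff_comb[OF gens_subset] using c(1,2) by blast
    then show "v \<in> \<Union>fine_fan" using fine_fanI[OF c(3) order_refl] by blast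
  qed
qed

section \<open>The cones over the faces of the polytope\<close>

lemma coarse_fanI: "A \<subseteq> selectors \<Longrightarrow> A \<noteq> {} \<Longrightarrow> max_cone A \<in> coarse_fan"
  unfolding coarse_fan_def by blast

lemma max_cone_max:
  assumes "y \<in> max_cone A" "s \<in> A" "s' \<in> A" "A \<subseteq> selectors"
  shows "pairing (support s) y = pairing (support s') y"
  using assms unfolding max_cone_def by (auto intro!: antisym)

lemma max_cone_pos:
  assumes y: "y \<in> max_cone A" and s: "s \<in> A" and nz: "y \<noteq> 0"
  shows "0 < pairing (support s) y"
proof -
  have "keys y \<subseteq> D" using y by (simp add: max_cone_def)
  then obtain s0 where "s0 \<in> selectors" "0 < pairing (support s0) y"
    using support_max nz by metis
  moreover have "pairing (support s0) y \<le> pairing (support s) y"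
    using y s \<open>s0 \<in> selectors\<close> by (auto simp: max_cone_def)
  ultimately show ?thesis by simp
qed

lemma convex_cone_max_cone: "convex_cone (max_cone A)"
  unfolding convex_cone_iff max_cone_def
  by (auto simp: pairing_add_right pairing_scaleR_right keys_add_subset keys_scaleR_subset
      intro: add_mono mult_left_mono dest: subsetD[OF keys_add])

text \<open>
  In the reduced representation of a point of the cone, equality in \<open>support_le_1\<close> is forced for
  every edge with a positive coefficient.
\<close>

lemma max_cone_generators:
  assumes A: "A \<subseteq> selectors" "A \<noteq> {}"
  shows "max_cone A = convex_cone hull (\<delta> ` {e\<in>E. \<forall>s\<in>A. pairing (support s) (\<delta> e) = 1})" (is "_ = convex_cone hull (\<delta> ` ?H)")
proof
  have HE: "?H \<subseteq> E" by blast
  have "\<delta> e \<in> max_cone A" if "e \<in> ?H" for e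
    using that support_le_1 keys_\<delta> by (auto simp: max_cone_def)
  then show "convex_cone hull (\<delta> ` ?H) \<subseteq> max_cone A"
    using convex_cone_max_cone by (intro hull_minimal) auto
  show "max_cone A \<subseteq> convex_cone hull (\<delta> ` ?H)"
  proof
    fix y assume y: "y \<in> max_cone A"
    then have "keys y \<subseteq> D" by (simp add: max_cone_def)
    then obtain c s0 where c: "s0 \<in> selectors" "\<And>e. e \<in> E \<Longrightarrow> 0 \<le> c e" "y = comb c"
      "pairing (support s0) y = (\<Sum>e\<in>E. c e)"
      "\<And>s'. s' \<in> selectors \<Longrightarrow> pairing (support s') y \<le> pairing (support s0) y"
      by (rule support_max) blast
    have "c e = 0" if e: "e \<in> E - ?H" for e
    proof -
      obtain s where s: "s \<in> A" "pairing (support s) (\<delta> e) \<noteq> 1" using e by blast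
      have sS: "s \<in> selectors" using s(1) A by blast
      have "pairing (support s) y = pairing (support s0) y"
        using y s(1) c(1) c(5)[OF sS] by (auto simp: max_cone_def intro: antisym)
      then have "(\<Sum>e\<in>E. c e * pairing (support s) (\<delta> e)) = (\<Sum>e\<in>E. c e)"
        using c(4) by (simp add: c(3) pairing_comb)
      then have "(\<Sum>e\<in>E. c e * (1 - pairing (support s) (\<delta> e))) = 0"
        by (simp add: right_diff_distrib sum_subtractf)
      moreover have "\<forall>e\<in>E. 0 \<le> c e * (1 - pairing (support s) (\<delta> e))"
        using c(2) support_le_1[OF sS] by simp
      ultimately have "\<forall>e\<in>E. c e * (1 - pairing (support s) (\<delta> e)) = 0"
        using finite_E by (subst (asm) sum_nonneg_eq_0_iff) auto
      then show ?thesis using e s(2) by auto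
    qed
    then show "y \<in> convex_cone hull (\<delta> ` ?H)"
      unfolding hull_iff_comb[OF HE] using c(2,3) by blast
  qed
qed

lemma max_cone_polyhedron:
  assumes "A \<subseteq> selectors"
  shows "max_cone A = {v \<in> {v. keys v \<subseteq> D}.
    \<forall>i\<in>A \<times> selectors. pairing (support (snd i) - support (fst i)) v \<le> 0}"
  by (auto simp: max_cone_def pairing_diff_left)

lemma max_cone_Un: "max_cone A \<inter> max_cone B = max_cone (A \<union> B)"
  by (auto simp: max_cone_def)

lemma max_cone_subset_iff:
  assumes A: "A \<subseteq> selectors" "A \<noteq> {}" "A \<subseteq> B" "B \<subseteq> selectors"
  shows "max_cone B = {v \<in> max_cone A. \<forall>s\<in>A. \<forall>s'\<in>B. pairing (support s') v = pairing (support s) v}"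
proof
  show "max_cone B \<subseteq> {v \<in> max_cone A. \<forall>s\<in>A. \<forall>s'\<in>B. pairing (support s') v = pairing (support s) v}"
    using A max_cone_max[of _ B] unfolding max_cone_def by blast
  show "{v \<in> max_cone A. \<forall>s\<in>A. \<forall>s'\<in>B. pairing (support s') v = pairing (support s) v} \<subseteq> max_cone B"
  proof
    fix v assume v: "v \<in> {v \<in> max_cone A. \<forall>s\<in>A. \<forall>s'\<in>B. pairing (support s') v = pairing (support s) v}"
    obtain s where "s \<in> A" using A by blast
    then show "v \<in> max_cone B" using v unfolding max_cone_def by auto
  qed
qed

lemma max_cone_face_of:
  assumes A: "A \<subseteq> selectors" "A \<noteq> {}" "A \<subseteq> B" "B \<subseteq> selectors"
  shows "max_cone B face_of max_cone A"
proof -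
  have "{v \<in> max_cone A. \<forall>i\<in>A \<times> B. pairing (support (snd i) - support (fst i)) v = 0} face_of max_cone A"
    by (rule tight_face[OF subspace_keys linear_pairing max_cone_polyhedron[OF A(1)]]) (use A in auto)
  moreover have "{v \<in> max_cone A. \<forall>i\<in>A \<times> B. pairing (support (snd i) - support (fst i)) v = 0} = max_cone B"
    unfolding max_cone_subset_iff[OF A] by (auto simp: pairing_diff_left)
  ultimately show ?thesis by simp
qed

lemma max_cone_faces:
  assumes A: "A \<subseteq> selectors" "A \<noteq> {}" and \<tau>: "\<tau> face_of max_cone A" "\<tau> \<noteq> {}"
  shows "\<tau> \<in> coarse_fan"
proof -
  define B where "B = {s'\<in>selectors. \<forall>w\<in>\<tau>. \<forall>s\<in>A. pairing (support s') w = pairing (support s) w}"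
  have \<tau>sub: "\<tau> \<subseteq> max_cone A" using \<tau>(1) by (rule face_of_imp_subset)
  have const: "pairing (support s') w = pairing (support s) w" if "w \<in> \<tau>" "s \<in> A" "s' \<in> A" for w s s'
    by (rule max_cone_max[OF subsetD[OF \<tau>sub that(1)] that(3,2) A(1)])
  have AB: "A \<subseteq> B" using A(1) const unfolding B_def by blast
  have BS: "B \<subseteq> selectors" by (auto simp: B_def)
  let ?K = "A \<times> selectors"
  have eq: "\<tau> = {v \<in> max_cone A. \<forall>i\<in>?K. (\<forall>w\<in>\<tau>. pairing (support (snd i) - support (fst i)) w = 0) \<longrightarrow>
      pairing (support (snd i) - support (fst i)) v = 0}"
    using finite_selectors finite_subset[OF A(1)]
    by (intro face_tight[OF subspace_keys linear_pairing _ max_cone_polyhedron[OF A(1)] \<tau>]) auto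
  have "\<tau> \<subseteq> max_cone B"
    unfolding max_cone_subset_iff[OF A AB BS] using \<tau>sub by (auto simp: B_def)
  moreover have "max_cone B \<subseteq> \<tau>"
  proof
    fix v assume v: "v \<in> max_cone B"
    have "pairing (support s') v = pairing (support s) v"
      if "s \<in> A" "s' \<in> selectors" "\<forall>w\<in>\<tau>. pairing (support s') w = pairing (support s) w" for s s'
    proof -
      have "pairing (support s') w = pairing (support t) w" if "w \<in> \<tau>" "t \<in> A" for w t
        using \<open>\<forall>w\<in>\<tau>. pairing (support s') w = pairing (support s) w\<close> const[OF that \<open>s \<in> A\<close>] that(1) by simp
      then have "s' \<in> B" using that(2) unfolding B_def by blast
      then show ?thesis using v that(1) unfolding max_cone_subset_iff[OF A AB BS] by blast
    qed
    moreover have "v \<in> max_cone A" using v AB by (auto simp: max_cone_def)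
    ultimately show "v \<in> \<tau>" by (subst eq) (auto simp: pairing_diff_left)
  qed
  ultimately have "\<tau> = max_cone B" by blast
  then show ?thesis using coarse_fanI[OF BS] AB A(2) by blast
qed

text \<open>
  If all support functionals agree at \<open>y \<noteq> 0\<close>, they are all positive at \<open>y\<close>, but also one of them is
  positive at \<open>- y\<close>.
\<close>

lemma max_cone_selectors: "max_cone selectors = {0}"
proof -
  have "y = 0" if y: "y \<in> max_cone selectors" for y
  proof (rule ccontr)
    assume nz: "y \<noteq> 0"
    have "keys (- y) \<subseteq> D" using y by (simp add: max_cone_def)
    then obtain s where s: "s \<in> selectors" "0 < pairing (support s) (- y)"
      using support_max[of "- y"] nz by (metis neg_equal_0_iff_equal)
    moreover have "0 < pairing (support s) y" by (rule max_cone_pos[OF y s(1) nz])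
    ultimately show False by (simp add: pairing_uminus_right)
  qed
  moreover have "0 \<in> max_cone selectors" by (simp add: max_cone_def)
  ultimately show ?thesis by blast
qed

lemma is_fan_coarse: "is_fan D coarse_fan"
  unfolding is_fan_def
proof (intro conjI ballI allI impI; (elim conjE)?)
  have "coarse_fan \<subseteq> max_cone ` Pow selectors" unfolding coarse_fan_def by blast
  then show "finite coarse_fan" using finite_selectors finite_subset by blast
  show "coarse_fan \<noteq> {}" using coarse_fanI[OF order_refl selectors_nonempty] by blast
next
  fix \<sigma> assume "\<sigma> \<in> coarse_fan"
  then obtain A where A: "A \<subseteq> selectors" "A \<noteq> {}" "\<sigma> = max_cone A" by (rule coarse_fanE)
  show "rational_polyhedral_cone D \<sigma>"
    unfolding A(3) max_cone_generators[OF A(1,2)] by (rule rational_hull) blast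
  show "strongly_convex \<sigma>"
    unfolding strongly_convex_def A(3)
  proof
    show "{0} \<subseteq> max_cone A \<inter> uminus ` max_cone A" by (force simp: max_cone_def)
    show "max_cone A \<inter> uminus ` max_cone A \<subseteq> {0}"
    proof
      fix v assume "v \<in> max_cone A \<inter> uminus ` max_cone A"
      then have v: "v \<in> max_cone A" "- v \<in> max_cone A" by auto
      obtain s where "s \<in> A" using A(2) by blast
      then show "v \<in> {0}"
        using max_cone_pos[OF v(1), of s] max_cone_pos[OF v(2), of s]
        by (cases "v = 0") (auto simp: pairing_uminus_right)
    qed
  qed
  show "\<tau> \<in> coarse_fan" if "\<tau> face_of \<sigma>" "\<tau> \<noteq> {}" for \<tau>
    using max_cone_faces[OF A(1,2)] that unfolding A(3) .
  fix \<tau> assume "\<tau> \<in> coarse_fan"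
  then obtain B where B: "B \<subseteq> selectors" "B \<noteq> {}" "\<tau> = max_cone B" by (rule coarse_fanE)
  have U: "A \<subseteq> A \<union> B" "B \<subseteq> A \<union> B" "A \<union> B \<subseteq> selectors" using A B by blast+
  show "\<sigma> \<inter> \<tau> face_of \<sigma>" unfolding A(3) B(3) max_cone_Un by (rule max_cone_face_of[OF A(1,2) U(1,3)])
  show "\<sigma> \<inter> \<tau> face_of \<tau>" unfolding A(3) B(3) max_cone_Un by (rule max_cone_face_of[OF B(1,2) U(2,3)])
qed

lemma toric_fan_coarse: "toric_fan D coarse_fan"
proof (unfold_locales, rule is_fan_coarse)
  fix \<sigma> \<tau> assume "\<sigma> \<in> coarse_fan" "\<tau> \<in> coarse_fan" and sub: "\<tau> \<subseteq> \<sigma>"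
  then obtain A B where A: "A \<subseteq> selectors" "A \<noteq> {}" "\<sigma> = max_cone A"
    and B: "B \<subseteq> selectors" "B \<noteq> {}" "\<tau> = max_cone B" by (elim coarse_fanE) blast
  obtain s0 where s0: "s0 \<in> A" using A(2) by blast
  \<comment> \<open>On \<open>\<sigma>\<close> the functional of \<open>s0\<close> is the maximum, so this sum vanishes where those of \<open>B\<close> attain it too.\<close>
  let ?m = "\<Sum>s\<in>B. support s0 - support s"
  have finB: "finite B" using B(1) finite_selectors finite_subset by blast
  have pm: "pairing ?m v = (\<Sum>s\<in>B. pairing (support s0) v - pairing (support s) v)" for v
    by (simp add: pairing_sum_left pairing_diff_left)
  have nonneg: "0 \<le> pairing (support s0) v - pairing (support s) v" if "v \<in> \<sigma>" "s \<in> B" for v s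
    using that s0 B(1) by (auto simp: A(3) max_cone_def)
  show "\<exists>m\<in>dual_monoid D \<sigma>. \<tau> = {v \<in> \<sigma>. pairing m v = 0}"
  proof (intro bexI[of _ ?m])
    have "keys (support s0 - support s) \<subseteq> D" if "s \<in> B" for s
      using keys_support[of s0] keys_support[of s] keys_diff[of "support s0" "support s"] s0 that A(1) B(1) by blast
    then have "keys ?m \<subseteq> D" by (rule keys_sum_subset)
    moreover have "0 \<le> pairing ?m v" if "v \<in> \<sigma>" for v
      using pm[of v] sum_nonneg[of B, OF nonneg[OF that]] by simp
    ultimately show "?m \<in> dual_monoid D \<sigma>" by (simp add: dual_monoid_def)
    have zero: "pairing ?m v = 0 \<longleftrightarrow> (\<forall>s\<in>B. pairing (support s0) v - pairing (support s) v = 0)" if "v \<in> \<sigma>" for v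
      unfolding pm using nonneg[OF that] finB by (intro sum_nonneg_eq_0_iff) auto
    have "v \<in> \<tau> \<longleftrightarrow> (\<forall>s\<in>B. pairing (support s0) v - pairing (support s) v = 0)" if v: "v \<in> \<sigma>" for v
    proof
      assume v': "v \<in> \<tau>"
      show "\<forall>s\<in>B. pairing (support s0) v - pairing (support s) v = 0"
      proof
        fix s assume s: "s \<in> B"
        have "pairing (support s0) v \<le> pairing (support s) v"
          using v' s subsetD[OF A(1) s0] unfolding B(3) max_cone_def by blast
        then show "pairing (support s0) v - pairing (support s) v = 0" using nonneg[OF v s] by simp
      qed
    next
      assume eq: "\<forall>s\<in>B. pairing (support s0) v - pairing (support s) v = 0"
      then have "pairing (support s) v = pairing (support s0) v" if "s \<in> B" for s using that by simp
      moreover have "keys v \<subseteq> D" "\<forall>s'\<in>selectors. pairing (support s') v \<le> pairing (support s0) v"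
        using v s0 unfolding A(3) max_cone_def by blast+
      ultimately show "v \<in> \<tau>" unfolding B(3) max_cone_def by simp
    qed
    then show "\<tau> = {v \<in> \<sigma>. pairing ?m v = 0}" using zero sub by blast
  qed
qed

lemma Union_coarse_fan: "\<Union>coarse_fan = {v. keys v \<subseteq> D}"
proof
  show "\<Union>coarse_fan \<subseteq> {v. keys v \<subseteq> D}"
    unfolding coarse_fan_def max_cone_def by blast
  show "{v. keys v \<subseteq> D} \<subseteq> \<Union>coarse_fan"
  proof clarify
    fix v :: "'d \<Rightarrow>\<^sub>0 real" assume v: "keys v \<subseteq> D"
    then obtain s where s: "s \<in> selectors" "\<And>s'. s' \<in> selectors \<Longrightarrow> pairing (support s') v \<le> pairing (support s) v"
      by (rule support_max) blast
    then have "v \<in> max_cone {s}" using v by (simp add: max_cone_def)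
    then show "v \<in> \<Union>coarse_fan" using coarse_fanI[of "{s}"] s(1) by blast
  qed
qed

lemma fan_refinement_fine_coarse: "fan_refinement D fine_fan coarse_fan"
  unfolding fan_refinement_def
proof (intro conjI is_fan_fine is_fan_coarse ballI)
  show "\<Union>fine_fan = \<Union>coarse_fan" by (simp add: Union_fine_fan Union_coarse_fan)
  fix \<sigma> assume "\<sigma> \<in> fine_fan"
  then obtain H s where \<sigma>: "s \<in> selectors" "H \<subseteq> gens s" "\<sigma> = convex_cone hull (\<delta> ` H)" by (rule fine_fanE)
  have "\<delta> ` H \<subseteq> \<delta> ` {e\<in>E. \<forall>s'\<in>{s}. pairing (support s') (\<delta> e) = 1}"
    using support_gens[OF \<sigma>(1)] \<sigma>(2) gens_subset by blast
  then have "\<sigma> \<subseteq> max_cone {s}"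
    unfolding \<sigma>(3) using max_cone_generators[of "{s}"] \<sigma>(1) hull_mono[where S = convex_cone] by simp
  then show "\<exists>\<tau>\<in>coarse_fan. \<sigma> \<subseteq> \<tau>" using coarse_fanI[of "{s}"] \<sigma>(1) by blast
qed

abbreviation polytope :: "('d \<Rightarrow>\<^sub>0 real) set" where
  "polytope \<equiv> convex hull (\<delta> ` E)"

text \<open>The edges of a region of maximal rank sum up to zero, as it lies below no edge.\<close>

lemma zero_in_polytope: "0 \<in> polytope"
proof -
  obtain r where r: "r \<in> R" "\<And>r'. r' \<in> R \<Longrightarrow> rank r' \<le> rank r"
    using Max_in[of "rank ` R"] Max_ge[of "rank ` R"] finite_R R_nonempty
    by (metis (no_types, lifting) finite_imageI image_iff image_is_empty rev_image_eqI)
  let ?C = "edges_of r"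
  have C: "finite ?C" "?C \<noteq> {}" using finite_E two_edges[OF r(1)] by auto
  have none: "{e\<in>E. ll e = r} = {}"
  proof -
    have "ll e \<noteq> r" if "e \<in> E" for e
      using rank[OF that] r ur[OF that] by (metis leD)
    then show ?thesis by blast
  qed
  have "(\<Sum>e\<in>?C. (1 / real (card ?C)) *\<^sub>R \<delta> e) = (1 / real (card ?C)) *\<^sub>R (\<Sum>e\<in>?C. \<delta> e)"
    by (simp only: scaleR_sum_right)
  also have "\<dots> = 0" by (simp only: region_relation[OF r(1)] none sum.empty scaleR_zero_right)
  finally have "(\<Sum>e\<in>?C. (1 / real (card ?C)) *\<^sub>R \<delta> e) = 0" .
  moreover have "(\<Sum>e\<in>?C. (1 / real (card ?C)) *\<^sub>R \<delta> e) \<in> polytope"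
    using C by (intro convex_sum) (auto intro: hull_inc)
  ultimately show ?thesis by simp
qed

lemma comb_in_polytope:
  assumes c: "\<And>e. e \<in> E \<Longrightarrow> 0 \<le> c e" and le: "(\<Sum>e\<in>E. c e) \<le> 1"
  shows "comb c \<in> polytope"
proof -
  let ?p = "\<Sum>e\<in>E. c e"
  show ?thesis
  proof (cases "?p = 0")
    case True
    then have "c e = 0" if "e \<in> E" for e
      using c finite_E that by (subst (asm) sum_nonneg_eq_0_iff) auto
    then have "comb c = 0" by (simp add: comb_def)
    then show ?thesis using zero_in_polytope by simp
  next
    case False
    then have p: "0 < ?p" using c by (simp add: sum_nonneg order_less_le)
    have "(\<Sum>e\<in>E. (c e / ?p) *\<^sub>R \<delta> e) \<in> polytope"
      using finite_E c p by (intro convex_sum) (auto simp: hull_inc simp flip: sum_divide_distrib)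
    then have "?p *\<^sub>R (\<Sum>e\<in>E. (c e / ?p) *\<^sub>R \<delta> e) + (1 - ?p) *\<^sub>R 0 \<in> polytope"
      using zero_in_polytope p le by (intro convexD) auto
    then show ?thesis using p by (simp add: comb_def scaleR_sum_right)
  qed
qed

text \<open>
  The polytope is cut out by the support functionals: the coefficients of a reduced representation
  add up to the largest of their values.
\<close>

lemma polytope_iff:
  "v \<in> polytope \<longleftrightarrow> keys v \<subseteq> D \<and> (\<forall>s\<in>selectors. pairing (support s) v \<le> 1)"
proof
  assume v: "v \<in> polytope"
  have "convex {v. keys v \<subseteq> D \<and> (\<forall>s\<in>selectors. pairing (support s) v \<le> 1)}"
    unfolding convex_def
    by (auto simp: pairing_add_right pairing_scaleR_right intro!: convex_bound_le
        dest!: subsetD[OF keys_add] intro: subsetD[OF keys_scaleR_subset])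
  then have "polytope \<subseteq> {v. keys v \<subseteq> D \<and> (\<forall>s\<in>selectors. pairing (support s) v \<le> 1)}"
    using support_le_1 keys_\<delta> by (intro hull_minimal) auto
  then show "keys v \<subseteq> D \<and> (\<forall>s\<in>selectors. pairing (support s) v \<le> 1)" using v by blast
next
  assume v: "keys v \<subseteq> D \<and> (\<forall>s\<in>selectors. pairing (support s) v \<le> 1)"
  then have "keys v \<subseteq> D" by simp
  then obtain c s where c: "s \<in> selectors" "\<And>e. e \<in> E \<Longrightarrow> 0 \<le> c e" "v = comb c"
    "pairing (support s) v = (\<Sum>e\<in>E. c e)"
    by (rule support_max) blast
  have "(\<Sum>e\<in>E. c e) \<le> 1" using v c(1) unfolding c(4)[symmetric] by blast
  then show "v \<in> polytope" unfolding c(3) by (intro comb_in_polytope c(2))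
qed

lemma hull_facets_inter:
  assumes A: "A \<subseteq> selectors" "A \<noteq> {}"
  shows "convex_cone hull {v \<in> polytope. \<forall>s\<in>A. pairing (support s) v = 1} = max_cone A" (is "convex_cone hull ?F = _")
proof
  have "?F \<subseteq> max_cone A" using polytope_iff by (auto simp: max_cone_def)
  then show "convex_cone hull ?F \<subseteq> max_cone A"
    using convex_cone_max_cone by (rule hull_minimal)
  show "max_cone A \<subseteq> convex_cone hull ?F"
  proof
    fix y assume y: "y \<in> max_cone A"
    show "y \<in> convex_cone hull ?F"
    proof (cases "y = 0")
      case False
      obtain s where s: "s \<in> A" using A(2) by blast
      define t where "t = pairing (support s) y"
      have t: "0 < t" unfolding t_def by (rule max_cone_pos[OF y s False])
      have eq: "pairing (support s') y = t" if "s' \<in> A" for s'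
        unfolding t_def by (rule max_cone_max[OF y that s A(1)])
      have "pairing (support s') y \<le> t" if "s' \<in> selectors" for s'
        using y s that by (simp add: t_def max_cone_def)
      then have "(1 / t) *\<^sub>R y \<in> ?F"
        using y t eq keys_scaleR_subset[of y D "1 / t"]
        by (simp add: polytope_iff max_cone_def pairing_scaleR_right)
      then have "t *\<^sub>R ((1 / t) *\<^sub>R y) \<in> convex_cone hull ?F"
        using t by (intro convex_cone_hull_mul hull_inc) auto
      then show ?thesis using t by simp
    qed (simp add: convex_cone_hull_contains_0)
  qed
qed

lemma polytope_polyhedron:
  "polytope = {v \<in> {v. keys v \<subseteq> D}. \<forall>s\<in>selectors. pairing (support s) v \<le> 1}"
  using polytope_iff by blast

lemma face_fan_eq_coarse_fan:
  "{convex_cone hull F | F. F face_of polytope \<and> F \<noteq> polytope} = coarse_fan"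
proof
  show "{convex_cone hull F | F. F face_of polytope \<and> F \<noteq> polytope} \<subseteq> coarse_fan"
  proof clarify
    fix F assume F: "F face_of polytope" "F \<noteq> polytope"
    show "convex_cone hull F \<in> coarse_fan"
    proof (cases "F = {}")
      case True
      have "convex_cone hull F = {0}"
        unfolding True using convex_cone_hull_image[of "{}" \<delta>] by simp
      then show ?thesis using coarse_fanI[OF order_refl selectors_nonempty] max_cone_selectors by simp
    next
      case False
      define A where "A = {s\<in>selectors. \<forall>w\<in>F. pairing (support s) w = 1}"
      have "F = {v \<in> polytope. \<forall>s\<in>selectors. (\<forall>w\<in>F. pairing (support s) w = 1) \<longrightarrow> pairing (support s) v = 1}"
        by (rule face_tight[OF subspace_keys linear_pairing finite_selectors polytope_polyhedron F(1) False])
      then have eq: "F = {v \<in> polytope. \<forall>s\<in>A. pairing (support s) v = 1}" unfolding A_def by blast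
      then have "A \<noteq> {}" using F(2) by auto
      then have "convex_cone hull {v \<in> polytope. \<forall>s\<in>A. pairing (support s) v = 1} \<in> coarse_fan"
        using coarse_fanI[of A] by (subst hull_facets_inter) (auto simp: A_def)
      then show ?thesis unfolding eq[symmetric] .
    qed
  qed
  show "coarse_fan \<subseteq> {convex_cone hull F | F. F face_of polytope \<and> F \<noteq> polytope}"
  proof
    fix \<sigma> assume "\<sigma> \<in> coarse_fan"
    then obtain A where A: "A \<subseteq> selectors" "A \<noteq> {}" "\<sigma> = max_cone A" by (rule coarse_fanE)
    let ?F = "{v \<in> polytope. \<forall>s\<in>A. pairing (support s) v = 1}"
    have "?F face_of polytope"
      by (rule tight_face[OF subspace_keys linear_pairing polytope_polyhedron A(1)])
    moreover have "0 \<notin> ?F" using A(2) by auto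
    then have "?F \<noteq> polytope" using zero_in_polytope by blast
    ultimately show "\<sigma> \<in> {convex_cone hull F | F. F face_of polytope \<and> F \<noteq> polytope}"
      unfolding A(3) hull_facets_inter[OF A(1,2), symmetric] by blast
  qed
qed

section \<open>Smoothness\<close>

lemma smooth_fine_fan: "smooth_toric_variety D fine_fan"
  unfolding smooth_toric_variety_def
proof (intro ballI)
  fix \<sigma> x assume \<sigma>: "\<sigma> \<in> fine_fan" and x: "x \<in> affine_chart D \<sigma>"
  obtain H s where s: "s \<in> selectors" "H \<subseteq> gens s" "\<sigma> = convex_cone hull (\<delta> ` H)"
    using \<sigma> by (rule fine_fanE)
  \<comment> \<open>Additivity of the coefficients needs \<open>\<delta> e\<close> to be a lattice point, hence the value zero for \<open>e \<notin> E\<close>.\<close>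
  interpret smooth_cone D \<sigma> "gens s" H "dual_char s" "\<lambda>e m. if e \<in> E then \<lfloor>pairing m (\<delta> e)\<rfloor> else 0"
  proof
    show "finite (gens s)" using finite_subset_E gens_subset by blast
    show "H \<subseteq> gens s" by (rule s(2))
    show "keys (dual_char s e) \<subseteq> D" for e by (rule dual_char(1)[OF s(1)])
    show "(if e \<in> E then \<lfloor>pairing (m + m') (\<delta> e)\<rfloor> else 0) =
        (if e \<in> E then \<lfloor>pairing m (\<delta> e)\<rfloor> else 0) + (if e \<in> E then \<lfloor>pairing m' (\<delta> e)\<rfloor> else 0)" for e m m'
      using pairing_\<delta>_int[of e m] by (auto simp: pairing_add_left elim!: Ints_cases)
    show "(if e \<in> E then \<lfloor>pairing (dual_char s e') (\<delta> e)\<rfloor> else 0) = (if e = e' then 1 else 0)"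
      if "e \<in> gens s" "e' \<in> gens s" for e e'
      using that gens_subset[of s] dual_char_\<delta>[OF s(1), of e' e] by auto
    show "m = (\<Sum>e\<in>gens s. frag_cmul (if e \<in> E then \<lfloor>pairing m (\<delta> e)\<rfloor> else 0) (dual_char s e))"
      if m: "keys m \<subseteq> D" for m
    proof (rule poly_mapping_eqI)
      fix d
      show "lookup m d = lookup (\<Sum>e\<in>gens s. frag_cmul (if e \<in> E then \<lfloor>pairing m (\<delta> e)\<rfloor> else 0) (dual_char s e)) d"
      proof (cases "d \<in> D")
        case True
        let ?b = "Poly_Mapping.single d (1::real)"
        have "real_of_int (lookup m d) = pairing m ?b" by (simp add: pairing_single_right)
        also have "?b = comb (\<lambda>e. pairing (dual_char s e) ?b)"
          by (rule dual_char(3)[OF s(1)]) (use True in simp)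
        also have "pairing m \<dots> = (\<Sum>e\<in>E. real_of_int (lookup (dual_char s e) d) * pairing m (\<delta> e))"
          unfolding pairing_comb by (simp add: pairing_single_right)
        also have "\<dots> = (\<Sum>e\<in>gens s. real_of_int (lookup (dual_char s e) d) * pairing m (\<delta> e))"
          using finite_E gens_subset dual_char_outside[OF s(1)] by (intro sum.mono_neutral_right) auto
        also have "\<dots> = (\<Sum>e\<in>gens s. real_of_int (\<lfloor>pairing m (\<delta> e)\<rfloor> * lookup (dual_char s e) d))"
        proof (rule sum.cong)
          fix e assume "e \<in> gens s"
          then have "pairing m (\<delta> e) \<in> \<int>" using gens_subset pairing_\<delta>_int by blast
          then show "real_of_int (lookup (dual_char s e) d) * pairing m (\<delta> e) =
              real_of_int (\<lfloor>pairing m (\<delta> e)\<rfloor> * lookup (dual_char s e) d)"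
            by (auto elim!: Ints_cases)
        qed simp
        finally have "lookup m d = (\<Sum>e\<in>gens s. \<lfloor>pairing m (\<delta> e)\<rfloor> * lookup (dual_char s e) d)"
          by (simp only: flip: of_int_sum)
        also have "\<dots> = (\<Sum>e\<in>gens s. (if e \<in> E then \<lfloor>pairing m (\<delta> e)\<rfloor> else 0) * lookup (dual_char s e) d)"
          using gens_subset[of s] by (intro sum.cong) auto
        finally show ?thesis by (simp add: lookup_sum)
      next
        case False
        then have "lookup (dual_char s e) d = 0" for e
          using dual_char(1)[OF s(1), of e] by (auto simp: in_keys_iff)
        moreover have "lookup m d = 0" using False m by (auto simp: in_keys_iff)
        ultimately show ?thesis by (simp add: lookup_sum)
      qed
    qed
    show "dual_monoid D \<sigma> = {m. keys m \<subseteq> D \<and> (\<forall>e\<in>H. 0 \<le> (if e \<in> E then \<lfloor>pairing m (\<delta> e)\<rfloor> else 0))}"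
      unfolding s(3) set_eq_iff mem_Collect_eq dual_monoid_hull using s(2) gens_subset[of s] by auto
  qed
  interpret smooth_cone_point D \<sigma> "gens s" H "dual_char s" "\<lambda>e m. if e \<in> E then \<lfloor>pairing m (\<delta> e)\<rfloor> else 0" x
    by unfold_locales (rule x)
  show "nonsingular_at (coordinate_ring D \<sigma>) x" by (rule nonsingular)
qed

text \<open>
  If a coordinate of a point of the chart vanishes, then some basis character \<open>dual_char s e\<close> with
  \<open>e \<in> H\<close> vanishes, since a multiple of their sum dominates every element of the dual monoid. Then
  every character that is positive on \<open>\<delta> e\<close> vanishes, being divisible by \<open>dual_char s e\<close>.
\<close>

lemma vanishing_generator:
  assumes s: "s \<in> selectors" and H: "H \<subseteq> gens s" and \<sigma>: "\<sigma> = convex_cone hull (\<delta> ` H)"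
    and x: "x \<in> affine_chart D \<sigma>" and m: "m \<in> dual_monoid D \<sigma>" "x m = 0"
  shows "\<exists>e\<in>H. \<forall>q\<in>dual_monoid D \<sigma>. x q \<noteq> 0 \<longrightarrow> pairing q (\<delta> e) = 0"
proof -
  have HE: "H \<subseteq> E" using H gens_subset by blast
  have finH: "finite H" by (rule finite_subset_E[OF HE])
  have dual: "q \<in> dual_monoid D \<sigma> \<longleftrightarrow> keys q \<subseteq> D \<and> (\<forall>e\<in>H. 0 \<le> pairing q (\<delta> e))" for q
    by (simp add: \<sigma> dual_monoid_hull)
  have basis: "dual_char s e \<in> dual_monoid D \<sigma>" if e: "e \<in> H" for e
  proof -
    have "0 \<le> pairing (dual_char s e) (\<delta> e')" if "e' \<in> H" for e'
      using dual_char_\<delta>[OF s subsetD[OF HE e] subsetD[OF H that]] by simp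
    then show ?thesis using dual_char(1)[OF s] by (simp add: dual)
  qed
  have "\<exists>e\<in>H. x (dual_char s e) = 0"
  proof (rule ccontr)
    assume "\<not> (\<exists>e\<in>H. x (dual_char s e) = 0)"
    then have nz: "x (dual_char s e) \<noteq> 0" if "e \<in> H" for e using that by blast
    have W: "(\<Sum>e\<in>M. dual_char s e) \<in> dual_monoid D \<sigma> \<and> x (\<Sum>e\<in>M. dual_char s e) \<noteq> 0"
      if "finite M" "M \<subseteq> H" for M
      using that
    proof (induction M)
      case empty
      then show ?case using chart_zero[OF x] by simp
    next
      case (insert e M)
      then show ?case
        using nz[of e] basis[of e] chart_add[OF x] dual_monoid_add by auto
    qed
    define w where "w = (\<Sum>e\<in>H. dual_char s e)"
    have w: "w \<in> dual_monoid D \<sigma>" "x w \<noteq> 0" using W[OF finH order_refl] by (auto simp: w_def)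
    have pw: "pairing w (\<delta> e) = 1" if e: "e \<in> H" for e
    proof -
      have "pairing w (\<delta> e) = (\<Sum>e'\<in>H. if e' = e then 1 else 0)"
        unfolding w_def pairing_sum_left
        by (intro sum.cong refl dual_char_\<delta>[OF s]) (use e HE H in auto)
      then show ?thesis using finH e by simp
    qed
    define N where "N = nat \<lceil>\<Sum>e\<in>H. pairing m (\<delta> e)\<rceil>"
    have nonneg: "0 \<le> pairing m (\<delta> e)" if "e \<in> H" for e using m(1) that by (simp add: dual)
    have N: "pairing m (\<delta> e) \<le> real N" if e: "e \<in> H" for e
    proof -
      have "pairing m (\<delta> e) \<le> (\<Sum>e\<in>H. pairing m (\<delta> e))"
        using e finH nonneg by (intro member_le_sum) auto
      then show ?thesis unfolding N_def by linarith
    qed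
    have "keys (frag_cmul (int N) w - m) \<subseteq> D"
      using keys_diff[of "frag_cmul (int N) w" m] keys_cmul[of "int N" w] w(1) m(1) by (auto simp: dual)
    moreover have "0 \<le> pairing (frag_cmul (int N) w - m) (\<delta> e)" if "e \<in> H" for e
      using N[OF that] pw[OF that] by (simp add: pairing_diff_left pairing_cmul_left)
    ultimately have d: "frag_cmul (int N) w - m \<in> dual_monoid D \<sigma>" by (simp add: dual)
    have "x w ^ N = x (m + (frag_cmul (int N) w - m))" using chart_cmul[OF x w(1)] by simp
    also have "\<dots> = 0" using chart_add[OF x m(1) d] m(2) by simp
    finally show False using w(2) by simp
  qed
  then obtain e where e: "e \<in> H" "x (dual_char s e) = 0" by blast
  have "pairing q (\<delta> e) = 0" if q: "q \<in> dual_monoid D \<sigma>" "x q \<noteq> 0" for q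
  proof (rule ccontr)
    assume nz: "pairing q (\<delta> e) \<noteq> 0"
    have eE: "e \<in> E" "e \<in> gens s" using e(1) HE H by auto
    have "0 \<le> pairing q (\<delta> e)" using q(1) e(1) by (simp add: dual)
    then have ge1: "1 \<le> pairing q (\<delta> e)"
      using nz pairing_\<delta>_int[OF eE(1), of q] by (auto elim!: Ints_cases)
    have "keys (q - dual_char s e) \<subseteq> D"
      using keys_diff[of q "dual_char s e"] q(1) dual_char(1)[OF s, of e] by (auto simp: dual)
    moreover have "0 \<le> pairing (q - dual_char s e) (\<delta> e')" if e': "e' \<in> H" for e'
      using q(1) e' ge1 dual_char_\<delta>[OF s eE(1), of e'] H by (auto simp: dual pairing_diff_left)
    ultimately have d: "q - dual_char s e \<in> dual_monoid D \<sigma>" by (simp add: dual)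
    have "x q = x ((q - dual_char s e) + dual_char s e)" by simp
    also have "\<dots> = 0" using chart_add[OF x d basis[OF e(1)]] e(2) by simp
    finally show False using q(2) by simp
  qed
  then show ?thesis using e(1) by blast
qed

end

section \<open>Small refinements from exposed edges\<close>

locale exposed_edge_regions = edge_regions +
  assumes exposed_edge: "e \<in> E \<Longrightarrow> \<exists>\<phi>. linear \<phi> \<and> \<phi> (\<delta> e) = (1::real) \<and> (\<forall>e'\<in>E - {e}. \<phi> (\<delta> e') < 1)"
begin

text \<open>By exposedness \<open>\<delta> e\<close> is the only point of the polytope where \<open>\<phi>\<close> attains its maximum, hence a vertex.\<close>

lemma ray_in_coarse_fan:
  assumes e: "e \<in> E"
  shows "convex_cone hull {\<delta> e} \<in> coarse_fan"
proof -
  obtain \<phi> where \<phi>: "linear \<phi>" "\<phi> (\<delta> e) = (1::real)" "\<And>e'. e' \<in> E \<Longrightarrow> e' \<noteq> e \<Longrightarrow> \<phi> (\<delta> e') < 1"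
    using exposed_edge[OF e] by blast
  have max: "\<phi> v \<le> 1 \<and> (\<phi> v = 1 \<longrightarrow> v = \<delta> e)" if v: "v \<in> polytope" for v
  proof -
    have "keys v \<subseteq> D" using v polytope_iff by blast
    then obtain c s where c: "s \<in> selectors" "\<And>e. e \<in> E \<Longrightarrow> 0 \<le> c e" "v = comb c"
      "pairing (support s) v = (\<Sum>e\<in>E. c e)"
      by (rule support_max) blast
    have le: "(\<Sum>e\<in>E. c e) \<le> 1" using c(1,4) v polytope_iff by metis
    have \<phi>v: "\<phi> v = (\<Sum>e'\<in>E. c e' * \<phi> (\<delta> e'))"
      unfolding c(3) comb_def using \<phi>(1) by (simp add: linear_sum linear_scale)
    have term_le: "c e' * \<phi> (\<delta> e') \<le> c e'" if "e' \<in> E" for e'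
      using c(2)[OF that] \<phi>(2) \<phi>(3)[OF that] by (cases "e' = e") (auto intro: mult_left_le)
    have sum_le: "\<phi> v \<le> (\<Sum>e\<in>E. c e)" unfolding \<phi>v using term_le by (rule sum_mono)
    have "v = \<delta> e" if one: "\<phi> v = 1"
    proof -
      have "(\<Sum>e'\<in>E. c e' - c e' * \<phi> (\<delta> e')) = 0"
        using sum_le le one by (simp add: sum_subtractf flip: \<phi>v)
      then have "\<forall>e'\<in>E. c e' - c e' * \<phi> (\<delta> e') = 0"
        using finite_E term_le by (subst (asm) sum_nonneg_eq_0_iff) auto
      then have zero: "c e' = 0" if "e' \<in> E" "e' \<noteq> e" for e' using \<phi>(3) that by force
      have "\<phi> v = (\<Sum>e'\<in>E. if e' = e then c e else 0)"
        unfolding \<phi>v using zero \<phi>(2) by (intro sum.cong) auto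
      then have "c e = 1" using one finite_E e by simp
      then have "comb c = comb (\<lambda>e'. if e' = e then 1 else 0)" using zero by (intro comb_cong) auto
      then show ?thesis using c(3) comb_indicator[OF e] by simp
    qed
    then show ?thesis using sum_le le by auto
  qed
  have "{\<delta> e} face_of polytope"
    unfolding face_of_def
  proof (intro conjI ballI impI)
    show "{\<delta> e} \<subseteq> polytope" using e by (auto intro: hull_inc)
    fix a b y assume a: "a \<in> polytope" and b: "b \<in> polytope" and y: "y \<in> {\<delta> e}" "y \<in> open_segment a b"
    obtain u where u: "0 < u" "u < 1" "y = (1 - u) *\<^sub>R a + u *\<^sub>R b" using y(2) by (auto simp: in_segment)
    have "\<phi> y = (1 - u) * \<phi> a + u * \<phi> b"
      unfolding u(3) using \<phi>(1) by (simp add: linear_add linear_scale)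
    then have eq: "(1 - u) * (1 - \<phi> a) + u * (1 - \<phi> b) = 0"
      using \<phi>(2) y(1) by (simp add: algebra_simps)
    have "0 \<le> (1 - u) * (1 - \<phi> a)" "0 \<le> u * (1 - \<phi> b)" using max[OF a] max[OF b] u by auto
    then have "(1 - u) * (1 - \<phi> a) = 0" "u * (1 - \<phi> b) = 0" using eq by linarith+
    then have "\<phi> a = 1" "\<phi> b = 1" using u by auto
    then show "a \<in> {\<delta> e}" "b \<in> {\<delta> e}" using max[OF a] max[OF b] by auto
  qed auto
  moreover have "{\<delta> e} \<noteq> polytope"
    using zero_in_polytope \<phi>(1,2) linear_0[OF \<phi>(1)] by (metis singletonD zero_neq_one)
  ultimately show ?thesis using face_fan_eq_coarse_fan by blast
qed

lemma small_refinement_fine_coarse: "small_refinement D fine_fan coarse_fan (\<delta> ` E)"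
proof -
  interpret fine: toric_fan D fine_fan by (rule toric_fan_fine)
  interpret coarse: toric_fan D coarse_fan by (rule toric_fan_coarse)
  obtain s0 where s0: "s0 \<in> selectors" using selectors_nonempty by blast
  have zero: "{0} = convex_cone hull (\<delta> ` {})"
    using convex_cone_hull_image[of "{}" \<delta>] by simp
  show ?thesis
  proof unfold_locales
    show "\<exists>\<sigma>\<in>coarse_fan. \<sigma>' \<subseteq> \<sigma>" if "\<sigma>' \<in> fine_fan" for \<sigma>'
      using fan_refinement_fine_coarse that by (simp add: fan_refinement_def)
    show "{0} \<in> fine_fan" unfolding zero by (rule fine_fanI[OF s0]) simp
    show "{0} \<in> coarse_fan" using coarse_fanI[OF order_refl selectors_nonempty] max_cone_selectors by simp
    show "finite (\<delta> ` E)" using finite_E by simp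
    show "v \<in> lattice_points D" if "v \<in> \<delta> ` E" for v using that \<delta>_lattice by blast
    show "v \<noteq> 0" if v: "v \<in> \<delta> ` E" for v
    proof -
      obtain e where e: "e \<in> E" "v = \<delta> e" using v by blast
      then show ?thesis using exposed_edge[OF e(1)] linear_0 by force
    qed
    show "convex_cone hull {v} \<in> fine_fan" if v: "v \<in> \<delta> ` E" for v
    proof -
      obtain e where e: "e \<in> E" "v = \<delta> e" using v by blast
      obtain s where "s \<in> selectors" "e \<notin> s ` R" using selector_avoiding by blast
      then show ?thesis using fine_fanI[of s "{e}"] e by (simp add: gens_def)
    qed
    show "convex_cone hull {v} \<in> coarse_fan" if v: "v \<in> \<delta> ` E" for v
      using v ray_in_coarse_fan by blast
    fix \<sigma> x m
    assume \<sigma>: "\<sigma> \<in> fine_fan" and x: "x \<in> affine_chart D \<sigma>" and m: "m \<in> dual_monoid D \<sigma>" "x m = 0"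
    obtain H s where s: "s \<in> selectors" "H \<subseteq> gens s" "\<sigma> = convex_cone hull (\<delta> ` H)"
      using \<sigma> by (rule fine_fanE)
    obtain e where e: "e \<in> H" "\<forall>q\<in>dual_monoid D \<sigma>. x q \<noteq> 0 \<longrightarrow> pairing q (\<delta> e) = 0"
      using vanishing_generator[OF s x m] by blast
    have "convex_cone hull {\<delta> e} \<subseteq> \<sigma>"
      unfolding s(3) by (rule hull_mono) (use e(1) in auto)
    moreover have "\<delta> e \<in> \<delta> ` E" using e(1) s(2) gens_subset by blast
    ultimately show "\<exists>v\<in>\<delta> ` E. convex_cone hull {v} \<subseteq> \<sigma> \<and>
        (\<forall>q\<in>dual_monoid D \<sigma>. x q \<noteq> 0 \<longrightarrow> pairing q v = 0)"
      using e(2) by blast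
  qed
qed

theorem small_desingularization:
  "fan_refinement D fine_fan coarse_fan \<and> smooth_toric_variety D fine_fan \<and>
   contracts_no_divisor (zariski D fine_fan) (zariski D coarse_fan) (toric_morphism D coarse_fan)"
  using fan_refinement_fine_coarse smooth_fine_fan small_refinement.contracts_no_divisor[OF small_refinement_fine_coarse]
  by blast

end

section \<open>The vertices and edges of the ladder graph\<close>

locale ladder =
  fixes l :: nat and k :: "nat \<Rightarrow> nat"
  assumes l: "l \<ge> 1" and k: "\<forall>i\<in>{1..l+1}. k i > 0"
begin

abbreviation p :: "nat \<Rightarrow> nat" where "p \<equiv> psum k"
abbreviation n :: nat where "n \<equiv> p (Suc l)"
abbreviation D :: "vertex set" where "D \<equiv> dots l k"
abbreviation V :: "vertex set" where "V \<equiv> graph_vertices l k"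
abbreviation E :: "edge set" where "E \<equiv> graph_edges l k"

lemma p_0 [simp]: "p 0 = 0"
  by (simp add: psum_def)

lemma p_Suc: "p (Suc i) = p i + k (Suc i)"
  by (simp add: psum_def)

lemma p_mono: "i \<le> j \<Longrightarrow> p i \<le> p j"
  unfolding psum_def by (rule sum_mono2) auto

lemma p_Suc_less: "i \<le> l \<Longrightarrow> p i < p (Suc i)"
  using k by (simp add: p_Suc)

lemma p_less_iff:
  assumes "i \<le> Suc l" "j \<le> Suc l"
  shows "p i < p j \<longleftrightarrow> i < j"
proof
  assume "i < j"
  then have "p i < p (Suc i)" using assms by (intro p_Suc_less) simp
  also have "\<dots> \<le> p j" using \<open>i < j\<close> by (intro p_mono) simp
  finally show "p i < p j" .
next
  assume "p i < p j"
  then show "i < j" using p_mono[of j i] by (meson leD le_less_linear)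
qed

lemma p_le_n: "i \<le> Suc l \<Longrightarrow> p i \<le> n"
  by (rule p_mono)

text \<open>
  With no lower bound for \<open>a\<close> in terms of \<open>i\<close> the description shows that the dots form a Young
  diagram.
\<close>

lemma dots_iff: "(a, c) \<in> D \<longleftrightarrow> 1 \<le> a \<and> 1 \<le> c \<and> (\<exists>i\<le>Suc l. a \<le> p i \<and> c + p i \<le> n)"
proof
  assume "(a, c) \<in> D"
  then obtain i where i: "1 \<le> i" "i \<le> Suc l" "p (i - 1) < a" "a \<le> p i" "1 \<le> c" "c \<le> n - p i"
    by (auto simp: dots_def)
  moreover have "p i \<le> n" using i by (intro p_le_n) simp
  ultimately show "1 \<le> a \<and> 1 \<le> c \<and> (\<exists>i\<le>Suc l. a \<le> p i \<and> c + p i \<le> n)"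
    by (intro conjI exI[of _ i]) auto
next
  assume *: "1 \<le> a \<and> 1 \<le> c \<and> (\<exists>i\<le>Suc l. a \<le> p i \<and> c + p i \<le> n)"
  then obtain i where i: "i \<le> Suc l" "a \<le> p i" "c + p i \<le> n" by blast
  define j where "j = (LEAST j. a \<le> p j)"
  have j: "a \<le> p j" "j \<le> i" unfolding j_def using i(2) by (auto intro: LeastI Least_le)
  have j0: "j \<noteq> 0" using j(1) * by (cases j) auto
  then have "\<not> a \<le> p (j - 1)" unfolding j_def by (intro not_less_Least) simp
  moreover have "c \<le> n - p j" using i(3) p_mono[OF j(2)] by simp
  ultimately show "(a, c) \<in> D"
    using * j j0 i(1) by (auto simp: dots_def intro!: bexI[of _ j])
qed

lemma dots_down: "(a, c) \<in> D \<Longrightarrow> 1 \<le> a' \<Longrightarrow> a' \<le> a \<Longrightarrow> 1 \<le> c' \<Longrightarrow> c' \<le> c \<Longrightarrow> (a', c') \<in> D"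
  unfolding dots_iff by (meson add_le_mono1 le_trans)

definition is_star :: "nat \<Rightarrow> nat \<Rightarrow> nat \<Rightarrow> bool" where
  "is_star i a c \<longleftrightarrow> i \<in> {1..Suc l} \<and> a = Suc (p (i - 1)) \<and> c + p i = Suc n"

lemma star_eq: "i \<in> {1..Suc l} \<Longrightarrow> star l k i = (a, c) \<longleftrightarrow> is_star i a c"
  using p_le_n[of i] by (auto simp: star_def is_star_def)

lemma V_iff: "(a, c) \<in> V \<longleftrightarrow> (a, c) \<in> D \<or> (\<exists>i. is_star i a c)"
proof -
  have "(a, c) \<in> star l k ` {1..l+1} \<longleftrightarrow> (\<exists>i. is_star i a c)"
  proof
    assume "(a, c) \<in> star l k ` {1..l+1}"
    then obtain i where "i \<in> {1..Suc l}" "star l k i = (a, c)" by auto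
    then show "\<exists>i. is_star i a c" using star_eq by blast
  next
    assume "\<exists>i. is_star i a c"
    then obtain i where i: "is_star i a c" by blast
    then have "i \<in> {1..Suc l}" by (simp add: is_star_def)
    then show "(a, c) \<in> star l k ` {1..l+1}"
      using star_eq[of i a c] i by (intro image_eqI[of _ _ i]) simp_all
  qed
  then show ?thesis by (auto simp: graph_vertices_def)
qed

lemma dots_V: "q \<in> D \<Longrightarrow> q \<in> V"
  by (simp add: graph_vertices_def)

lemma V_ge_1: "(a, c) \<in> V \<Longrightarrow> 1 \<le> a \<and> 1 \<le> c"
  using p_le_n by (fastforce simp: V_iff dots_iff is_star_def)

lemma V_left:
  assumes "(Suc a, c) \<in> V" "1 \<le> a"
  shows "(a, c) \<in> D"
proof -
  from assms(1) consider (dot) "(Suc a, c) \<in> D" | (star) i where "is_star i (Suc a) c" by (auto simp: V_iff)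
  then show ?thesis
  proof cases
    case dot
    moreover have "1 \<le> c" using V_ge_1[OF assms(1)] by simp
    ultimately show ?thesis using dots_down[of "Suc a" c a c] assms(2) by simp
  next
    case star
    then have i: "1 \<le> i" "i \<le> Suc l" "a = p (i - 1)" "c + p i = Suc n" by (auto simp: is_star_def)
    then have "p (i - 1) < p i" using p_less_iff[of "i - 1" i] by auto
    then show ?thesis using i assms V_ge_1[OF assms(1)] by (auto simp: dots_iff intro!: exI[of _ "i - 1"])
  qed
qed

lemma V_down:
  assumes "(a, Suc c) \<in> V" "1 \<le> c"
  shows "(a, c) \<in> D"
proof -
  from assms(1) consider (dot) "(a, Suc c) \<in> D" | (star) i where "is_star i a (Suc c)" by (auto simp: V_iff)
  then show ?thesis
  proof cases
    case dot
    moreover have "1 \<le> a" using V_ge_1[OF assms(1)] by simp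
    ultimately show ?thesis using dots_down[of a "Suc c" a c] assms(2) by simp
  next
    case star
    then have i: "1 \<le> i" "i \<le> Suc l" "a = Suc (p (i - 1))" "c + p i = n" by (auto simp: is_star_def)
    then have "p (i - 1) < p i" using p_less_iff[of "i - 1" i] by auto
    then show ?thesis using i assms by (auto simp: dots_iff intro!: exI[of _ i])
  qed
qed

abbreviation hedge :: "nat \<Rightarrow> nat \<Rightarrow> edge" where "hedge a c \<equiv> ((a, c), (Suc a, c))"
abbreviation vedge :: "nat \<Rightarrow> nat \<Rightarrow> edge" where "vedge a c \<equiv> ((a, Suc c), (a, c))"

lemma hedge_iff: "hedge a c \<in> E \<longleftrightarrow> (a, c) \<in> D \<and> (Suc a, c) \<in> V"
  using V_left[of a c] dots_V[of "(a, c)"] V_ge_1[of a c] by (auto simp: graph_edges_def)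

lemma vedge_iff: "vedge a c \<in> E \<longleftrightarrow> (a, c) \<in> D \<and> (a, Suc c) \<in> V"
  using V_down[of a c] dots_V[of "(a, c)"] V_ge_1[of a c] by (auto simp: graph_edges_def)

lemma edge_cases:
  assumes "e \<in> E"
  obtains (h) a c where "e = hedge a c" "(a, c) \<in> D" "(Suc a, c) \<in> V"
    | (v) a c where "e = vedge a c" "(a, c) \<in> D" "(a, Suc c) \<in> V"
proof -
  obtain a c a' c' where e: "e = ((a, c), (a', c'))" by (metis surj_pair)
  then consider "a' = Suc a" "c' = c" | "a' = a" "c = Suc c'"
    using assms by (auto simp: graph_edges_def)
  then show thesis
  proof cases
    case 1
    then show thesis using h[of a c] hedge_iff assms e by auto
  next
    case 2
    then show thesis using v[of a c'] vedge_iff assms e by auto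
  qed
qed

lemma dots_le_n: "(a, c) \<in> D \<Longrightarrow> a \<le> n \<and> c \<le> n"
  using p_le_n by (fastforce simp: dots_iff)

lemma finite_D: "finite D"
  by (rule finite_subset[of _ "{..n} \<times> {..n}"]) (use dots_le_n in auto)

lemma finite_E: "finite E"
proof (rule finite_subset)
  show "E \<subseteq> V \<times> V" by (auto simp: graph_edges_def)
  show "finite (V \<times> V)" using finite_D by (simp add: graph_vertices_def)
qed

section \<open>The regions of the ladder graph\<close>

definition grp :: "nat \<Rightarrow> nat" where
  "grp a = (LEAST i. a \<le> p i)"

lemma grp_eq:
  assumes "i \<le> l" "p i < a" "a \<le> p (Suc i)"
  shows "grp a = Suc i"
  unfolding grp_def
proof (rule Least_equality)
  fix j assume "a \<le> p j"
  then have "p i < p j" using assms by simp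
  then show "Suc i \<le> j" using p_mono[of j i] by (meson Suc_leI leD le_less_linear)
qed (rule assms)

lemma dot_grp:
  assumes "(a, c) \<in> D"
  obtains i where "i < l" "grp a = Suc i" "p i < a" "a \<le> p (Suc i)" "c + p (Suc i) \<le> n"
proof -
  obtain j where j: "1 \<le> j" "j \<le> Suc l" "p (j - 1) < a" "a \<le> p j" "1 \<le> c" "c \<le> n - p j"
    using assms by (auto simp: dots_def)
  have "c + p j \<le> n" using j p_le_n[of j] by simp
  moreover have "j \<noteq> Suc l" using j by auto
  ultimately show thesis using j grp_eq[of "j - 1" a] by (intro that[of "j - 1"]) auto
qed

text \<open>
  The bounded regions of the plane cut out by the graph are the boxes, given by their lower left
  vertices; \<open>Inr i\<close> stands for the region beyond the \<open>i\<close>-th roof, which touches the dots of the roof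
  from the upper right.
\<close>

type_synonym region = "vertex + nat"

definition region_at :: "vertex \<Rightarrow> region" where
  "region_at q = (if q \<in> D \<and> (Suc (fst q), Suc (snd q)) \<notin> V then Inr (grp (fst q)) else Inl q)"

definition regions :: "region set" where
  "regions = Inl ` {(a, c). (a, c) \<in> D \<and> (Suc a, Suc c) \<in> V} \<union> Inr ` {1..l}"

definition region_rank :: "region \<Rightarrow> nat" where
  "region_rank r = (case r of Inl q \<Rightarrow> fst q + snd q | Inr i \<Rightarrow> 2 * n + 2)"

text \<open>
  On the lower left of an edge there is a box or the outer region, but never the region beyond a roof.
  The outer region is represented by every \<open>Inl q\<close> that is not a box.
\<close>

definition upper_region :: "edge \<Rightarrow> region" where
  "upper_region e = region_at (if snd (fst e) = snd (snd e) then fst e else snd e)"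

definition lower_region :: "edge \<Rightarrow> region" where
  "lower_region e = Inl (if snd (fst e) = snd (snd e) then (fst (fst e), snd (fst e) - 1)
     else (fst (snd e) - 1, snd (snd e)))"

lemma upper_region_simps [simp]:
  "upper_region (hedge a c) = region_at (a, c)" "upper_region (vedge a c) = region_at (a, c)"
  by (auto simp: upper_region_def)

lemma lower_region_simps [simp]:
  "lower_region (hedge a c) = Inl (a, c - 1)" "lower_region (vedge a c) = Inl (a - 1, c)"
  by (auto simp: lower_region_def)

lemma region_at_box: "(Suc a, Suc c) \<in> V \<Longrightarrow> region_at (a, c) = Inl (a, c)"
  by (simp add: region_at_def)

lemma Inl_in_regions: "Inl (a, c) \<in> regions \<longleftrightarrow> (a, c) \<in> D \<and> (Suc a, Suc c) \<in> V"
  by (auto simp: regions_def)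

lemma Inr_in_regions: "Inr i \<in> regions \<longleftrightarrow> 1 \<le> i \<and> i \<le> l"
  by (auto simp: regions_def)

lemma region_at_in_regions: "q \<in> D \<Longrightarrow> region_at q \<in> regions"
proof -
  assume q: "q \<in> D"
  obtain a c where ac: "q = (a, c)" by (cases q)
  obtain i where "i < l" "grp a = Suc i" using q dot_grp unfolding ac by blast
  then show ?thesis using q unfolding ac by (auto simp: region_at_def Inl_in_regions Inr_in_regions)
qed

lemma finite_regions: "finite regions"
proof -
  have "finite {(a, c). (a, c) \<in> D \<and> (Suc a, Suc c) \<in> V}"
    by (rule finite_subset[OF _ finite_D]) auto
  then show ?thesis by (simp add: regions_def)
qed

text \<open>The dots on a roof run along the top of one group of columns and then down its right side.\<close>

lemma roof_dot:
  assumes D: "(a, c) \<in> D" and V: "(Suc a, Suc c) \<notin> V" and i: "grp a = Suc i"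
  shows "i < l" "p i < a" "a < p (Suc i) \<and> c + p (Suc i) = n \<or>
    a = p (Suc i) \<and> n < c + p (Suc (Suc i)) \<and> c + p (Suc i) \<le> n"
proof -
  obtain j where j: "j < l" "grp a = Suc j" "p j < a" "a \<le> p (Suc j)" "c + p (Suc j) \<le> n"
    using dot_grp[OF D] .
  then have ij: "j = i" using i by simp
  show "i < l" "p i < a" using j ij by auto
  have c1: "1 \<le> c" using D by (simp add: dots_iff)
  have noD: "\<not> (\<exists>i\<le>Suc l. Suc a \<le> p i \<and> Suc c + p i \<le> n)" using V by (auto simp: V_iff dots_iff)
  have noS: "\<not> is_star j (Suc a) (Suc c)" for j using V by (auto simp: V_iff)
  show "a < p (Suc i) \<and> c + p (Suc i) = n \<or> a = p (Suc i) \<and> n < c + p (Suc (Suc i)) \<and> c + p (Suc i) \<le> n"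
  proof (cases "a < p (Suc i)")
    case True
    then have "\<not> Suc c + p (Suc i) \<le> n" using noD j ij by auto
    then show ?thesis using True j ij by auto
  next
    case False
    then have a: "a = p (Suc i)" using j ij by simp
    have less: "p (Suc i) < p (Suc (Suc i))" using j ij by (intro p_Suc_less) simp
    then have "\<not> Suc c + p (Suc (Suc i)) \<le> n" using noD j ij a by auto
    moreover have "c + p (Suc (Suc i)) \<noteq> n"
      using noS[of "Suc (Suc i)"] a j ij by (auto simp: is_star_def)
    ultimately show ?thesis using a j ij by auto
  qed
qed

lemma roof_dotI:
  assumes i: "i < l" and ac: "p i < a" "1 \<le> c"
    and disj: "a < p (Suc i) \<and> c + p (Suc i) = n \<or>
      a = p (Suc i) \<and> n < c + p (Suc (Suc i)) \<and> c + p (Suc i) \<le> n"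
  shows "(a, c) \<in> D" "(Suc a, Suc c) \<notin> V" "grp a = Suc i"
proof -
  show "grp a = Suc i" using i ac disj by (intro grp_eq) auto
  show "(a, c) \<in> D" using i ac disj by (auto simp: dots_iff intro!: exI[of _ "Suc i"])
  have less: "p (Suc i) < p (Suc (Suc i))" using i by (intro p_Suc_less) simp
  show "(Suc a, Suc c) \<notin> V"
  proof
    assume "(Suc a, Suc c) \<in> V"
    then consider (dot) j where "j \<le> Suc l" "Suc a \<le> p j" "Suc c + p j \<le> n"
      | (star) j where "is_star j (Suc a) (Suc c)" by (auto simp: V_iff dots_iff)
    then show False
    proof cases
      case dot
      then have "p i < p j" using ac by simp
      then have "Suc i \<le> j" using p_less_iff[of i j] dot i by simp
      then have j: "p (Suc i) \<le> p j" by (rule p_mono)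
      have "p (Suc i) < p j" if "a = p (Suc i)" using dot that by simp
      then have "Suc (Suc i) \<le> j" if "a = p (Suc i)" using p_less_iff[of "Suc i" j] dot i that by auto
      then have "p (Suc (Suc i)) \<le> p j" if "a = p (Suc i)" using that p_mono by blast
      then show False using j dot disj by auto
    next
      case star
      then have j: "1 \<le> j" "j \<le> Suc l" "a = p (j - 1)" "c + p j = n" by (auto simp: is_star_def)
      have "p i < p (j - 1)" using ac j by simp
      moreover have "j - 1 \<le> Suc l" "i \<le> Suc l" using i j by linarith+
      ultimately have "Suc i \<le> j - 1" using p_less_iff[of i "j - 1"] by linarith
      then have le: "p (Suc i) \<le> p (j - 1)" by (rule p_mono)
      then have a: "a = p (Suc i)" using disj j by auto
      have "Suc (Suc i) \<le> j" using \<open>Suc i \<le> j - 1\<close> by simp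
      then have "p (Suc (Suc i)) \<le> p j" by (rule p_mono)
      then show False using disj j a by auto
    qed
  qed
qed

lemma roof_hedge_iff:
  assumes D: "(a, c) \<in> D" and V: "(Suc a, Suc c) \<notin> V" and i: "grp a = Suc i"
  shows "(Suc a, c) \<in> V \<longleftrightarrow> a < p (Suc i) \<or> c + p (Suc (Suc i)) = Suc n"
proof -
  note r = roof_dot[OF assms]
  have c: "1 \<le> c" using D by (simp add: dots_iff)
  show ?thesis
  proof (cases "a < p (Suc i)")
    case True
    then have "(Suc a, c) \<in> D" using r c by (auto simp: dots_iff intro!: exI[of _ "Suc i"])
    then show ?thesis using True dots_V by simp
  next
    case False
    then have a: "a = p (Suc i)" "n < c + p (Suc (Suc i))" using r by auto
    have "(Suc a, c) \<notin> D"
    proof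
      assume "(Suc a, c) \<in> D"
      then obtain j where j: "j \<le> Suc l" "Suc a \<le> p j" "c + p j \<le> n" by (auto simp: dots_iff)
      then have "Suc (Suc i) \<le> j" using p_less_iff[of "Suc i" j] r(1) a by auto
      then have "p (Suc (Suc i)) \<le> p j" by (rule p_mono)
      then show False using a j by simp
    qed
    moreover have "(\<exists>j. is_star j (Suc a) c) \<longleftrightarrow> c + p (Suc (Suc i)) = Suc n"
    proof
      assume "\<exists>j. is_star j (Suc a) c"
      then obtain j where j: "1 \<le> j" "j \<le> Suc l" "a = p (j - 1)" "c + p j = Suc n" by (auto simp: is_star_def)
      have "j - 1 \<le> Suc l" "Suc i \<le> Suc l" using j r(1) by linarith+
      note less_iff = p_less_iff[OF this] p_less_iff[OF this(2,1)]
      have "\<not> j - 1 < Suc i" "\<not> Suc i < j - 1"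
        unfolding less_iff[symmetric] using j(3) a(1) by simp_all
      then have "j - 1 = Suc i" by linarith
      then have "j = Suc (Suc i)" by simp
      then show "c + p (Suc (Suc i)) = Suc n" using j by simp
    next
      assume "c + p (Suc (Suc i)) = Suc n"
      then have "is_star (Suc (Suc i)) (Suc a) c" using a r(1) by (simp add: is_star_def)
      then show "\<exists>j. is_star j (Suc a) c" by blast
    qed
    ultimately show ?thesis using False by (simp add: V_iff)
  qed
qed

lemma roof_vedge_iff:
  assumes D: "(a, c) \<in> D" and V: "(Suc a, Suc c) \<notin> V" and i: "grp a = Suc i"
  shows "(a, Suc c) \<in> V \<longleftrightarrow> c + p (Suc i) < n \<or> a = Suc (p i)"
proof -
  note r = roof_dot[OF assms]
  show ?thesis
  proof (cases "c + p (Suc i) < n")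
    case True
    then have "(a, Suc c) \<in> D" using r by (auto simp: dots_iff intro!: exI[of _ "Suc i"])
    then show ?thesis using True dots_V by simp
  next
    case False
    then have c: "c + p (Suc i) = n" using r by auto
    have "(a, Suc c) \<notin> D"
    proof
      assume "(a, Suc c) \<in> D"
      then obtain j where "grp a = Suc j" "Suc c + p (Suc j) \<le> n" by (rule dot_grp)
      then show False using i c by simp
    qed
    moreover have "(\<exists>j. is_star j a (Suc c)) \<longleftrightarrow> a = Suc (p i)"
    proof
      assume "\<exists>j. is_star j a (Suc c)"
      then obtain j where j: "1 \<le> j" "j \<le> Suc l" "a = Suc (p (j - 1))" "c + p j = n" by (auto simp: is_star_def)
      have "j = Suc i"
        using p_less_iff[of j "Suc i"] p_less_iff[of "Suc i" j] j c r(1) by auto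
      then show "a = Suc (p i)" using j by simp
    next
      assume "a = Suc (p i)"
      then have "is_star (Suc i) a (Suc c)" using c r(1) by (simp add: is_star_def)
      then show "\<exists>j. is_star j a (Suc c)" by blast
    qed
    ultimately show ?thesis using False by (simp add: V_iff)
  qed
qed

text \<open>A missing edge does not separate regions: both of its sides belong to the same roof.\<close>

lemma missing_vedge:
  assumes D: "(a, c) \<in> D" and V: "(a, Suc c) \<notin> V"
  shows "1 < a" "(a - 1, c) \<in> D" "region_at (a - 1, c) = region_at (a, c)"
proof -
  have a1: "1 \<le> a" and c1: "1 \<le> c" using D by (auto simp: dots_iff)
  have nb: "(Suc a, Suc c) \<notin> V" using V V_left[of a "Suc c"] a1 dots_V by blast
  obtain i where i: "i < l" "grp a = Suc i" "p i < a" "a \<le> p (Suc i)" "c + p (Suc i) \<le> n"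
    using D by (rule dot_grp)
  have "c + p (Suc i) = n" "a \<noteq> Suc (p i)"
    using V i(5) unfolding roof_vedge_iff[OF D nb i(2)] by auto
  then have a: "p i < a - 1" "a - 1 < p (Suc i)" using i by auto
  show "1 < a" using a by simp
  have "(a - 1, c) \<in> D \<and> (Suc (a - 1), Suc c) \<notin> V \<and> grp (a - 1) = Suc i"
    using roof_dotI[OF i(1) a(1) c1] a \<open>c + p (Suc i) = n\<close> by blast
  then show "(a - 1, c) \<in> D" "region_at (a - 1, c) = region_at (a, c)"
    using D nb i(2) by (auto simp: region_at_def)
qed

lemma missing_hedge:
  assumes D: "(a, c) \<in> D" and V: "(Suc a, c) \<notin> V"
  shows "1 < c" "(a, c - 1) \<in> D" "region_at (a, c - 1) = region_at (a, c)"
proof -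
  have a1: "1 \<le> a" and c1: "1 \<le> c" using D by (auto simp: dots_iff)
  have nb: "(Suc a, Suc c) \<notin> V" using V V_down[of "Suc a" c] c1 dots_V by blast
  obtain i where i: "i < l" "grp a = Suc i" "p i < a" "a \<le> p (Suc i)" "c + p (Suc i) \<le> n"
    using D by (rule dot_grp)
  have *: "\<not> a < p (Suc i)" "c + p (Suc (Suc i)) \<noteq> Suc n"
    using V unfolding roof_hedge_iff[OF D nb i(2)] by auto
  then have r: "a = p (Suc i)" "n < c + p (Suc (Suc i))" using roof_dot[OF D nb i(2)] by auto
  have "p (Suc (Suc i)) \<le> n" using i(1) by (intro p_le_n) simp
  then show c: "1 < c" using r * by simp
  have "(a, c - 1) \<in> D \<and> (Suc a, Suc (c - 1)) \<notin> V"
    using dots_down[OF D a1 order_refl, of "c - 1"] c V by simp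
  then show "(a, c - 1) \<in> D" "region_at (a, c - 1) = region_at (a, c)"
    using D nb by (auto simp: region_at_def)
qed

section \<open>Circulations are differences of region potentials\<close>

lemma lookup_delta:
  assumes "d \<in> D"
  shows "lookup (delta l k e) d = (if snd e = d then 1 else 0) - (if fst e = d then 1 else 0)"
  using assms by (auto simp: delta_def lookup_minus lookup_single when_def)

lemma keys_delta: "keys (delta l k e) \<subseteq> D"
  by (auto simp: keys_subset_iff delta_def lookup_minus lookup_single when_def)

text \<open>
  With coefficients extended by zero to all unit segments of the grid, conservation at a dot can be
  written without distinguishing which of the four segments at the dot are edges.
\<close>

definition flow :: "(edge \<Rightarrow> real) \<Rightarrow> edge \<Rightarrow> real" where
  "flow c e = (if e \<in> E then c e else 0)"

lemma divergence:
  assumes "(Suc a, Suc c) \<in> D"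
  shows "lookup (\<Sum>e\<in>E. f e *\<^sub>R delta l k e) (Suc a, Suc c) =
    flow f (hedge a (Suc c)) + flow f (vedge (Suc a) (Suc c)) - flow f (hedge (Suc a) (Suc c)) - flow f (vedge (Suc a) c)"
proof -
  let ?d = "(Suc a, Suc c)"
  have "lookup (\<Sum>e\<in>E. f e *\<^sub>R delta l k e) ?d =
      (\<Sum>e\<in>E. (if snd e = ?d then f e else 0) - (if fst e = ?d then f e else 0))"
    unfolding lookup_sum by (rule sum.cong) (auto simp: lookup_delta[OF assms])
  also have "\<dots> = (\<Sum>e\<in>E. if snd e = ?d then f e else 0) - (\<Sum>e\<in>E. if fst e = ?d then f e else 0)"
    by (rule sum_subtractf)
  also have "(\<Sum>e\<in>E. if snd e = ?d then f e else 0) = (\<Sum>e\<in>{hedge a (Suc c), vedge (Suc a) (Suc c)}. flow f e)"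
    by (rule sum.mono_neutral_cong[OF _ finite_E]) (auto simp: flow_def elim!: edge_cases)
  also have "\<dots> = flow f (hedge a (Suc c)) + flow f (vedge (Suc a) (Suc c))" by simp
  also have "(\<Sum>e\<in>E. if fst e = ?d then f e else 0) = (\<Sum>e\<in>{hedge (Suc a) (Suc c), vedge (Suc a) c}. flow f e)"
    by (rule sum.mono_neutral_cong[OF _ finite_E]) (auto simp: flow_def elim!: edge_cases)
  also have "\<dots> = flow f (hedge (Suc a) (Suc c)) + flow f (vedge (Suc a) c)" by simp
  finally show ?thesis by simp
qed

lemma flow_nonedge [simp]: "flow f (hedge 0 c) = 0" "flow f (vedge a 0) = 0"
  by (auto simp: flow_def hedge_iff vedge_iff dots_iff)

lemma circulation_iff:
  "(\<Sum>e\<in>E. f e *\<^sub>R delta l k e) = 0 \<longleftrightarrow> (\<forall>a c. (Suc a, Suc c) \<in> D \<longrightarrow>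
    flow f (hedge a (Suc c)) + flow f (vedge (Suc a) (Suc c)) = flow f (hedge (Suc a) (Suc c)) + flow f (vedge (Suc a) c))"
    (is "?S = 0 \<longleftrightarrow> ?C")
proof
  assume S: "?S = 0"
  show ?C
  proof (intro allI impI)
    fix a c assume "(Suc a, Suc c) \<in> D"
    from divergence[OF this, of f]
    show "flow f (hedge a (Suc c)) + flow f (vedge (Suc a) (Suc c)) =
        flow f (hedge (Suc a) (Suc c)) + flow f (vedge (Suc a) c)"
      unfolding S by simp
  qed
next
  assume C: ?C
  show "?S = 0"
  proof (rule poly_mapping_eqI)
    fix d
    show "lookup ?S d = lookup 0 d"
    proof (cases "d \<in> D")
      case True
      obtain a c where d: "d = (Suc a, Suc c)"
        using True by (cases d; cases "fst d"; cases "snd d") (auto simp: dots_iff)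
      show ?thesis using divergence[of a c f] C True unfolding d by simp
    next
      case False
      have "keys ?S \<subseteq> D" by (intro keys_sum_subset keys_scaleR_subset keys_delta)
      then show ?thesis using False by (auto simp: in_keys_iff)
    qed
  qed
qed

definition height :: "(edge \<Rightarrow> real) \<Rightarrow> nat \<Rightarrow> nat \<Rightarrow> real" where
  "height f a c = (\<Sum>a'=1..a. flow f (vedge a' c))"

lemma height_0 [simp]: "height f 0 c = 0" "height f a 0 = 0"
  by (simp_all add: height_def)

lemma height_Suc: "height f (Suc a) c = height f a c + flow f (vedge (Suc a) c)"
  by (simp add: height_def)

text \<open>
  Adding up the vertical flow from the left boundary gives a potential for a circulation, as one
  sees by adding up the conservation laws along a row.
\<close>

lemma hedge_height:
  assumes circ: "(\<Sum>e\<in>E. f e *\<^sub>R delta l k e) = 0" and D: "(a, Suc c) \<in> D"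
  shows "flow f (hedge a (Suc c)) = height f a (Suc c) - height f a c"
proof -
  have "a' \<le> a \<Longrightarrow> flow f (hedge a' (Suc c)) = height f a' (Suc c) - height f a' c" for a'
  proof (induction a')
    case (Suc a')
    then have "(Suc a', Suc c) \<in> D" using dots_down[OF D, of "Suc a'" "Suc c"] by simp
    then have "flow f (hedge a' (Suc c)) + flow f (vedge (Suc a') (Suc c)) =
        flow f (hedge (Suc a') (Suc c)) + flow f (vedge (Suc a') c)"
      using circ unfolding circulation_iff by blast
    then show ?case using Suc by (simp add: height_Suc)
  qed simp
  then show ?thesis by simp
qed

lemma height_roof:
  assumes circ: "(\<Sum>e\<in>E. f e *\<^sub>R delta l k e) = 0"
    and D: "(a, c) \<in> D" and V: "(Suc a, Suc c) \<notin> V" and i: "grp a = Suc i"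
  shows "height f a c = height f (p (Suc i)) (n - p (Suc i))"
  using D V i
proof (induction "(p (Suc i) - a) + (n - c)" arbitrary: a c rule: less_induct)
  case less
  note r = roof_dot[OF less.prems]
  have c1: "1 \<le> c" using less.prems(1) by (simp add: dots_iff)
  from r(3) consider "a < p (Suc i)" "c + p (Suc i) = n"
    | "a = p (Suc i)" "c + p (Suc i) < n" "n < c + p (Suc (Suc i))"
    | "a = p (Suc i)" "c + p (Suc i) = n" by linarith
  then show ?case
  proof cases
    case 1
    have d: "Suc a < p (Suc i) \<and> c + p (Suc i) = n \<or>
        Suc a = p (Suc i) \<and> n < c + p (Suc (Suc i)) \<and> c + p (Suc i) \<le> n"
      using 1 r(1) c1 p_Suc_less[of "Suc i"] by auto
    have "p i < Suc a" using r(2) by simp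
    note next' = roof_dotI[OF r(1) this c1 d]
    have "(Suc a, Suc c) \<notin> V" by (rule less.prems(2))
    then have "flow f (vedge (Suc a) c) = 0" by (simp add: flow_def vedge_iff)
    then have "height f (Suc a) c = height f a c" by (simp add: height_Suc)
    moreover have "height f (Suc a) c = height f (p (Suc i)) (n - p (Suc i))"
      using 1 by (intro less.hyps next') simp
    ultimately show ?thesis by simp
  next
    case 2
    have d: "a < p (Suc i) \<and> Suc c + p (Suc i) = n \<or>
        a = p (Suc i) \<and> n < Suc c + p (Suc (Suc i)) \<and> Suc c + p (Suc i) \<le> n"
      using 2 by auto
    have "1 \<le> Suc c" by simp
    note next' = roof_dotI[OF r(1,2) this d]
    have "flow f (hedge a (Suc c)) = 0"
      using less.prems(2) by (simp add: flow_def hedge_iff)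
    then have "height f a (Suc c) = height f a c" using hedge_height[OF circ next'(1)] by simp
    moreover have "height f a (Suc c) = height f (p (Suc i)) (n - p (Suc i))"
      using 2 by (intro less.hyps next') simp
    ultimately show ?thesis by simp
  next
    case 3
    then have "c = n - p (Suc i)" by simp
    then show ?thesis using 3 by simp
  qed
qed

lemma circulation_potential:
  "(\<Sum>e\<in>E. f e *\<^sub>R delta l k e) = 0 \<longleftrightarrow>
    (\<exists>x. (\<forall>r. r \<notin> regions \<longrightarrow> x r = 0) \<and> (\<forall>e\<in>E. f e = x (upper_region e) - x (lower_region e)))"
proof
  assume circ: "(\<Sum>e\<in>E. f e *\<^sub>R delta l k e) = 0"
  define x where "x r = (if r \<in> regions then
      case r of Inl q \<Rightarrow> height f (fst q) (snd q) | Inr i \<Rightarrow> height f (p i) (n - p i) else 0)" for r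
  have dot: "x (region_at (a, c)) = height f a c" if D: "(a, c) \<in> D" for a c
  proof (cases "(Suc a, Suc c) \<in> V")
    case True
    then show ?thesis using D by (simp add: region_at_box x_def Inl_in_regions)
  next
    case False
    obtain i where i: "grp a = Suc i" using D by (rule dot_grp)
    then have "region_at (a, c) = Inr (Suc i)" using D False by (simp add: region_at_def)
    then show ?thesis
      using region_at_in_regions[OF D] height_roof[OF circ D False i] by (simp add: x_def)
  qed
  have box: "x (Inl (a, c)) = height f a c"
    if "(Suc a, Suc c) \<in> V" "a \<noteq> 0 \<Longrightarrow> c \<noteq> 0 \<Longrightarrow> (a, c) \<in> D" for a c
    using that V_ge_1 by (cases "a = 0 \<or> c = 0") (auto simp: x_def Inl_in_regions dots_iff)
  have "f e = x (upper_region e) - x (lower_region e)" if e: "e \<in> E" for e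
    using e
  proof (cases rule: edge_cases)
    case (h a c)
    obtain c' where c: "c = Suc c'" using h(2) by (cases c) (auto simp: dots_iff)
    have "x (Inl (a, c')) = height f a c'"
      using h(2,3) dots_down[OF h(2), of a c'] by (intro box) (auto simp: c)
    then show ?thesis
      using hedge_height[OF circ, of a c'] h e dot[OF h(2)] by (simp add: c flow_def)
  next
    case (v a c)
    obtain a' where a: "a = Suc a'" using v(2) by (cases a) (auto simp: dots_iff)
    have "x (Inl (a', c)) = height f a' c"
      using v(2,3) dots_down[OF v(2), of a' c] by (intro box) (auto simp: a)
    then show ?thesis
      using height_Suc[of f a' c] v e dot[OF v(2)] by (simp add: a flow_def)
  qed
  then show "\<exists>x. (\<forall>r. r \<notin> regions \<longrightarrow> x r = 0) \<and> (\<forall>e\<in>E. f e = x (upper_region e) - x (lower_region e))"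
    by (intro exI[of _ x]) (auto simp: x_def)
next
  assume "\<exists>x. (\<forall>r. r \<notin> regions \<longrightarrow> x r = 0) \<and> (\<forall>e\<in>E. f e = x (upper_region e) - x (lower_region e))"
  then obtain x where x: "\<And>r. r \<notin> regions \<Longrightarrow> x r = 0" "\<And>e. e \<in> E \<Longrightarrow> f e = x (upper_region e) - x (lower_region e)"
    by blast
  define y where "y a c = (if (a, c) \<in> D then x (region_at (a, c)) else 0)" for a c
  have y_box: "x (Inl (a, c)) = y a c" if "(Suc a, Suc c) \<in> V" for a c
    using that x(1)[of "Inl (a, c)"] by (auto simp: y_def region_at_box Inl_in_regions)
  have flow_v: "flow f (vedge (Suc a) c) = y (Suc a) c - y a c" if D: "(Suc a, c) \<in> D" for a c
  proof (cases "(Suc a, Suc c) \<in> V")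
    case True
    then show ?thesis
      using x(2)[of "vedge (Suc a) c"] D y_box[OF True] by (simp add: flow_def vedge_iff y_def)
  next
    case False
    then show ?thesis
      using missing_vedge[OF D False] D by (simp add: flow_def vedge_iff y_def)
  qed
  have flow_h: "flow f (hedge a (Suc c)) = y a (Suc c) - y a c" if D: "(a, Suc c) \<in> D" for a c
  proof (cases "(Suc a, Suc c) \<in> V")
    case True
    then show ?thesis
      using x(2)[of "hedge a (Suc c)"] D y_box[OF True] by (simp add: flow_def hedge_iff y_def)
  next
    case False
    then show ?thesis
      using missing_hedge[OF D False] D by (simp add: flow_def hedge_iff y_def)
  qed
  have y0: "y 0 c = 0" "y a 0 = 0" for a c by (auto simp: y_def dots_iff)
  have flow_h': "flow f (hedge a (Suc c)) = y a (Suc c) - y a c" if "(Suc a, Suc c) \<in> D" for a c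
  proof (cases "a = 0")
    case False
    then show ?thesis using dots_down[OF that, of a "Suc c"] flow_h by simp
  qed (simp add: y0)
  have flow_v': "flow f (vedge (Suc a) c) = y (Suc a) c - y a c" if "(Suc a, Suc c) \<in> D" for a c
  proof (cases "c = 0")
    case False
    then show ?thesis using dots_down[OF that, of "Suc a" c] flow_v by simp
  qed (simp add: y0)
  show "(\<Sum>e\<in>E. f e *\<^sub>R delta l k e) = 0"
    unfolding circulation_iff using flow_h flow_v flow_h' flow_v' by simp
qed

section \<open>The ladder graph as a system of regions\<close>

definition int_combination :: "(vertex \<Rightarrow>\<^sub>0 real) \<Rightarrow> bool" where
  "int_combination v \<longleftrightarrow> (\<exists>c::edge \<Rightarrow> int. v = (\<Sum>e\<in>E. of_int (c e) *\<^sub>R delta l k e))"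

lemma int_combination_diff:
  assumes "int_combination v" "int_combination w"
  shows "int_combination (v - w)"
proof -
  obtain b c :: "edge \<Rightarrow> int" where "v = (\<Sum>e\<in>E. of_int (b e) *\<^sub>R delta l k e)" "w = (\<Sum>e\<in>E. of_int (c e) *\<^sub>R delta l k e)"
    using assms by (auto simp: int_combination_def)
  then have "v - w = (\<Sum>e\<in>E. of_int (b e - c e) *\<^sub>R delta l k e)"
    by (simp add: scaleR_left.diff sum_subtractf)
  then show ?thesis unfolding int_combination_def by (intro exI[of _ "\<lambda>e. b e - c e"])
qed

lemma int_combination_zero: "int_combination 0"
  unfolding int_combination_def by (intro exI[of _ "\<lambda>_. 0"]) simp

lemma int_combination_edge:
  assumes "e \<in> E"
  shows "int_combination (delta l k e)"
proof -
  have "delta l k e = (\<Sum>e'\<in>E. of_int (if e' = e then 1 else 0) *\<^sub>R delta l k e')"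
    using assms finite_E by (simp add: if_distrib[of "\<lambda>r. real_of_int r *\<^sub>R _"] cong: if_cong)
  then show ?thesis unfolding int_combination_def by (intro exI[of _ "\<lambda>e'. if e' = e then 1 else 0"])
qed

text \<open>From every dot one reaches a star by going right whenever possible and down otherwise.\<close>

lemma int_combination_dot:
  assumes "(a, c) \<in> D"
  shows "int_combination (Poly_Mapping.single (a, c) 1)"
  using assms
proof (induction "(n - a) + c" arbitrary: a c rule: less_induct)
  case less
  show ?case
  proof (cases "(Suc a, c) \<in> V")
    case True
    then have e: "hedge a c \<in> E" using less.prems by (simp add: hedge_iff)
    have target: "int_combination (if (Suc a, c) \<in> D then Poly_Mapping.single (Suc a, c) 1 else 0)"
    proof (cases "(Suc a, c) \<in> D")
      case True
      then have "int_combination (Poly_Mapping.single (Suc a, c) 1)"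
        using dots_le_n[OF True] by (intro less.hyps) auto
      then show ?thesis using True by simp
    qed (simp add: int_combination_zero)
    have "(if (Suc a, c) \<in> D then Poly_Mapping.single (Suc a, c) 1 else 0) - delta l k (hedge a c) =
        Poly_Mapping.single (a, c) 1"
      using less.prems by (auto simp: delta_def)
    then show ?thesis using int_combination_diff[OF target int_combination_edge[OF e]] by simp
  next
    case False
    note m = missing_hedge[OF less.prems False]
    then obtain c' where c: "c = Suc c'" by (cases c) auto
    have e: "vedge a c' \<in> E" using m less.prems dots_V by (simp add: vedge_iff c)
    have target: "int_combination (Poly_Mapping.single (a, c') 1)" using m by (intro less.hyps) (auto simp: c)
    have "Poly_Mapping.single (a, c') 1 - delta l k (vedge a c') = Poly_Mapping.single (a, c) 1"
      using less.prems m by (auto simp: delta_def c)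
    then show ?thesis using int_combination_diff[OF target int_combination_edge[OF e]] by simp
  qed
qed

lemma box_edges:
  assumes "(a, c) \<in> D" "(Suc a, Suc c) \<in> V"
  shows "hedge a c \<in> E" "vedge a c \<in> E" "hedge a (Suc c) \<in> E" "vedge (Suc a) c \<in> E"
proof -
  have "1 \<le> a" "1 \<le> c" using assms(1) by (auto simp: dots_iff)
  then have "(a, Suc c) \<in> D" "(Suc a, c) \<in> D" using V_left V_down assms(2) by auto
  then show "hedge a c \<in> E" "vedge a c \<in> E" "hedge a (Suc c) \<in> E" "vedge (Suc a) c \<in> E"
    using assms dots_V by (auto simp: hedge_iff vedge_iff)
qed

lemma roof_end_edges:
  assumes i: "i < l"
  defines "hi \<equiv> n - p (Suc i)" and "lo \<equiv> Suc n - p (Suc (Suc i))"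
  shows "vedge (Suc (p i)) hi \<in> E" "upper_region (vedge (Suc (p i)) hi) = Inr (Suc i)"
    "hedge (p (Suc i)) lo \<in> E" "upper_region (hedge (p (Suc i)) lo) = Inr (Suc i)"
proof -
  have less: "p i < p (Suc i)" "p (Suc i) < p (Suc (Suc i))" "p (Suc (Suc i)) \<le> n"
    using i by (auto intro: p_Suc_less p_le_n)
  have hi: "1 \<le> hi" "hi + p (Suc i) = n" and lo: "1 \<le> lo" "lo + p (Suc (Suc i)) = Suc n"
    using less by (auto simp: hi_def lo_def)
  have d1: "Suc (p i) < p (Suc i) \<and> hi + p (Suc i) = n \<or>
      Suc (p i) = p (Suc i) \<and> n < hi + p (Suc (Suc i)) \<and> hi + p (Suc i) \<le> n"
    using less hi by linarith
  have d2: "p (Suc i) < p (Suc i) \<and> lo + p (Suc i) = n \<or>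
      p (Suc i) = p (Suc i) \<and> n < lo + p (Suc (Suc i)) \<and> lo + p (Suc i) \<le> n"
    using less lo by linarith
  note r1 = roof_dotI[OF i lessI hi(1) d1] and r2 = roof_dotI[OF i less(1) lo(1) d2]
  show "vedge (Suc (p i)) hi \<in> E" using r1 roof_vedge_iff[OF r1] by (simp add: vedge_iff)
  show "upper_region (vedge (Suc (p i)) hi) = Inr (Suc i)" using r1 by (simp add: region_at_def)
  show "hedge (p (Suc i)) lo \<in> E" using r2 roof_hedge_iff[OF r2] lo by (simp add: hedge_iff)
  show "upper_region (hedge (p (Suc i)) lo) = Inr (Suc i)" using r2 by (simp add: region_at_def)
qed

lemma region_cases:
  assumes "r \<in> regions"
  obtains (box) a c where "r = Inl (a, c)" "(a, c) \<in> D" "(Suc a, Suc c) \<in> V"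
    | (roof) i where "r = Inr (Suc i)" "i < l"
proof (cases r)
  case (Inl q)
  then show thesis using box assms Inl_in_regions by (cases q) auto
next
  case (Inr i)
  then show thesis using roof[of "i - 1"] assms Inr_in_regions by auto
qed

text \<open>
  Potentials that are positive at the head and negative at the tail of one edge single out its
  vertex of the polytope. If one end is a star, the potential vanishes there and the other end gets
  all of the difference, which is halved again along the one other edge that could compete.
\<close>

lemma exposed_delta:
  assumes e: "e \<in> E"
  shows "\<exists>\<phi>. linear \<phi> \<and> \<phi> (delta l k e) = (1::real) \<and> (\<forall>e'\<in>E - {e}. \<phi> (delta l k e') < 1)"
proof -
  have "\<exists>g :: vertex \<Rightarrow> real. (\<forall>q. q \<notin> D \<longrightarrow> g q = 0) \<and> g (snd e) - g (fst e) = 1 \<and>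
      (\<forall>e'\<in>E - {e}. g (snd e') - g (fst e') < 1)"
  proof (cases "fst e \<in> D \<and> snd e \<in> D")
    case True
    have ne: "fst e \<noteq> snd e" using e by (auto elim: edge_cases)
    let ?g = "\<lambda>q. if q = snd e then 1/2 else if q = fst e then - 1/2 else 0 :: real"
    have "?g (snd e') - ?g (fst e') < 1" if "e' \<in> E - {e}" for e'
    proof -
      have "\<not> (snd e' = snd e \<and> fst e' = fst e)" using that by (auto simp: prod_eq_iff)
      then show ?thesis by auto
    qed
    then show ?thesis using True ne by (intro exI[of _ ?g]) auto
  next
    case False
    from e show ?thesis
    proof (cases rule: edge_cases)
      case (v a c)
      then have star: "(a, Suc c) \<notin> D" using False by simp
      let ?b = "(a - 1, c)"
      let ?g = "\<lambda>q. if q = (a, c) then 1 else if q = ?b \<and> ?b \<in> D then 1/2 else 0 :: real"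
      have a1: "1 \<le> a" using v(2) by (simp add: dots_iff)
      have "?g (snd e') - ?g (fst e') < 1" if e': "e' \<in> E - {e}" for e'
      proof (cases "snd e' = (a, c)")
        case True
        have "e' \<in> E" using e' by simp
        then have "fst e' = ?b \<and> ?b \<in> D"
          using True e' v(1) by (cases rule: edge_cases) auto
        then show ?thesis using True a1 by auto
      next
        case False
        have "0 \<le> ?g (fst e')" by simp
        then show ?thesis using False by auto
      qed
      moreover have "\<forall>q. q \<notin> D \<longrightarrow> ?g q = 0" using v(2) by auto
      moreover have "?g (snd e) - ?g (fst e) = 1" using v(1) star by auto
      ultimately show ?thesis by (intro exI[of _ ?g]) blast
    next
      case (h a c)
      then have star: "(Suc a, c) \<notin> D" using False by simp
      let ?b = "(a, c - 1)"
      let ?g = "\<lambda>q. if q = (a, c) then - 1 else if q = ?b \<and> ?b \<in> D then - 1/2 else 0 :: real"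
      have c1: "1 \<le> c" using h(2) by (simp add: dots_iff)
      have "?g (snd e') - ?g (fst e') < 1" if e': "e' \<in> E - {e}" for e'
      proof (cases "fst e' = (a, c)")
        case True
        have "e' \<in> E" using e' by simp
        then have "snd e' = ?b \<and> ?b \<in> D"
          using True e' h(1) by (cases rule: edge_cases) auto
        then show ?thesis using True c1 by auto
      next
        case False
        have "?g (snd e') \<le> 0" by simp
        then show ?thesis using False by auto
      qed
      moreover have "\<forall>q. q \<notin> D \<longrightarrow> ?g q = 0" using h(2) by auto
      moreover have "?g (snd e) - ?g (fst e) = 1" using h(1) star by auto
      ultimately show ?thesis by (intro exI[of _ ?g]) blast
    qed
  qed
  then obtain g :: "vertex \<Rightarrow> real" where g: "\<And>q. q \<notin> D \<Longrightarrow> g q = 0" "g (snd e) - g (fst e) = 1"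
    "\<And>e'. e' \<in> E - {e} \<Longrightarrow> g (snd e') - g (fst e') < 1" by blast
  define \<phi> where "\<phi> v = (\<Sum>q\<in>D. g q * lookup v q)" for v :: "vertex \<Rightarrow>\<^sub>0 real"
  have "linear \<phi>"
    by (rule linearI) (simp_all add: \<phi>_def lookup_add distrib_left sum.distrib sum_distrib_left mult_ac)
  moreover have "\<phi> (delta l k e') = g (snd e') - g (fst e')" for e'
  proof -
    have "\<phi> (delta l k e') = (\<Sum>q\<in>D. (if snd e' = q then g q else 0) - (if fst e' = q then g q else 0))"
      unfolding \<phi>_def by (rule sum.cong) (auto simp: lookup_delta)
    also have "\<dots> = (\<Sum>q\<in>D. if snd e' = q then g q else 0) - (\<Sum>q\<in>D. if fst e' = q then g q else 0)"
      by (rule sum_subtractf)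
    finally show ?thesis using finite_D g(1) by simp
  qed
  ultimately show ?thesis using g(2,3) by (intro exI[of _ \<phi>]) auto
qed

sublocale exposed_edge_regions D E regions upper_region lower_region region_rank "delta l k"
proof
  show "finite D" by (rule finite_D)
  show "finite E" by (rule finite_E)
  show "finite regions" by (rule finite_regions)
  show "regions \<noteq> {}" using l Inr_in_regions[of 1] by auto
  show "upper_region e \<in> regions" if "e \<in> E" for e
    using that by (cases rule: edge_cases) (auto intro: region_at_in_regions)
  show "region_rank (lower_region e) < region_rank (upper_region e)"
    if e: "e \<in> E" "lower_region e \<in> regions" for e
  proof -
    have less: "m < region_rank (region_at (a, c))" if "(a, c) \<in> D" "m < a + c" for a c m
      using dots_le_n[OF that(1)] that by (auto simp: region_at_def region_rank_def)
    from e(1) show ?thesis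
    proof (cases rule: edge_cases)
      case (h a c)
      then have "1 \<le> c" by (simp add: dots_iff)
      then show ?thesis using less[OF h(2), of "a + (c - 1)"] h(1) by (simp add: region_rank_def)
    next
      case (v a c)
      then have "1 \<le> a" by (simp add: dots_iff)
      then show ?thesis using less[OF v(2), of "a - 1 + c"] v(1) by (simp add: region_rank_def)
    qed
  qed
  show "\<exists>e\<in>E. upper_region e = r \<and> e \<noteq> e'" if "r \<in> regions" for r e'
    using that
  proof (cases rule: region_cases)
    case (box a c)
    then show ?thesis
      using box_edges[OF box(2,3)] region_at_box[OF box(3)]
      by (metis (no_types, lifting) Pair_inject n_not_Suc_n upper_region_simps)
  next
    case (roof i)
    note r = roof_end_edges[OF roof(2)]
    have "vedge (Suc (p i)) (n - p (Suc i)) \<noteq> hedge (p (Suc i)) (Suc n - p (Suc (Suc i)))" by simp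
    then show ?thesis using r roof(1) by metis
  qed
  show "card {e\<in>E. lower_region e = r} \<le> card {e\<in>E. upper_region e = r}" if "r \<in> regions" for r
    using that
  proof (cases rule: region_cases)
    case (box a c)
    have "{e\<in>E. lower_region e = r} \<subseteq> {hedge a (Suc c), vedge (Suc a) c}"
      using box(1) by (auto elim!: edge_cases simp: dots_iff)
    then have "card {e\<in>E. lower_region e = r} \<le> card {hedge a (Suc c), vedge (Suc a) c}"
      by (intro card_mono) auto
    also have "\<dots> = card {hedge a c, vedge a c}" by simp
    also have "{hedge a c, vedge a c} \<subseteq> {e\<in>E. upper_region e = r}"
      using box_edges[OF box(2,3)] region_at_box[OF box(3)] box(1) by auto
    then have "card {hedge a c, vedge a c} \<le> card {e\<in>E. upper_region e = r}"
      using finite_E by (intro card_mono) auto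
    finally show ?thesis .
  next
    case (roof i)
    then have none: "{e\<in>E. lower_region e = r} = {}" by (auto simp: lower_region_def)
    show ?thesis unfolding none by simp
  qed
  show "delta l k e \<in> lattice_points D" for e
    using keys_delta[of e] by (auto simp: lattice_points_def delta_def lookup_minus lookup_single when_def)
  show "(\<Sum>e\<in>E. c e *\<^sub>R delta l k e) = 0 \<longleftrightarrow>
      (\<exists>x. (\<forall>r. r \<notin> regions \<longrightarrow> x r = 0) \<and> (\<forall>e\<in>E. c e = x (upper_region e) - x (lower_region e)))" for c
    by (rule circulation_potential)
  show "\<exists>c::edge \<Rightarrow> int. Poly_Mapping.single d 1 = (\<Sum>e\<in>E. of_int (c e) *\<^sub>R delta l k e)" if "d \<in> D" for d
    using int_combination_dot[of "fst d" "snd d"] that by (simp add: int_combination_def)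
  show "\<exists>\<phi>. linear \<phi> \<and> \<phi> (delta l k e) = (1::real) \<and> (\<forall>e'\<in>E - {e}. \<phi> (delta l k e') < 1)" if "e \<in> E" for e
    by (rule exposed_delta[OF that])
qed

section \<open>Roofs and corners\<close>

lemma corner_edges:
  assumes "(a, c) \<in> D" "(Suc a, Suc c) \<in> V"
  shows "corner (a, c) = edges_of (Inl (a, c))"
proof
  show "corner (a, c) \<subseteq> edges_of (Inl (a, c))"
    using box_edges[OF assms] region_at_box[OF assms(2)] by (auto simp: corner_def)
  show "edges_of (Inl (a, c)) \<subseteq> corner (a, c)"
    by (auto simp: corner_def region_at_def split: if_splits elim!: edge_cases)
qed

lemma corners_eq: "corners l k = edges_of ` {r \<in> regions. isl r}"
proof
  show "corners l k \<subseteq> edges_of ` {r \<in> regions. isl r}"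
  proof
    fix C assume "C \<in> corners l k"
    then obtain a c where C: "C = corner (a, c)" "unit_square (a, c) \<subseteq> E" by (auto simp: corners_def)
    then have "hedge a c \<in> E" "hedge a (Suc c) \<in> E" by (auto simp: unit_square_def)
    then have box: "(a, c) \<in> D" "(Suc a, Suc c) \<in> V" by (auto simp: hedge_iff)
    then have "Inl (a, c) \<in> regions" by (simp add: Inl_in_regions)
    then show "C \<in> edges_of ` {r \<in> regions. isl r}"
      unfolding C(1) corner_edges[OF box] by (intro imageI) simp
  qed
  show "edges_of ` {r \<in> regions. isl r} \<subseteq> corners l k"
  proof
    fix C assume "C \<in> edges_of ` {r \<in> regions. isl r}"
    then obtain r where r: "r \<in> regions" "isl r" "C = edges_of r" by blast
    from r(1) show "C \<in> corners l k"
    proof (cases rule: region_cases)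
      case (box a c)
      have "unit_square (a, c) \<subseteq> E" using box_edges[OF box(2,3)] by (simp add: unit_square_def)
      then show ?thesis
        unfolding r(3) box(1) corner_edges[OF box(2,3), symmetric] corners_def by blast
    next
      case (roof i)
      then show ?thesis using r(2) by simp
    qed
  qed
qed

lemma roof_edges:
  assumes i: "i < l"
  shows "roof l k (Suc i) = edges_of (Inr (Suc i))"
proof -
  have less: "p i < p (Suc i)" "p (Suc i) < p (Suc (Suc i))" "p (Suc (Suc i)) \<le> n"
    using i by (auto intro: p_Suc_less p_le_n)
  define hi lo where "hi = n - p (Suc i)" and "lo = Suc (n - p (Suc (Suc i)))"
  have hi: "hi + p (Suc i) = n" and lo: "lo + p (Suc (Suc i)) = Suc n"
    using less by (auto simp: hi_def lo_def)
  have s1: "star l k (Suc i) = (Suc (p i), Suc hi)" by (simp add: star_def hi_def)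
  have s2: "star l k (Suc (Suc i)) = (Suc (p (Suc i)), lo)" by (simp add: star_def lo_def)
  have roof: "roof l k (Suc i) = {vedge (Suc (p i)) hi} \<union> {hedge a hi | a. p i < a \<and> a < p (Suc i)}
      \<union> {vedge (p (Suc i)) c | c. lo \<le> c \<and> c < hi} \<union> {hedge (p (Suc i)) lo}"
    by (auto simp: roof_def Let_def s1 s2 simp flip: hi_def lo_def)
  have dot: "(a, c) \<in> D \<and> (Suc a, Suc c) \<notin> V \<and> grp a = Suc i \<longleftrightarrow>
      p i < a \<and> 1 \<le> c \<and> (a < p (Suc i) \<and> c = hi \<or> a = p (Suc i) \<and> lo \<le> c \<and> c \<le> hi)" for a c
  proof
    assume *: "(a, c) \<in> D \<and> (Suc a, Suc c) \<notin> V \<and> grp a = Suc i"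
    then have "1 \<le> c" by (simp add: dots_iff)
    then show "p i < a \<and> 1 \<le> c \<and> (a < p (Suc i) \<and> c = hi \<or> a = p (Suc i) \<and> lo \<le> c \<and> c \<le> hi)"
      using roof_dot[of a c i] * hi lo by auto
  next
    assume *: "p i < a \<and> 1 \<le> c \<and> (a < p (Suc i) \<and> c = hi \<or> a = p (Suc i) \<and> lo \<le> c \<and> c \<le> hi)"
    then have "a < p (Suc i) \<and> c + p (Suc i) = n \<or>
        a = p (Suc i) \<and> n < c + p (Suc (Suc i)) \<and> c + p (Suc i) \<le> n"
      using hi lo by auto
    then show "(a, c) \<in> D \<and> (Suc a, Suc c) \<notin> V \<and> grp a = Suc i"
      using roof_dotI[OF i, of a c] * by blast
  qed
  have reg: "region_at q = Inr (Suc i) \<longleftrightarrow> q \<in> D \<and> (Suc (fst q), Suc (snd q)) \<notin> V \<and> grp (fst q) = Suc i" for q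
    by (auto simp: region_at_def)
  have hi1: "1 \<le> hi" and lo1: "1 \<le> lo" "lo \<le> hi" using less by (auto simp: hi_def lo_def)
  have horizontal: "hedge a c \<in> edges_of (Inr (Suc i)) \<longleftrightarrow>
      p i < a \<and> a < p (Suc i) \<and> c = hi \<or> a = p (Suc i) \<and> c = lo" for a c
  proof -
    have "hedge a c \<in> edges_of (Inr (Suc i)) \<longleftrightarrow>
        ((a, c) \<in> D \<and> (Suc a, Suc c) \<notin> V \<and> grp a = Suc i) \<and> (a < p (Suc i) \<or> c = lo)"
      using roof_hedge_iff[of a c i] lo by (auto simp: reg hedge_iff)
    then show ?thesis unfolding dot using hi1 lo1 less by auto
  qed
  have vertical: "vedge a c \<in> edges_of (Inr (Suc i)) \<longleftrightarrow>
      a = Suc (p i) \<and> c = hi \<or> a = p (Suc i) \<and> lo \<le> c \<and> c < hi" for a c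
  proof -
    have "vedge a c \<in> edges_of (Inr (Suc i)) \<longleftrightarrow>
        ((a, c) \<in> D \<and> (Suc a, Suc c) \<notin> V \<and> grp a = Suc i) \<and> (c < hi \<or> a = Suc (p i))"
      using roof_vedge_iff[of a c i] hi by (auto simp: reg vedge_iff)
    then show ?thesis unfolding dot using hi1 lo1 less by auto
  qed
  show ?thesis
  proof
    show "roof l k (Suc i) \<subseteq> edges_of (Inr (Suc i))" unfolding roof using horizontal vertical by blast
    show "edges_of (Inr (Suc i)) \<subseteq> roof l k (Suc i)"
    proof
      fix e assume e: "e \<in> edges_of (Inr (Suc i))"
      then have "e \<in> E" by simp
      then show "e \<in> roof l k (Suc i)"
      proof (cases rule: edge_cases)
        case (h a c)
        then show ?thesis using e horizontal[of a c] unfolding roof by blast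
      next
        case (v a c)
        then show ?thesis using e vertical[of a c] unfolding roof by blast
      qed
    qed
  qed
qed

lemma roofs_eq: "roofs l k = edges_of ` {r \<in> regions. \<not> isl r}"
proof
  show "roofs l k \<subseteq> edges_of ` {r \<in> regions. \<not> isl r}"
  proof
    fix C assume "C \<in> roofs l k"
    then obtain j where j: "1 \<le> j" "j \<le> l" "C = roof l k j" by (auto simp: roofs_def)
    then obtain i where i: "j = Suc i" "i < l" by (cases j) auto
    have "Inr (Suc i) \<in> regions" using i by (simp add: Inr_in_regions)
    then show "C \<in> edges_of ` {r \<in> regions. \<not> isl r}"
      unfolding j(3) i(1) roof_edges[OF i(2)] by (intro imageI) simp
  qed
  show "edges_of ` {r \<in> regions. \<not> isl r} \<subseteq> roofs l k"
  proof
    fix C assume "C \<in> edges_of ` {r \<in> regions. \<not> isl r}"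
    then obtain r where r: "r \<in> regions" "\<not> isl r" "C = edges_of r" by blast
    from r(1) show "C \<in> roofs l k"
    proof (cases rule: region_cases)
      case (box a c)
      then show ?thesis using r(2) by simp
    next
      case (roof i)
      then show ?thesis
        unfolding r(3) roof(1) roof_edges[OF roof(2), symmetric] roofs_def by (intro imageI) simp
    qed
  qed
qed

lemma maximal_generators_eq: "maximal_generators l k = gens ` selectors"
proof
  have "roofs l k \<union> corners l k = edges_of ` regions"
    unfolding roofs_eq corners_eq by blast
  then have maximal_iff: "G \<in> maximal_generators l k \<longleftrightarrow> G \<subseteq> E \<and> (\<forall>r\<in>regions. \<exists>!e. e \<in> edges_of r - G)" for G
    unfolding maximal_generators_def by (simp only: mem_Collect_eq ball_simps)
  show "gens ` selectors \<subseteq> maximal_generators l k"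
  proof clarify
    fix s assume s: "s \<in> selectors"
    have "\<exists>!e. e \<in> edges_of r - gens s" if r: "r \<in> regions" for r
    proof (rule ex1I[of _ "s r"])
      show "s r \<in> edges_of r - gens s" using selector_mem[OF s r] r by (auto simp: gens_def)
      fix e assume "e \<in> edges_of r - gens s"
      then obtain r' where "r' \<in> regions" "e = s r'" "upper_region e = r" by (auto simp: gens_def)
      then show "e = s r" using selector_mem[OF s] by auto
    qed
    then show "gens s \<in> maximal_generators l k"
      unfolding maximal_iff by (intro conjI ballI gens_subset)
  qed
  show "maximal_generators l k \<subseteq> gens ` selectors"
  proof
    fix G assume "G \<in> maximal_generators l k"
    then have G: "G \<subseteq> E" "\<And>r. r \<in> regions \<Longrightarrow> \<exists>!e. e \<in> edges_of r - G"
      unfolding maximal_iff by simp_all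
    define s where "s = restrict (\<lambda>r. THE e. e \<in> edges_of r - G) regions"
    have s: "s r \<in> edges_of r - G" "\<And>e. e \<in> edges_of r - G \<Longrightarrow> e = s r" if r: "r \<in> regions" for r
    proof -
      have eq: "s r = (THE e. e \<in> edges_of r - G)" using r by (simp add: s_def)
      show "s r \<in> edges_of r - G" unfolding eq by (rule theI'[OF G(2)[OF r]])
      then show "e = s r" if "e \<in> edges_of r - G" for e using that G(2)[OF r] by blast
    qed
    have "s \<in> selectors" using s(1) by (auto simp: selectors_def s_def)
    moreover have "gens s = G"
    proof
      show "G \<subseteq> gens s" using G(1) s(1) by (auto simp: gens_def)
      show "gens s \<subseteq> G"
      proof
        fix e assume e: "e \<in> gens s"
        then have "e \<in> E" "upper_region e \<in> regions" using ur by (auto simp: gens_def)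
        then show "e \<in> G" using s(2)[of "upper_region e" e] e by (auto simp: gens_def)
      qed
    qed
    ultimately show "G \<in> gens ` selectors" by blast
  qed
qed

lemma Sigma_hat_eq: "Sigma_hat l k = fine_fan"
  unfolding Sigma_hat_def fine_fan_def maximal_generators_eq by blast

lemma Sigma_fan_eq: "Sigma_fan l k = coarse_fan"
  unfolding Sigma_fan_def Delta_def by (rule face_fan_eq_coarse_fan)

end

theorem proposition3p1p2:
  fixes l :: nat and k :: "nat \<Rightarrow> nat"
  assumes "l \<ge> 1"
    and "\<forall>i\<in>{1..l+1}. k i > 0"
  shows "fan_refinement (dots l k) (Sigma_hat l k) (Sigma_fan l k) \<and>
         smooth_toric_variety (dots l k) (Sigma_hat l k) \<and>
         contracts_no_divisor
           (zariski (dots l k) (Sigma_hat l k)) (zariski (dots l k) (Sigma_fan l k))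
           (toric_morphism (dots l k) (Sigma_fan l k))"
proof -
  interpret ladder l k using assms by unfold_locales
  show ?thesis unfolding Sigma_hat_eq Sigma_fan_eq by (rule small_desingularization)
qed

end
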